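(* Let $D\subset\mathbb R^d$, $d\in\{2,3\}$, be a bounded Lipschitz domain, $(\Omega,\mathcal F,\mathbb P)$ a probability space, and $a:D\times\Omega\to\mathbb R$ a random field with constants $0<a_{\min}<a_{\max}<\infty$ such that $a_{\min}<a(x,\omega)<a_{\max}$ for all $(x,\omega)\in D\times\Omega$. Let $y_D\in L^2(D)$, $\lambda\ge0$, and $C=\mathcal U_{ad}=\{u\in L^2(D):u_a\le u\le u_b\text{ a.e. in }D\}$. For $u\in L^2(D)$ and $\omega\in\Omega$ let $y(\cdot,\omega)\in H_0^1(D)$ solve $\int_Da(x,\omega)\nabla y\cdot\nabla v\,dx=\int_Duv\,dx$ for all $v\in H_0^1(D)$, and let $$j(u)=\mathbb E\Big[\tfrac12\|y(\cdot,\omega)-y_D\|_{L^2(D)}^2\Big]+\tfrac\lambda2\|u\|_{L^2(D)}^2.$$ Consider the following algorithm: choose $u_1\in L^2(D)$; for $n=1,2,\dots$, generate a realization $a(\cdot,\omega_n)$ independent of previous realizations; let $y_n\in H_0^1(D)$ solve $\int_Da(x,\omega_n)\nabla y_n\cdot\nabla v\,dx=\int_Du_nv\,dx$ for all $v\in H_0^1(D)$; let $p_n\in H_0^1(D)$ solve $\int_Da(x,\omega_n)\nabla v\cdot\nabla p_n\,dx=\int_D(y_D-y_n)v\,dx$ for all $v\in H_0^1(D)$; set $G(u_n,\omega_n)=\lambda u_n-p_n$ and $u_{n+1}=\pi_{\mathcal U_{ad}}(u_n-\tau_nG(u_n,\omega_n))$, where $\pi_{\mathcal U_{ad}}$ is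 the $L^2(D)$-projection onto $\mathcal U_{ad}$ and the deterministic step sizes $\tau_n>0$ satisfy $\sum_n\tau_n=\infty$ and $\sum_n\tau_n^2<\infty$. Then the sequence $\{u_n\}$: 1. converges strongly in $L^2(D)$ almost surely to the unique minimizer $\bar u$ of $j$ over $\mathcal U_{ad}$, if $\lambda\neq0$; 2. converges weakly in $L^2(D)$ almost surely to a point in $S=\{u\in\mathcal U_{ad}: j(u)\le j(w)\ \forall w\in\mathcal U_{ad}\}$, if $\lambda=0$.
   Context: The bounds $u_a,u_b\in L^2(D)$ satisfy $u_a\le u_b$ a.e., so that $\mathcal U_{ad}$ is a nonempty, bounded, closed, convex subset of $L^2(D)$; the random field $a$ is assumed measurable so that the expectation defining $j$ is well defined. $H_0^1(D)$ is the closure of $C_0^\infty(D)$ in $H^1(D)$. *)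

theory Defs
  imports "HOL-Analysis.Analysis" "HOL-Probability.Probability"
begin

text \<open>A bounded Lipschitz domain: a bounded, open, connected set whose boundary is
  locally the (strict) subgraph of a Lipschitz function in a suitably rotated
  coordinate system (direction nu is the local vertical direction).\<close>
definition lipschitz_domain :: "'a::euclidean_space set \<Rightarrow> bool" where
  "lipschitz_domain D \<longleftrightarrow> open D \<and> connected D \<and> bounded D \<and> D \<noteq> {} \<and>
    (\<forall>x0\<in>frontier D. \<exists>r>0. \<exists>nu::'a. \<exists>L. \<exists>\<gamma>::'a \<Rightarrow> real.
        norm nu = 1 \<and> lipschitz_on L UNIV \<gamma> \<and>
        (\<forall>x\<in>ball x0 r. x \<in> D \<longleftrightarrow>
            (x - x0) \<bullet> nu < \<gamma> ((x - x0) - ((x - x0) \<bullet> nu) *\<^sub>R nu)))"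

definition L2 :: "'a::euclidean_space set \<Rightarrow> ('a \<Rightarrow> real) set" where
  "L2 D = {f. f \<in> borel_measurable (lebesgue_on D) \<and>
                 integrable (lebesgue_on D) (\<lambda>x. (f x)\<^sup>2)}"

definition L2_inner :: "'a::euclidean_space set \<Rightarrow> ('a \<Rightarrow> real) \<Rightarrow> ('a \<Rightarrow> real) \<Rightarrow> real" where
  "L2_inner D f g = integral\<^sup>L (lebesgue_on D) (\<lambda>x. f x * g x)"

definition L2_norm :: "'a::euclidean_space set \<Rightarrow> ('a \<Rightarrow> real) \<Rightarrow> real" where
  "L2_norm D f = sqrt (integral\<^sup>L (lebesgue_on D) (\<lambda>x. (f x)\<^sup>2))"

definition smooth_fun :: "('a::euclidean_space \<Rightarrow> real) \<Rightarrow> bool" where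
  "smooth_fun \<phi> \<longleftrightarrow> (\<exists>S. \<phi> \<in> S \<and> (\<forall>f\<in>S. (\<forall>x. f differentiable (at x)) \<and>
      (\<forall>b\<in>Basis. (\<lambda>x. frechet_derivative f (at x) b) \<in> S)))"

definition grad :: "('a::euclidean_space \<Rightarrow> real) \<Rightarrow> 'a \<Rightarrow> 'a" where
  "grad \<phi> x = (\<Sum>b\<in>Basis. frechet_derivative \<phi> (at x) b *\<^sub>R b)"

definition test_fun :: "'a::euclidean_space set \<Rightarrow> ('a \<Rightarrow> real) \<Rightarrow> bool" where
  "test_fun D \<phi> \<longleftrightarrow> smooth_fun \<phi> \<and> compact (closure {x. \<phi> x \<noteq> 0}) \<and>
      closure {x. \<phi> x \<noteq> 0} \<subseteq> D"

definition weak_gradient :: "'a::euclidean_space set \<Rightarrow> ('a \<Rightarrow> real) \<Rightarrow> ('a \<Rightarrow> 'a) \<Rightarrow> bool" where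
  "weak_gradient D y g \<longleftrightarrow> (\<forall>\<phi>. test_fun D \<phi> \<longrightarrow> (\<forall>b\<in>Basis.
      integral\<^sup>L (lebesgue_on D) (\<lambda>x. y x * frechet_derivative \<phi> (at x) b)
      = - integral\<^sup>L (lebesgue_on D) (\<lambda>x. (g x \<bullet> b) * \<phi> x)))"

definition H01_grad :: "'a::euclidean_space set \<Rightarrow> ('a \<Rightarrow> real) \<Rightarrow> ('a \<Rightarrow> 'a) \<Rightarrow> bool" where
  "H01_grad D y g \<longleftrightarrow> y \<in> L2 D \<and> (\<forall>b\<in>Basis. (\<lambda>x. g x \<bullet> b) \<in> L2 D) \<and>
      weak_gradient D y g \<and>
      (\<exists>\<phi>. (\<forall>k. test_fun D (\<phi> k)) \<and>
         (\<lambda>k. L2_norm D (\<lambda>x. \<phi> k x - y x)) \<longlonglongrightarrow> 0 \<and>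
         (\<lambda>k. L2_norm D (\<lambda>x. norm (grad (\<phi> k) x - g x))) \<longlonglongrightarrow> 0)"

definition weak_sol :: "'a::euclidean_space set \<Rightarrow> ('a \<Rightarrow> real) \<Rightarrow> ('a \<Rightarrow> real) \<Rightarrow> ('a \<Rightarrow> real) \<Rightarrow> bool" where
  "weak_sol D A f y \<longleftrightarrow> (\<exists>g. H01_grad D y g \<and>
     (\<forall>v gv. H01_grad D v gv \<longrightarrow>
        integral\<^sup>L (lebesgue_on D) (\<lambda>x. A x * (g x \<bullet> gv x)) = integral\<^sup>L (lebesgue_on D) (\<lambda>x. f x * v x)))"

definition adj_sol :: "'a::euclidean_space set \<Rightarrow> ('a \<Rightarrow> real) \<Rightarrow> ('a \<Rightarrow> real) \<Rightarrow> ('a \<Rightarrow> real) \<Rightarrow> bool" where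
  "adj_sol D A f p \<longleftrightarrow> (\<exists>g. H01_grad D p g \<and>
     (\<forall>v gv. H01_grad D v gv \<longrightarrow>
        integral\<^sup>L (lebesgue_on D) (\<lambda>x. A x * (gv x \<bullet> g x)) = integral\<^sup>L (lebesgue_on D) (\<lambda>x. f x * v x)))"

definition Uad :: "'a::euclidean_space set \<Rightarrow> ('a \<Rightarrow> real) \<Rightarrow> ('a \<Rightarrow> real) \<Rightarrow> ('a \<Rightarrow> real) set" where
  "Uad D ua ub = {u \<in> L2 D. AE x in lebesgue_on D. ua x \<le> u x \<and> u x \<le> ub x}"

text \<open>The state y(.,omega) for control u (a solution of the state equation; it is unique
  as an element of H_0^1(D), and the objective only depends on its class).\<close>
definition state :: "'a::euclidean_space set \<Rightarrow> ('a \<Rightarrow> 'w \<Rightarrow> real) \<Rightarrow> 'w \<Rightarrow> ('a \<Rightarrow> real) \<Rightarrow> ('a \<Rightarrow> real)" where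
  "state D a \<omega> u = (SOME y. weak_sol D (\<lambda>x. a x \<omega>) u y)"

definition jfun :: "'a::euclidean_space set \<Rightarrow> 'w measure \<Rightarrow> ('a \<Rightarrow> 'w \<Rightarrow> real) \<Rightarrow> ('a \<Rightarrow> real)
                    \<Rightarrow> real \<Rightarrow> ('a \<Rightarrow> real) \<Rightarrow> real" where
  "jfun D M a yD lam u =
     (\<integral>\<omega>. 1/2 * (L2_norm D (\<lambda>x. state D a \<omega> u x - yD x))\<^sup>2 \<partial>M) + lam / 2 * (L2_norm D u)\<^sup>2"

end

theory Submission
  imports Defs
begin

text \<open>
  For a fixed coefficient the solution operator T of the state equation is a bounded self-adjoint
  operator on L2, the adjoint state is p = T (yD - T u), and the stochastic gradient is
  G = lam u - T (yD - T u). Pointwise convexity gives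
  G \<bullet> (u - w) \<ge> J(u) - J(w) for the sampled objective J, so nonexpansiveness of the projection yields
  |u_{n+1} - w|^2 \<le> |u_n - w|^2 - 2 tau_n (j(u_n) - j(w)) + O(tau_n^2) - 2 X_n
  with martingale differences X_n of size O(tau_n). The series of the X_n converges almost surely by
  Kolmogorov's inequality; hence |u_n - w| converges for every minimizer w and
  tau_n (j(u_n) - j(w)) is summable. As j(u_n) varies at most by O(tau_n) per step and
  the sum of the tau_n diverges, j(u_n) tends to the minimum. For lam > 0 strong convexity gives
  strong convergence; for lam = 0 Opial's argument gives weak convergence.

  The measurability of the iterates, which are not assumed to be measurable functions of the sample,
  rests on two facts: L2 is separable, and T depends continuously on the pair
  (coefficient, right-hand side) in L2.
\<close>


subsection \<open>Hilbert spaces\<close>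

text \<open>The subgradient inequality is applied sample by sample, before any averaging. The error
  is then a difference of objective values, not of gradients, so the martingale differences are
  bounded real numbers and no vector-valued conditional expectation occurs. The price is that the
  noise, and hence its null set, depends on the comparison point w; for lam = 0 there may be
  uncountably many minimizers, so only a countable dense set of them is used directly. The starting
  control may lie outside the admissible set. The gap to the minimum can then be negative and the
  first step need not be of size O(tau), so the descent arguments start one index later. The
  convergence analysis lives in a type class of Hilbert spaces, which forces L2 to be a type:
  classes of square integrable functions on the whole space, with functions on D extended by zero.
  H01 becomes a closed subspace of the product of the spaces for functions and for gradients, and
  one existence theorem for variational inequalities yields both the metric projection and the
  solution operator.\<close>

lemma Cauchy_if_sq_dist_le:
  fixes x :: "nat \<Rightarrow> 'h::real_inner"
  assumes "\<And>m n. m \<le> n \<Longrightarrow> (norm (x m - x n))\<^sup>2 \<le> r m" and "r \<longlonglongrightarrow> 0"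
  shows "Cauchy x"
proof (rule metric_CauchyI)
  fix e :: real assume "e > 0"
  then have "eventually (\<lambda>m. r m < (e/2)^2) sequentially"
    using assms(2) by (intro order_tendstoD) auto
  then obtain N where N: "\<And>m. m \<ge> N \<Longrightarrow> r m < (e/2)^2"
    by (auto simp: eventually_sequentially)
  have *: "norm (x N - x n) < e/2" if "n \<ge> N" for n
  proof -
    have "(norm (x N - x n))\<^sup>2 < (e/2)^2"
      using assms(1)[OF that] N[of N] by simp
    then show ?thesis using \<open>e > 0\<close> by (intro power_less_imp_less_base[of _ 2 "e/2"]) auto
  qed
  show "\<exists>M. \<forall>m\<ge>M. \<forall>n\<ge>M. dist (x m) (x n) < e"
  proof (intro exI allI impI)
    fix m n assume "N \<le> m" "N \<le> n"
    then show "dist (x m) (x n) < e"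
      using *[of m] *[of n] dist_triangle_half_r[of "x N" "x m" e "x n"]
      by (simp add: dist_norm)
  qed
qed

text \<open>Stampacchia's theorem for symmetric forms: by the parallelogram law every minimizing sequence
  of the energy is Cauchy.\<close>

lemma variational_inequality_exists:
  fixes B :: "'h::{real_inner,complete_space} \<Rightarrow> 'h \<Rightarrow> real"
  assumes B: "bounded_bilinear B" and sym: "\<And>x y. B x y = B y x"
    and l: "bounded_linear l"
    and C: "closed C" "convex C" "C \<noteq> {}"
    and c: "c > 0" and coercive: "\<And>x y. x \<in> C \<Longrightarrow> y \<in> C \<Longrightarrow> c * (norm (x - y))\<^sup>2 \<le> B (x - y) (x - y)"
  obtains x where "x \<in> C" "\<And>v. v \<in> C \<Longrightarrow> l (v - x) \<le> B x (v - x)"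
proof -
  interpret B: bounded_bilinear B by fact
  interpret l: bounded_linear l by fact
  define F where "F x = B x x - 2 * l x" for x
  note lin = B.add_left B.add_right B.diff_left B.diff_right B.scaleR_left B.scaleR_right
    l.add l.diff l.scaleR
  have expand: "F (z + h) = F z + 2 * (B z h - l h) + B h h" for z h
    using sym[of z h] by (simp add: F_def lin algebra_simps)
  obtain z where z: "z \<in> C" using C by auto
  obtain K1 where K1: "\<And>a b. norm (B a b) \<le> norm a * norm b * K1"
    using B.pos_bounded by auto
  obtain K2 where K2: "\<And>a. norm (l a) \<le> norm a * K2"
    using l.pos_bounded by auto
  define k where "k = norm z * K1 + K2"
  \<comment> \<open>Completing the square in \<open>norm h\<close>: coercivity contributes
    \<open>c * (norm h)^2\<close>, the linear terms at least \<open>- 2 * (k * norm h)\<close>, and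
    the minimum over \<open>norm h\<close> is \<open>- k^2 / c\<close>.\<close>
  have lower: "F z - k^2 / c \<le> F x" if "x \<in> C" for x
  proof -
    define h where "h = x - z"
    have "\<bar>B z h\<bar> \<le> norm z * norm h * K1" "\<bar>l h\<bar> \<le> norm h * K2"
      using K1[of z h] K2[of h] by auto
    then have "- (k * norm h) \<le> B z h - l h"
      by (simp add: k_def algebra_simps)
    moreover have "c * (norm h)^2 \<le> B h h"
      using coercive[OF that z] by (simp add: h_def)
    moreover have "c * (norm h)^2 - 2 * (k * norm h) + k^2 / c = c * (norm h - k/c)^2"
      using c by (simp add: field_simps power2_eq_square)
    moreover have "0 \<le> c * (norm h - k/c)^2" using c by simp
    ultimately show ?thesis
      using expand[of z h] by (simp add: h_def)
  qed
  define d where "d = (INF x\<in>C. F x)"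
  have bdd: "bdd_below (F ` C)"
    using lower by (auto intro!: bdd_belowI)
  have d_le: "d \<le> F x" if "x \<in> C" for x
    unfolding d_def using bdd that by (rule cINF_lower)
  have "\<exists>x\<in>C. F x < d + inverse (Suc n)" for n
  proof -
    have "(INF x\<in>C. F x) < d + inverse (Suc n)" by (simp add: d_def)
    then show ?thesis using cINF_less_iff[OF C(3) bdd] by auto
  qed
  then obtain x where x: "\<And>n. x n \<in> C" "\<And>n. F (x n) < d + inverse (real (Suc n))"
    by metis
  have "(norm (x m - x n))\<^sup>2 \<le> 4 / c * inverse (real (Suc m))" if "m \<le> n" for m n
  proof -
    define p where "p = (1/2) *\<^sub>R x m + (1/2) *\<^sub>R x n"
    have "p \<in> C"
      unfolding p_def using C(2) x by (intro convexD) auto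
    then have "d \<le> F p" by (rule d_le)
    \<comment> \<open>Both values exceed \<open>d\<close> by less than
      \<open>inverse (real (Suc m))\<close>, while \<open>F p\<close> is at least \<open>d\<close>.
      The gap is thus at most twice that amount, and the division by 2 on the right produces the
      factor 4.\<close>
    moreover have "F (x m) + F (x n) - 2 * F p = B (x m - x n) (x m - x n) / 2"
      using sym[of "x m" "x n"] by (simp add: F_def p_def lin algebra_simps)
    moreover have "F (x n) < d + inverse (real (Suc m))"
      using x(2)[of n] that le_imp_inverse_le[of "real (Suc m)" "real (Suc n)"] by linarith
    ultimately have "B (x m - x n) (x m - x n) \<le> 4 * inverse (real (Suc m))"
      using x(2)[of m] by linarith
    then have "c * (norm (x m - x n))\<^sup>2 \<le> 4 * inverse (real (Suc m))"
      using coercive[OF x(1) x(1), of m n] by linarith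
    then show ?thesis using c by (simp add: pos_le_divide_eq mult.commute)
  qed
  moreover have "(\<lambda>m. 4 / c * inverse (real (Suc m))) \<longlonglongrightarrow> 0"
    using tendsto_mult[OF tendsto_const LIMSEQ_inverse_real_of_nat, of "4/c"] by simp
  ultimately have "Cauchy x" by (rule Cauchy_if_sq_dist_le)
  then obtain y where y: "x \<longlonglongrightarrow> y"
    using Cauchy_convergent convergent_def by blast
  have yC: "y \<in> C" using closed_sequentially[OF C(1)] x(1) y by blast
  have "(\<lambda>n. F (x n)) \<longlonglongrightarrow> F y"
    unfolding F_def by (intro tendsto_intros B.tendsto l.tendsto y)
  moreover have "(\<lambda>n. d + inverse (real (Suc n))) \<longlonglongrightarrow> d + 0"
    by (intro tendsto_intros LIMSEQ_inverse_real_of_nat)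
  ultimately have "F y \<le> d"
    using LIMSEQ_le[of "\<lambda>n. F (x n)" "F y" "\<lambda>n. d + inverse (real (Suc n))" d] x(2)
    by (auto intro: less_imp_le)
  have "l (v - y) \<le> B y (v - y)" if v: "v \<in> C" for v
  proof -
    define h where "h = v - y"
    \<comment> \<open>First-order condition: \<open>y\<close> is compared with points at parameter
      \<open>t\<close> on the segment towards \<open>v\<close>, the inequality is divided by
      \<open>t\<close>, and \<open>t\<close> tends to 0 along
      \<open>inverse (real (Suc n))\<close>.\<close>
    have ineq: "0 \<le> 2 * (B y h - l h) + inverse (real (Suc n)) * B h h" for n
    proof -
      define t where "t = inverse (real (Suc n))"
      have t: "0 < t" "t \<le> 1" by (auto simp: t_def inverse_le_1_iff)
      have "y + t *\<^sub>R h \<in> C"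
        using convexD_alt[OF C(2) yC v, of t] t by (simp add: h_def algebra_simps)
      then have "F y \<le> F (y + t *\<^sub>R h)" using d_le \<open>F y \<le> d\<close> by force
      then have "0 \<le> t * (2 * (B y h - l h) + t * B h h)"
        using expand[of y "t *\<^sub>R h"] by (simp add: lin algebra_simps)
      then show ?thesis using t(1) unfolding t_def[symmetric] by (simp add: zero_le_mult_iff)
    qed
    have "(\<lambda>n. 2 * (B y h - l h) + inverse (real (Suc n)) * B h h) \<longlonglongrightarrow> 2 * (B y h - l h) + 0 * B h h"
      by (intro tendsto_intros LIMSEQ_inverse_real_of_nat)
    then have "0 \<le> 2 * (B y h - l h) + 0 * B h h"
      using ineq by (intro LIMSEQ_le_const[of _ _ 0]) auto
    then show ?thesis by (simp add: h_def)
  qed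
  then show ?thesis using that yC by blast
qed

section \<open>Metric projection onto closed convex sets\<close>

definition hproj :: "'h::{real_inner,complete_space} set \<Rightarrow> 'h \<Rightarrow> 'h" where
  "hproj C x = (SOME p. p \<in> C \<and> (\<forall>v\<in>C. (x - p) \<bullet> (v - p) \<le> 0))"

text \<open>Stampacchia with the inner product as the form and the functional given by
  \<open>x\<close>. The obtuse-angle inequality serves as the defining property because
  nonexpansiveness follows from it directly; the link to minimal distance is
  \<open>hproj_eqI\<close>.\<close>

lemma
  fixes C :: "'h::{real_inner,complete_space} set"
  assumes C: "closed C" "convex C" "C \<noteq> {}"
  shows hproj_in: "hproj C x \<in> C"
    and hproj_inner: "v \<in> C \<Longrightarrow> (x - hproj C x) \<bullet> (v - hproj C x) \<le> 0"
proof -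
  obtain p where p: "p \<in> C" "\<And>v. v \<in> C \<Longrightarrow> x \<bullet> (v - p) \<le> p \<bullet> (v - p)"
    using variational_inequality_exists[OF bounded_bilinear_inner inner_commute
        bounded_linear_inner_right C zero_less_one, of x]
    by (auto simp: power2_norm_eq_inner)
  have "hproj C x \<in> C \<and> (\<forall>v\<in>C. (x - hproj C x) \<bullet> (v - hproj C x) \<le> 0)"
    unfolding hproj_def
    by (rule someI[of _ p]) (use p in \<open>auto simp: inner_diff_left\<close>)
  then show "hproj C x \<in> C" "v \<in> C \<Longrightarrow> (x - hproj C x) \<bullet> (v - hproj C x) \<le> 0"
    by auto
qed

text \<open>The two obtuse-angle inequalities, each tested with the other projection, add up to a
  bound that Cauchy-Schwarz finishes.\<close>

lemma hproj_nonexpansive: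
  assumes "closed C" "convex C" "C \<noteq> {}"
  shows "norm (hproj C x - hproj C y) \<le> norm (x - y)"
proof -
  define p q where "p = hproj C x" and "q = hproj C y"
  have "(x - p) \<bullet> (q - p) \<le> 0" "(y - q) \<bullet> (p - q) \<le> 0"
    unfolding p_def q_def by (intro hproj_inner hproj_in assms)+
  then have "(p - q) \<bullet> (p - q) \<le> (x - y) \<bullet> (p - q)"
    by (simp add: inner_diff_left inner_diff_right inner_commute algebra_simps)
  also have "\<dots> \<le> norm (x - y) * norm (p - q)" by (rule norm_cauchy_schwarz)
  finally show ?thesis
    by (cases "p = q") (auto simp: p_def q_def power2_norm_eq_inner[symmetric] power2_eq_square)
qed

text \<open>The algorithm specifies its iterate as a distance minimizer over the admissible set;
  this identifies it with \<open>hproj\<close>. Minimality gives the obtuse-angle inequality at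
  \<open>p\<close> as well, and the two inequalities tested crosswise force equality.\<close>

lemma hproj_eqI:
  assumes "closed C" "convex C" "p \<in> C" and "\<And>v. v \<in> C \<Longrightarrow> norm (x - p) \<le> norm (x - v)"
  shows "hproj C x = p"
proof -
  have ne: "C \<noteq> {}" using assms(3) by auto
  define q where "q = hproj C x"
  have "(x - p) \<bullet> (q - p) \<le> 0"
    unfolding q_def using assms ne
    by (intro any_closest_point_dot[of C]) (auto simp: dist_norm hproj_in)
  moreover have "(x - q) \<bullet> (p - q) \<le> 0"
    unfolding q_def by (intro hproj_inner assms ne)
  ultimately have "(p - q) \<bullet> (p - q) \<le> 0"
    by (simp add: inner_diff_left inner_diff_right inner_commute algebra_simps)
  then have "p - q = 0" by (metis inner_ge_zero inner_eq_zero_iff order_antisym)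
  then show ?thesis by (simp add: q_def)
qed

lemma hproj_id:
  assumes "closed C" "convex C" "x \<in> C"
  shows "hproj C x = x"
  using assms by (intro hproj_eqI) auto

text \<open>This replaces weak compactness: the points of minimal norm form a Cauchy sequence.\<close>

lemma decreasing_convex_Inter_nonempty:
  fixes C :: "nat \<Rightarrow> 'h::{real_inner,complete_space} set"
  assumes C: "\<And>n. closed (C n)" "\<And>n. convex (C n)" "\<And>n. C n \<noteq> {}"
    and dec: "\<And>m n. m \<le> n \<Longrightarrow> C n \<subseteq> C m" and bdd: "bounded (C 0)"
  obtains x where "\<And>n. x \<in> C n"
proof -
  define d where "d n = (norm (hproj (C n) 0))^2" for n
  \<comment> \<open>Pythagoras as an inequality: for the projection of 0 the obtuse-angle condition
    makes the mixed term nonnegative.\<close>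
  have min: "d n + (norm (v - hproj (C n) 0))^2 \<le> (norm v)^2" if "v \<in> C n" for v n
  proof -
    have "0 \<le> hproj (C n) 0 \<bullet> (v - hproj (C n) 0)"
      using hproj_inner[OF C that, of 0] by simp
    then show ?thesis
      by (simp add: d_def power2_norm_eq_inner inner_diff_left inner_diff_right inner_commute)
  qed
  have mem: "hproj (C n) 0 \<in> C m" if "m \<le> n" for m n
    using hproj_in[OF C, of n 0] dec[OF that] by auto
  \<comment> \<open>The later minimal point still lies in the earlier set, so squared distances are
    controlled by increments of \<open>d\<close>, which is increasing and bounded.\<close>
  have step: "(norm (hproj (C m) 0 - hproj (C n) 0))^2 \<le> d n - d m" if "m \<le> n" for m n
    using min[OF mem[OF that]] by (simp add: d_def norm_minus_commute)
  have "incseq d"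
    unfolding incseq_def using step by (smt (verit) zero_le_power2)
  obtain b where b: "\<And>x. x \<in> C 0 \<Longrightarrow> norm x \<le> b"
    using bdd by (auto simp: bounded_iff)
  have "d n \<le> b^2" for n
    unfolding d_def using b[OF mem[of 0 n]] by (intro power_mono) auto
  then obtain L where L: "d \<longlonglongrightarrow> L"
    using incseq_convergent[OF \<open>incseq d\<close>] by blast
  have "d n \<le> L" for n
    using incseq_le[OF \<open>incseq d\<close> L] .
  then have "(norm (hproj (C m) 0 - hproj (C n) 0))^2 \<le> L - d m" if "m \<le> n" for m n
    using step[OF that] by (smt (verit))
  moreover have "(\<lambda>m. L - d m) \<longlonglongrightarrow> 0"
    using tendsto_diff[OF tendsto_const L, of L] by simp
  ultimately have "Cauchy (\<lambda>n. hproj (C n) 0)"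
    by (rule Cauchy_if_sq_dist_le)
  then obtain y where y: "(\<lambda>n. hproj (C n) 0) \<longlonglongrightarrow> y"
    using Cauchy_convergent convergent_def by blast
  have "y \<in> C m" for m
  proof (rule closed_sequentially[OF C(1)])
    show "(\<lambda>n. hproj (C (n + m)) 0) \<longlonglongrightarrow> y" using LIMSEQ_ignore_initial_segment[OF y] .
  qed (simp add: mem)
  then show ?thesis using that by blast
qed

text \<open>Opial's lemma, with weak cluster points replaced by common points of the closed convex
  hulls of the tails.\<close>

lemma weak_convergence_Opial:
  fixes x :: "nat \<Rightarrow> 'h::{real_inner,complete_space}"
  assumes bdd: "bounded (range x)"
    and conv: "\<And>w. w \<in> S \<Longrightarrow> convergent (\<lambda>n. norm (x n - w))"
    and tails: "\<And>z. (\<And>m. z \<in> closure (convex hull (x ` {m..}))) \<Longrightarrow> z \<in> S"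
  shows "\<exists>w\<in>S. \<forall>v. (\<lambda>n. x n \<bullet> v) \<longlonglongrightarrow> w \<bullet> v"
proof -
  \<comment> \<open>The index set \<open>I\<close> is a parameter because the final contradiction
    runs along an infinite set of bad indices and not along the whole sequence.\<close>
  define K where "K I m = closure (convex hull (x ` (I \<inter> {m..})))" for I and m :: nat
  have half: "a \<le> z \<bullet> v" if "z \<in> K I m" "\<And>n. n \<in> I \<Longrightarrow> m \<le> n \<Longrightarrow> a \<le> x n \<bullet> v" for z v a I m
  proof -
    have "convex hull (x ` (I \<inter> {m..})) \<subseteq> {z. a \<le> v \<bullet> z}"
      using that(2) by (intro hull_minimal convex_halfspace_ge) (auto simp: inner_commute)
    then have "K I m \<subseteq> {z. a \<le> v \<bullet> z}"
      unfolding K_def by (intro closure_minimal closed_halfspace_ge)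
    then show ?thesis using that(1) by (auto simp: inner_commute)
  qed
  have K_mono: "K I n \<subseteq> K J m" if "I \<subseteq> J" "m \<le> n" for I J m n
    unfolding K_def using that by (intro closure_mono hull_mono image_mono) auto
  have ex: "\<exists>z. \<forall>m. z \<in> K I m" if inf: "infinite I" for I
  proof -
    have "K I m \<noteq> {}" for m
    proof -
      obtain n where "n \<ge> m" "n \<in> I"
        using inf by (meson infinite_nat_iff_unbounded_le)
      then have "x n \<in> x ` (I \<inter> {m..})" by auto
      then show ?thesis unfolding K_def
        using hull_subset[of "x ` (I \<inter> {m..})" convex] closure_subset by blast
    qed
    moreover have "bounded (K I 0)"
      unfolding K_def by (intro bounded_closure bounded_convex_hull bounded_subset[OF bdd]) auto
    moreover have "convex (K I m)" for m
      unfolding K_def by (intro convex_closure convex_convex_hull)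
    moreover have "closed (K I m)" for m
      unfolding K_def by simp
    ultimately show ?thesis
      using decreasing_convex_Inter_nonempty[of "K I"] K_mono by (metis order_refl)
  qed
  have inS: "z \<in> S" if "\<And>m. z \<in> K I m" for z I
  proof (rule tails)
    fix m
    show "z \<in> closure (convex hull (x ` {m..}))"
      using that[of m] K_mono[of I UNIV m m] by (auto simp: K_def)
  qed
  obtain w where w: "\<And>m. w \<in> K UNIV m" using ex[of UNIV] by auto
  \<comment> \<open>Convergence of the distances to \<open>z\<close> and to \<open>w\<close> makes
    the inner products of x_n with \<open>z - w\<close> converge. The limit is the value of this
    functional at every common point of the hulls, hence at both \<open>z\<close> and
    \<open>w\<close>, so the norm of \<open>z - w\<close> vanishes.\<close>
  have uniq: "z = w" if z: "\<And>m. z \<in> K I m" for z I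
  proof -
    have "z \<in> S" "w \<in> S" using inS z w by blast+
    then obtain p q where "(\<lambda>n. norm (x n - z)) \<longlonglongrightarrow> p" "(\<lambda>n. norm (x n - w)) \<longlonglongrightarrow> q"
      using conv unfolding convergent_def by metis
    then have "(\<lambda>n. ((norm (x n - w))^2 - (norm (x n - z))^2 + (norm z)^2 - (norm w)^2) / 2)
        \<longlonglongrightarrow> (q^2 - p^2 + (norm z)^2 - (norm w)^2) / 2"
      by (intro tendsto_intros) auto
    moreover have "((norm (x n - w))^2 - (norm (x n - z))^2 + (norm z)^2 - (norm w)^2) / 2
        = x n \<bullet> (z - w)" for n
      by (simp add: power2_norm_eq_inner inner_diff_left inner_diff_right inner_commute field_simps)
    ultimately obtain c where c: "(\<lambda>n. x n \<bullet> (z - w)) \<longlonglongrightarrow> c" by auto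
    have lim: "c = y \<bullet> (z - w)" if y: "\<And>m. y \<in> K I m" for y I
    proof (rule antisym)
      show "c \<le> y \<bullet> (z - w)"
      proof (rule field_le_epsilon)
        fix e :: real assume "e > 0"
        then obtain m where "\<And>n. n \<ge> m \<Longrightarrow> c - e < x n \<bullet> (z - w)"
          using order_tendstoD(1)[OF c, of "c - e"] by (auto simp: eventually_sequentially)
        then have "c - e \<le> y \<bullet> (z - w)" using half[OF y[of m], of "c - e" "z - w"] by force
        then show "c \<le> y \<bullet> (z - w) + e" by simp
      qed
      show "y \<bullet> (z - w) \<le> c"
      proof (rule field_le_epsilon)
        fix e :: real assume "e > 0"
        then obtain m where "\<And>n. n \<ge> m \<Longrightarrow> x n \<bullet> (z - w) < c + e"
          using order_tendstoD(2)[OF c, of "c + e"] by (auto simp: eventually_sequentially)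
        then have "- (c + e) \<le> y \<bullet> (- (z - w))"
          using half[OF y[of m], of "- (c + e)" "- (z - w)"]
          by (metis inner_minus_right less_imp_le neg_le_iff_le)
        then show "y \<bullet> (z - w) \<le> c + e" by (simp add: inner_diff_right)
      qed
    qed
    have "(z - w) \<bullet> (z - w) = 0"
      using lim[OF z] lim[OF w] by (simp add: inner_diff_left)
    then show ?thesis by simp
  qed
  \<comment> \<open>If infinitely many indices violated the bound, their hulls would have a common
    point. It is \<open>w\<close> by uniqueness, yet it lies in the half-space beyond the
    bound.\<close>
  have bound: "eventually (\<lambda>n. x n \<bullet> v < w \<bullet> v + e) sequentially" if "e > 0" for v e
  proof (rule ccontr)
    assume "\<not> ?thesis"
    then have "infinite {n. w \<bullet> v + e \<le> x n \<bullet> v}"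
      by (auto simp: frequently_cofinite cofinite_eq_sequentially[symmetric] not_less
          eventually_cofinite not_eventually)
    then obtain z where z: "\<And>m. z \<in> K {n. w \<bullet> v + e \<le> x n \<bullet> v} m" using ex by blast
    then have "w \<bullet> v + e \<le> z \<bullet> v" using half by (metis mem_Collect_eq)
    then show False using uniq[OF z] that by simp
  qed
  have "(\<lambda>n. x n \<bullet> v) \<longlonglongrightarrow> w \<bullet> v" for v
  proof (rule order_tendstoI)
    fix a assume "w \<bullet> v < a"
    then show "eventually (\<lambda>n. x n \<bullet> v < a) sequentially"
      using bound[of "a - w \<bullet> v" v] by simp
  next
    fix a assume "a < w \<bullet> v"
    then show "eventually (\<lambda>n. a < x n \<bullet> v) sequentially"
      using bound[of "w \<bullet> v - a" "- v"] by (simp add: inner_minus_right)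
  qed
  then show ?thesis using inS[OF w] by blast
qed

section \<open>Descent recursions for real sequences\<close>

lemma perturbed_descent_converges:
  fixes e b q :: "nat \<Rightarrow> real"
  assumes e: "\<And>n. 0 \<le> e n" and b: "\<And>n. 0 \<le> b n"
    and step: "\<And>n. e (Suc n) \<le> e n - b n + q n" and q: "summable q"
  shows "convergent e" "summable b"
proof -
  obtain B where B: "\<And>n. \<bar>\<Sum>k<n. q k\<bar> \<le> B"
    using q convergent_imp_Bseq[of "\<lambda>n. \<Sum>k<n. q k"] unfolding summable_iff_convergent Bseq_def by auto
  \<comment> \<open>\<open>q\<close> may change sign, as the noise does, and may be only
    conditionally summable. Subtracting its partial sums leaves a decreasing sequence that is
    bounded below.\<close>
  define z where "z n = e n + (\<Sum>k<n. b k) - (\<Sum>k<n. q k)" for n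
  have "decseq z"
    by (rule decseq_SucI) (use step in \<open>simp add: z_def algebra_simps\<close>)
  then have z_le: "z n \<le> z 0" for n by (simp add: decseqD)
  have "(\<Sum>k<n. b k) \<le> z 0 + B" for n
    using z_le[of n] e[of n] B[of n] by (simp add: z_def abs_le_iff)
  then show sb: "summable b"
    using b by (intro bounded_imp_summable[of b "z 0 + B"]) (auto simp flip: lessThan_Suc_atMost simp del: sum.lessThan_Suc)
  have "- B \<le> z n" for n
    using e[of n] sum_nonneg[of "{..<n}" b] b B[of n] by (simp add: z_def abs_le_iff)
  then have "convergent z"
    using decseq_convergent[OF \<open>decseq z\<close>] by (metis convergent_def)
  moreover have "convergent (\<lambda>n. \<Sum>k<n. b k)" "convergent (\<lambda>n. \<Sum>k<n. q k)"
    using sb q by (auto simp: summable_iff_convergent)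
  ultimately have "convergent (\<lambda>n. z n - (\<Sum>k<n. b k) + (\<Sum>k<n. q k))"
    by (intro convergent_add convergent_diff)
  then show "convergent e" by (simp add: z_def)
qed

text \<open>Divergence of the sum of \<open>t\<close> alone yields only arbitrarily small values of
  \<open>b\<close>. Slow variation excludes late large values: while \<open>b\<close> falls from
  \<open>2 * e\<close> to below \<open>e\<close>, the weights add up to at least about
  \<open>e / L\<close> with \<open>b\<close> at least \<open>e\<close>, which costs about
  \<open>e^2 / L\<close> of the series of \<open>t n * b n\<close>. The tails of that series are
  eventually smaller.\<close>

lemma weighted_summable_slowly_varying_tendsto_0:
  fixes t b :: "nat \<Rightarrow> real"
  assumes t: "\<And>n. 0 < t n" "\<not> summable t" and b: "\<And>n. 0 \<le> b n"
    and tb: "summable (\<lambda>n. t n * b n)" and slow: "\<And>n. \<bar>b (Suc n) - b n\<bar> \<le> L * t n"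
  shows "b \<longlonglongrightarrow> 0"
proof (rule LIMSEQ_I)
  fix e0 :: real assume "e0 > 0"
  define e where "e = e0 / 2"
  have e: "e > 0" using \<open>e0 > 0\<close> by (simp add: e_def)
  \<comment> \<open>Positive whatever the sign of \<open>L\<close>, so that one can divide by
    it.\<close>
  define L' where "L' = max L 1"
  have L': "L' > 0" "\<And>n. \<bar>b (Suc n) - b n\<bar> \<le> L' * t n"
  proof -
    show "L' > 0" by (simp add: L'_def)
    fix n
    have "L * t n \<le> L' * t n"
      using t(1)[of n] by (intro mult_right_mono) (auto simp: L'_def)
    then show "\<bar>b (Suc n) - b n\<bar> \<le> L' * t n" using slow[of n] by linarith
  qed
  obtain N where N: "\<And>m n. m \<ge> N \<Longrightarrow> norm (\<Sum>k=m..<n. t k * b k) < e^2 / L'"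
    using tb e L' by (auto simp: summable_Cauchy)
      (metis zero_less_divide_iff zero_less_power)
  have "b m < 2 * e" if "m \<ge> N" for m
  proof (rule ccontr)
    assume bm: "\<not> b m < 2 * e"
    have "\<exists>n\<ge>m. b n < e"
    proof (rule ccontr)
      assume "\<not> (\<exists>n\<ge>m. b n < e)"
      then have *: "\<And>n. n \<ge> m \<Longrightarrow> e \<le> b n" by (auto simp: not_less)
      have "summable t"
      proof (rule summable_comparison_test')
        show "summable (\<lambda>n. t n * b n / e)" using tb by (rule summable_divide)
        fix n assume "m \<le> n"
        then show "norm (t n) \<le> t n * b n / e"
          using *[of n] t(1)[of n] e by (simp add: field_simps)
      qed
      then show False using t(2) by simp
    qed
    define n where "n = (LEAST n. n \<ge> m \<and> b n < e)"
    have n: "n \<ge> m" "b n < e"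
      using LeastI_ex[OF \<open>\<exists>n\<ge>m. b n < e\<close>[unfolded]] \<open>\<exists>n\<ge>m. b n < e\<close>
      by (auto simp: n_def intro: LeastI2_ex)
    have before: "e \<le> b k" if "m \<le> k" "k < n" for k
      using not_less_Least[of k "\<lambda>n. n \<ge> m \<and> b n < e"] that by (auto simp: n_def)
    have "b m - b n = (\<Sum>k=m..<n. b k - b (Suc k))"
      using sum_Suc_diff'[OF n(1), of "\<lambda>k. - b k"] by simp
    also have "\<dots> \<le> (\<Sum>k=m..<n. L' * t k * b k / e)"
    proof (rule sum_mono)
      fix k assume "k \<in> {m..<n}"
      then have "e \<le> b k" using before by auto
      then have "L' * t k \<le> L' * t k * b k / e"
        using e L'(1) t(1)[of k] by (simp add: field_simps)
      then show "b k - b (Suc k) \<le> L' * t k * b k / e"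
        using L'(2)[of k] by linarith
    qed
    also have "\<dots> = L' / e * (\<Sum>k=m..<n. t k * b k)"
      by (simp add: sum_distrib_left mult_ac)
    also have "\<dots> < L' / e * (e^2 / L')"
      using N[OF that, of n] L'(1) e by (intro mult_strict_left_mono) auto
    also have "\<dots> = e" using L'(1) e by (simp add: field_simps power2_eq_square)
    finally show False using bm n(2) by simp
  qed
  then show "\<exists>N. \<forall>n\<ge>N. norm (b n - 0) < e0"
    using b by (auto simp: e_def)
qed


subsection \<open>Convergence of martingale difference series\<close>

text \<open>Vanishing integrals over all sets of \<open>F\<close> say that the conditional
  expectation of \<open>X\<close> given \<open>F\<close> is 0, and the \<open>F\<close>-measurable
  factor \<open>Z\<close> can be pulled out of it.\<close>

lemma (in prob_space) martingale_difference_orthogonal: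
  fixes X Z :: "'a \<Rightarrow> real"
  assumes sub: "subalgebra M F"
    and X: "X \<in> borel_measurable M" "\<And>x. x \<in> space M \<Longrightarrow> \<bar>X x\<bar> \<le> c"
    and Z: "Z \<in> borel_measurable F" "\<And>x. x \<in> space M \<Longrightarrow> \<bar>Z x\<bar> \<le> k"
    and mean: "\<And>A. A \<in> sets F \<Longrightarrow> (\<integral>x\<in>A. X x \<partial>M) = 0"
  shows "(\<integral>x. Z x * X x \<partial>M) = 0"
proof -
  interpret finite_measure_subalgebra M F
    by unfold_locales (rule sub)
  note [measurable] = X(1) Z(1) measurable_from_subalg[OF sub Z(1)]
  have iX: "integrable M X"
    using X by (intro integrable_const_bound[of _ c]) auto
  have ZX: "integrable M (\<lambda>x. Z x * X x)"
    using X(2) Z(2)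
    by (intro integrable_const_bound[of _ "k * c"]) (auto simp: abs_mult intro!: mult_mono' AE_I2)
  have "AE x in M. real_cond_exp M F X x = 0"
    by (rule real_cond_exp_charact) (use mean iX in \<open>auto simp: set_lebesgue_integral_def\<close>)
  then have "(\<integral>x. Z x * real_cond_exp M F X x \<partial>M) = (\<integral>x. 0 \<partial>M)"
    by (intro integral_cong_AE) auto
  then show ?thesis
    using real_cond_exp_intg(2)[OF ZX Z(1) X(1)] by simp
qed

text \<open>The martingale difference property is phrased by integrals over the sets of
  \<open>F n\<close>, because for samples this can be computed directly on a product space.\<close>

locale bounded_martingale_differences = prob_space +
  fixes F :: "nat \<Rightarrow> 'a measure" and X :: "nat \<Rightarrow> 'a \<Rightarrow> real" and c :: "nat \<Rightarrow> real"
  assumes sub: "subalgebra M (F n)" and F_Suc: "sets (F n) \<subseteq> sets (F (Suc n))"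
    and X_meas: "X n \<in> borel_measurable (F (Suc n))"
    and X_bound: "x \<in> space M \<Longrightarrow> \<bar>X n x\<bar> \<le> c n"
    and c_sq: "summable (\<lambda>n. (c n)\<^sup>2)"
    and X_mean: "A \<in> sets (F n) \<Longrightarrow> (\<integral>x\<in>A. X n x \<partial>M) = 0"
begin

lemma meas_mono:
  assumes "m \<le> n" "f \<in> borel_measurable (F m)"
  shows "f \<in> borel_measurable (F n)"
proof -
  have "sets (F m) \<subseteq> sets (F n)"
    using F_Suc by (rule lift_Suc_mono_le[OF _ assms(1)])
  then have "subalgebra (F n) (F m)"
    using sub by (simp add: subalgebra_def)
  then show ?thesis using assms(2) by (rule measurable_from_subalg)
qed

lemma X_meas': "k < n \<Longrightarrow> X k \<in> borel_measurable (F n)"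
  using meas_mono[OF _ X_meas] by simp

text \<open>Kolmogorov's maximal inequality: stop the partial sums on leaving the ball of radius
  e; the stopped increments are again orthogonal.\<close>

lemma maximal_inequality:
  assumes e: "e > 0"
  shows "measure M {x \<in> space M. \<exists>n\<in>{m..N}. e \<le> \<bar>\<Sum>k=m..<n. X k x\<bar>}
    \<le> (\<Sum>k=m..<N. (c k)\<^sup>2) / e\<^sup>2"
proof -
  define S where "S n x = (\<Sum>k=m..<n. X k x)" for n x
  \<comment> \<open>\<open>S n\<close> involves only \<open>X k\<close> with \<open>k < n\<close>,
    so \<open>I n\<close> is known at time \<open>n\<close>, before \<open>X n\<close> is drawn.
    \<open>T\<close> is therefore the sum stopped at its first exit.\<close>
  define I where "I n x = (if \<forall>i\<in>{m..n}. \<bar>S i x\<bar> < e then 1 else 0 :: real)" for n x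
  define T where "T n x = (\<Sum>k=m..<n. I k x * X k x)" for n x
  have S_meas: "S i \<in> borel_measurable (F n)" if "i \<le> n" for i n
    unfolding S_def using that by (intro borel_measurable_sum X_meas') auto
  have I_meas: "I i \<in> borel_measurable (F n)" if "i \<le> n" for i n
  proof -
    have "Measurable.pred (F n) (\<lambda>x. \<forall>j\<in>{m..i}. \<bar>S j x\<bar> < e)"
    proof (intro pred_intros_finite)
      fix j assume "j \<in> {m..i}"
      then have [measurable]: "S j \<in> borel_measurable (F n)" using S_meas that by simp
      show "Measurable.pred (F n) (\<lambda>x. \<bar>S j x\<bar> < e)" by measurable
    qed simp
    then show ?thesis unfolding I_def by measurable
  qed
  have I01: "I n x \<in> {0, 1}" for n x by (simp add: I_def)
  have T_meas: "T i \<in> borel_measurable (F n)" if "i \<le> n" for i n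
    unfolding T_def using that by (intro borel_measurable_sum borel_measurable_times I_meas X_meas') auto
  have IX: "\<bar>I n x * X n x\<bar> \<le> c n" if "x \<in> space M" for n x
    using I01[of n x] X_bound[OF that, of n] by auto
  have T_bound: "\<bar>T n x\<bar> \<le> (\<Sum>k=m..<n. c k)" if "x \<in> space M" for n x
    unfolding T_def by (rule order_trans[OF sum_abs sum_mono]) (rule IX[OF that])
  have from_F: "f \<in> borel_measurable M" if "f \<in> borel_measurable (F n)" for f :: "'a \<Rightarrow> real" and n
    using measurable_from_subalg[OF sub that] .
  have TM[measurable]: "T n \<in> borel_measurable M" for n by (rule from_F[OF T_meas[OF order_refl]])
  have IM[measurable]: "I n \<in> borel_measurable M" for n by (rule from_F[OF I_meas[OF order_refl]])
  have XM[measurable]: "X n \<in> borel_measurable M" for n by (rule from_F[OF X_meas])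
  have SM[measurable]: "S n \<in> borel_measurable M" for n by (rule from_F[OF S_meas[OF order_refl]])
  have sq: "y\<^sup>2 \<le> z\<^sup>2" if "\<bar>y\<bar> \<le> z" for y z :: real
    using power_mono[OF that, of 2] by simp
  have int_T2: "integrable M (\<lambda>x. (T n x)\<^sup>2)" for n
    using T_bound[of _ n]
    by (intro integrable_const_bound[of _ "(\<Sum>k=m..<n. c k)\<^sup>2"])
      (auto intro!: AE_I2 sq)
  have energy: "(\<integral>x. (T n x)\<^sup>2 \<partial>M) \<le> (\<Sum>k=m..<n. (c k)\<^sup>2)" for n
  proof (induction n)
    case 0
    then show ?case by (simp add: T_def)
  next
    case (Suc n)
    show ?case
    proof (cases "m \<le> n")
      case False
      then show ?thesis by (simp add: T_def)
    next
      case True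
      \<comment> \<open>The factor in front of \<open>X n\<close> is determined at time
        \<open>n\<close>, so the mixed term of the square integrates to 0 and the energies of the
        increments add up.\<close>
      have cross: "(\<integral>x. (T n x * I n x) * X n x \<partial>M) = 0"
      proof (rule martingale_difference_orthogonal[OF sub[of n]])
        show "(\<lambda>x. T n x * I n x) \<in> borel_measurable (F n)"
          by (intro borel_measurable_times T_meas I_meas) auto
        fix x assume "x \<in> space M"
        then show "\<bar>T n x * I n x\<bar> \<le> (\<Sum>k=m..<n. c k)"
          using I01[of n x] T_bound[of x n] by auto
      qed (use X_bound X_mean XM in auto)
      have int_cross: "integrable M (\<lambda>x. (T n x * I n x) * X n x)"
      proof (rule integrable_const_bound[of _ "(\<Sum>k=m..<n. c k) * c n"])
        show "AE x in M. norm ((T n x * I n x) * X n x) \<le> (\<Sum>k=m..<n. c k) * c n"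
          using T_bound IX by (auto intro!: AE_I2 mult_mono' simp: abs_mult mult.assoc)
      qed measurable
      have int_IX: "integrable M (\<lambda>x. (I n x * X n x)\<^sup>2)"
        using IX[of _ n]
        by (intro integrable_const_bound[of _ "(c n)\<^sup>2"])
          (auto intro!: AE_I2 sq)
      have "(\<integral>x. (T (Suc n) x)\<^sup>2 \<partial>M)
          = (\<integral>x. (T n x)\<^sup>2 + 2 * ((T n x * I n x) * X n x) + (I n x * X n x)\<^sup>2 \<partial>M)"
        using True by (intro Bochner_Integration.integral_cong)
          (auto simp: T_def power2_eq_square algebra_simps)
      also have "\<dots> = (\<integral>x. (T n x)\<^sup>2 \<partial>M) + (\<integral>x. (I n x * X n x)\<^sup>2 \<partial>M)"
        using int_T2[of n] int_cross int_IX cross by simp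
      also have "(\<integral>x. (I n x * X n x)\<^sup>2 \<partial>M) \<le> (\<integral>x. (c n)\<^sup>2 \<partial>M)"
        using int_IX IX[of _ n]
        by (intro integral_mono) (auto intro: sq)
      finally show ?thesis using Suc True by (simp add: prob_space)
    qed
  qed
  \<comment> \<open>At the first exit time \<open>h\<close> the stopped sum equals
    \<open>S h\<close>: the indicators before \<open>h\<close> are 1, those from \<open>h\<close> on
    are 0. So \<open>T N\<close> remembers an exit that \<open>S N\<close> may have undone, and
    Chebyshev's inequality for \<open>T N\<close> controls the maximum.\<close>
  have hit: "e\<^sup>2 \<le> (T N x)\<^sup>2" if n: "n \<in> {m..N}" "e \<le> \<bar>S n x\<bar>" for n x
  proof -
    define h where "h = (LEAST h. h \<in> {m..N} \<and> e \<le> \<bar>S h x\<bar>)"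
    have h: "h \<in> {m..N}" "e \<le> \<bar>S h x\<bar>"
      using LeastI[of "\<lambda>h. h \<in> {m..N} \<and> e \<le> \<bar>S h x\<bar>" n] n by (auto simp: h_def)
    have before: "\<bar>S i x\<bar> < e" if "i \<in> {m..<h}" for i
      using not_less_Least[of i "\<lambda>h. h \<in> {m..N} \<and> e \<le> \<bar>S h x\<bar>"] that h(1) by (auto simp: h_def)
    have "T N x = (\<Sum>k=m..<h. I k x * X k x) + (\<Sum>k=h..<N. I k x * X k x)"
      unfolding T_def using h(1) by (subst sum.atLeastLessThan_concat) auto
    also have "(\<Sum>k=m..<h. I k x * X k x) = S h x"
      unfolding S_def by (rule sum.cong) (auto simp: I_def before)
    also have "(\<Sum>k=h..<N. I k x * X k x) = 0"
      using h by (intro sum.neutral) (force simp: I_def)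
    finally have "\<bar>T N x\<bar> \<ge> e" using h by simp
    then show ?thesis using e by (metis abs_le_square_iff abs_of_pos)
  qed
  define A where "A = {x \<in> space M. \<exists>n\<in>{m..N}. e \<le> \<bar>S n x\<bar>}"
  have A: "A \<in> sets M" unfolding A_def by measurable
  have "e\<^sup>2 * measure M A = (\<integral>x. e\<^sup>2 * indicator A x \<partial>M)"
    using A by simp
  also have "\<dots> \<le> (\<integral>x. (T N x)\<^sup>2 \<partial>M)"
  proof (rule integral_mono[OF _ int_T2])
    show "integrable M (\<lambda>x. e\<^sup>2 * indicator A x)"
      using A by (intro integrable_mult_right integrable_real_indicator) (auto simp: emeasure_eq_measure)
  qed (auto simp: indicator_def A_def intro: hit)
  also have "\<dots> \<le> (\<Sum>k=m..<N. (c k)\<^sup>2)" by (rule energy)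
  finally show ?thesis using e by (simp add: A_def S_def field_simps)
qed

lemma tail_inequality:
  assumes e: "e > 0"
  shows "measure M {x \<in> space M. \<exists>n\<ge>m. e \<le> \<bar>\<Sum>k=m..<n. X k x\<bar>} \<le> (\<Sum>k. (c (k + m))\<^sup>2) / e\<^sup>2"
proof -
  define A where "A N = {x \<in> space M. \<exists>n\<in>{m..N}. e \<le> \<bar>\<Sum>k=m..<n. X k x\<bar>}" for N
  have [measurable]: "X n \<in> borel_measurable M" for n
    using measurable_from_subalg[OF sub X_meas] .
  have A_sets: "range A \<subseteq> sets M" unfolding A_def by auto
  have "(\<lambda>N. measure M (A N)) \<longlonglongrightarrow> measure M (\<Union>N. A N)"
    using A_sets by (intro finite_Lim_measure_incseq) (auto simp: incseq_def A_def)
  moreover have "measure M (A N) \<le> (\<Sum>k. (c (k + m))\<^sup>2) / e\<^sup>2" for N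
  proof -
    have "(\<Sum>k=m..<N. (c k)\<^sup>2) = (\<Sum>k<N - m. (c (k + m))\<^sup>2)"
      by (subst sum.atLeastLessThan_shift_0) (simp add: lessThan_atLeast0 add.commute)
    also have "\<dots> \<le> (\<Sum>k. (c (k + m))\<^sup>2)"
      using c_sq summable_iff_shift[of "\<lambda>n. (c n)\<^sup>2" m] by (intro sum_le_suminf) auto
    finally have "(\<Sum>k=m..<N. (c k)\<^sup>2) / e\<^sup>2 \<le> (\<Sum>k. (c (k + m))\<^sup>2) / e\<^sup>2"
      by (intro divide_right_mono) auto
    then show ?thesis
      using maximal_inequality[OF e, of m N] by (simp add: A_def)
  qed
  ultimately have "measure M (\<Union>N. A N) \<le> (\<Sum>k. (c (k + m))\<^sup>2) / e\<^sup>2"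
    by (intro LIMSEQ_le_const2[of "\<lambda>N. measure M (A N)"]) auto
  moreover have "(\<Union>N. A N) = {x \<in> space M. \<exists>n\<ge>m. e \<le> \<bar>\<Sum>k=m..<n. X k x\<bar>}"
  proof (intro equalityI subsetI)
    fix x assume "x \<in> {x \<in> space M. \<exists>n\<ge>m. e \<le> \<bar>\<Sum>k=m..<n. X k x\<bar>}"
    then obtain n where "x \<in> space M" "n \<in> {m..n}" "e \<le> \<bar>\<Sum>k=m..<n. X k x\<bar>" by auto
    then have "x \<in> A n" unfolding A_def by blast
    then show "x \<in> (\<Union>N. A N)" by blast
  qed (auto simp: A_def)
  ultimately show ?thesis by simp
qed

text \<open>The tails of the sum of the \<open>(c n)\<^sup>2\<close> tend to 0, so for every
  \<open>e\<close> almost surely some block start \<open>m\<close> exists after which the partial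
  sums stay within \<open>e\<close>. Taking \<open>e\<close> from a countable null sequence gives
  the Cauchy criterion outside one null set.\<close>

theorem AE_summable: "AE x in M. summable (\<lambda>n. X n x)"
proof -
  have [measurable]: "X n \<in> borel_measurable M" for n
    using measurable_from_subalg[OF sub X_meas] .
  have "AE x in M. \<exists>m. \<forall>n\<ge>m. \<bar>\<Sum>k=m..<n. X k x\<bar> < e" if e: "e > 0" for e :: real
  proof -
    define A where "A m = {x \<in> space M. \<exists>n\<ge>m. e \<le> \<bar>\<Sum>k=m..<n. X k x\<bar>}" for m
    have [measurable]: "A m \<in> sets M" for m unfolding A_def by measurable
    have "(\<lambda>m. (\<Sum>k. (c (k + m))\<^sup>2) / e\<^sup>2) \<longlonglongrightarrow> 0 / e\<^sup>2"
      using e by (intro tendsto_intros suminf_exist_split2[OF c_sq]) auto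
    then have lim: "(\<lambda>m. (\<Sum>k. (c (k + m))\<^sup>2) / e\<^sup>2) \<longlonglongrightarrow> 0" by simp
    have "measure M (\<Inter>m. A m) \<le> (\<Sum>k. (c (k + m))\<^sup>2) / e\<^sup>2" for m
      using tail_inequality[OF e, of m] finite_measure_mono[of "\<Inter>m. A m" "A m"] INT_lower[of m UNIV A]
      by (auto simp: A_def[symmetric])
    then have "measure M (\<Inter>m. A m) \<le> 0"
      by (intro LIMSEQ_le_const[OF lim]) auto
    then have "(\<Inter>m. A m) \<in> null_sets M"
      using emeasure_eq_measure by (intro null_setsI) (auto simp: measure_le_0_iff)
    then show ?thesis
      by (rule AE_I') (auto simp: A_def not_less)
  qed
  then have "AE x in M. \<exists>m. \<forall>n\<ge>m. \<bar>\<Sum>k=m..<n. X k x\<bar> < inverse (real (Suc i))" for i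
    by simp
  then have "AE x in M. \<forall>i. \<exists>m. \<forall>n\<ge>m. \<bar>\<Sum>k=m..<n. X k x\<bar> < inverse (real (Suc i))"
    by (simp add: AE_all_countable)
  then show ?thesis
  proof eventually_elim
    case (elim x)
    have "Cauchy (\<lambda>n. \<Sum>k<n. X k x)"
    proof (rule metric_CauchyI)
      fix e :: real assume "e > 0"
      then obtain i where i: "inverse (real (Suc i)) < e/2"
        using reals_Archimedean[of "e/2"] by auto
      obtain m where m: "\<And>n. n \<ge> m \<Longrightarrow> \<bar>\<Sum>k=m..<n. X k x\<bar> < inverse (real (Suc i))"
        using elim by blast
      have split: "(\<Sum>k<n. X k x) = (\<Sum>k<m. X k x) + (\<Sum>k=m..<n. X k x)" if "n \<ge> m" for n
        using sum.atLeastLessThan_concat[of 0 m n "\<lambda>k. X k x"] that by (simp add: lessThan_atLeast0)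
      have "dist (\<Sum>k<n. X k x) (\<Sum>k<p. X k x) < e" if "n \<ge> m" "p \<ge> m" for n p
        using m[OF that(1)] m[OF that(2)] i split[OF that(1)] split[OF that(2)]
        by (simp add: dist_real_def)
      then show "\<exists>M. \<forall>n\<ge>M. \<forall>p\<ge>M. dist (\<Sum>k<n. X k x) (\<Sum>k<p. X k x) < e" by blast
    qed
    then show ?case
      by (simp add: summable_iff_convergent Cauchy_convergent)
  qed
qed

end


subsection \<open>Projected stochastic gradient descent for quadratic objectives\<close>

lemma norm_sq_convex_combination:
  fixes x y :: "'h::real_inner"
  shows "(norm ((1 - t) *\<^sub>R x + t *\<^sub>R y))\<^sup>2
    = (1 - t) * (norm x)\<^sup>2 + t * (norm y)\<^sup>2 - t * (1 - t) * (norm (x - y))\<^sup>2"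
  unfolding power2_norm_eq_inner
  by (simp add: inner_add_left inner_add_right inner_diff_left inner_diff_right inner_commute[of y x])
    (simp add: algebra_simps)

lemma norm_sq_diff_scaleR:
  fixes x y :: "'h::real_inner"
  shows "(norm (x - t *\<^sub>R y))\<^sup>2 = (norm x)\<^sup>2 - 2 * t * (y \<bullet> x) + t\<^sup>2 * (norm y)\<^sup>2"
  unfolding power2_norm_eq_inner
  by (simp add: inner_diff_left inner_diff_right inner_commute[of x y] power2_eq_square algebra_simps)

text \<open>\<open>T \<omega>\<close> is the control-to-state map of one sample. By symmetry it is
  its own adjoint, so it also produces the adjoint state in the recursion. The start
  \<open>u0\<close> is not tied to \<open>K\<close>.\<close>

locale projected_sgd = M: prob_space M + P: prob_space P
  for M :: "'w measure" and P :: "'s measure" +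
  fixes T :: "'w \<Rightarrow> 'h \<Rightarrow> 'h::{real_inner,complete_space,second_countable_topology}"
    and c lam :: real and d u0 :: 'h and K :: "'h set"
    and \<xi> :: "nat \<Rightarrow> 's \<Rightarrow> 'w" and \<tau> :: "nat \<Rightarrow> real" and u :: "nat \<Rightarrow> 's \<Rightarrow> 'h"
  assumes T_meas: "(\<lambda>(\<omega>, v). T \<omega> v) \<in> borel_measurable (M \<Otimes>\<^sub>M borel)"
    and T_linear: "\<omega> \<in> space M \<Longrightarrow> linear (T \<omega>)"
    and T_sym: "\<omega> \<in> space M \<Longrightarrow> T \<omega> v \<bullet> w = v \<bullet> T \<omega> w"
    and T_bound: "\<omega> \<in> space M \<Longrightarrow> norm (T \<omega> v) \<le> c * norm v"
    and K: "closed K" "convex K" "bounded K" "K \<noteq> {}"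
    and lam: "0 \<le> lam"
    and \<xi>_meas: "\<xi> n \<in> measurable P M"
    and \<xi>_distr: "distr P M (\<xi> n) = M"
    and \<xi>_indep: "P.indep_vars (\<lambda>_. M) \<xi> UNIV"
    and \<tau>_pos: "0 < \<tau> n"
    and \<tau>_sum: "\<not> summable \<tau>"
    and \<tau>_sq: "summable (\<lambda>n. (\<tau> n)\<^sup>2)"
    and u_0: "s \<in> space P \<Longrightarrow> u 0 s = u0"
    and u_Suc: "s \<in> space P \<Longrightarrow> u (Suc n) s =
      hproj K (u n s - \<tau> n *\<^sub>R (lam *\<^sub>R u n s - T (\<xi> n s) (d - T (\<xi> n s) (u n s))))"
begin

section \<open>The objective and its minimizers\<close>

definition J :: "'w \<Rightarrow> 'h \<Rightarrow> real" where "J \<omega> v = 1/2 * (norm (T \<omega> v - d))\<^sup>2"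

definition j0 :: "'h \<Rightarrow> real" where "j0 v = (\<integral>\<omega>. J \<omega> v \<partial>M)"

definition j :: "'h \<Rightarrow> real" where "j v = j0 v + lam / 2 * (norm v)\<^sup>2"

definition minimizers :: "'h set" where "minimizers = {v \<in> K. \<forall>w\<in>K. j v \<le> j w}"

definition G :: "'w \<Rightarrow> 'h \<Rightarrow> 'h" where "G \<omega> v = lam *\<^sub>R v - T \<omega> (d - T \<omega> v)"

definition step :: "nat \<Rightarrow> 'w \<Rightarrow> 'h \<Rightarrow> 'h" where
  "step n \<omega> v = hproj K (v - \<tau> n *\<^sub>R G \<omega> v)"

text \<open>The iterates as functions of the sample sequence alone. Measurability is proved for
  these on product spaces and then carried over to \<open>u\<close>.\<close>

primrec traj :: "nat \<Rightarrow> (nat \<Rightarrow> 'w) \<Rightarrow> 'h" where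
  "traj 0 \<alpha> = u0"
| "traj (Suc n) \<alpha> = step n (\<alpha> n) (traj n \<alpha>)"

text \<open>A common radius for \<open>K\<close> and for \<open>u0\<close>, which may lie outside
  \<open>K\<close>; all constants below are uniform on this ball.\<close>

definition r :: real where "r = (SOME r. 0 \<le> r \<and> norm u0 \<le> r \<and> (\<forall>v\<in>K. norm v \<le> r))"

definition k :: real where "k = \<bar>c\<bar> * r + norm d"

lemma r: "0 \<le> r" "norm u0 \<le> r" "v \<in> K \<Longrightarrow> norm v \<le> r"
proof -
  obtain b where "\<And>v. v \<in> K \<Longrightarrow> norm v \<le> b"
    using K(3) by (auto simp: bounded_iff)
  then have "\<exists>r. 0 \<le> r \<and> norm u0 \<le> r \<and> (\<forall>v\<in>K. norm v \<le> r)"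
    by (intro exI[of _ "max (norm u0) b"]) (auto simp: le_max_iff_disj)
  from someI_ex[OF this] show "0 \<le> r" "norm u0 \<le> r" "v \<in> K \<Longrightarrow> norm v \<le> r"
    by (auto simp: r_def)
qed

lemma k_nonneg: "0 \<le> k" using r(1) by (simp add: k_def)

lemma T_bound': "\<omega> \<in> space M \<Longrightarrow> norm v \<le> r \<Longrightarrow> norm (T \<omega> v - d) \<le> k"
proof -
  assume *: "\<omega> \<in> space M" "norm v \<le> r"
  have "norm (T \<omega> v - d) \<le> norm (T \<omega> v) + norm d" by (rule norm_triangle_ineq4)
  also have "norm (T \<omega> v) \<le> \<bar>c\<bar> * norm v"
    using T_bound[OF *(1), of v] by (rule order_trans) (simp add: mult_right_mono)
  also have "\<dots> \<le> \<bar>c\<bar> * r" using *(2) by (rule mult_left_mono) simp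
  finally show ?thesis by (simp add: k_def)
qed

lemma T_measurable[measurable (raw)]:
  assumes [measurable]: "f \<in> measurable N M" "g \<in> borel_measurable N"
  shows "(\<lambda>x. T (f x) (g x)) \<in> borel_measurable N"
proof -
  have "(\<lambda>x. (f x, g x)) \<in> measurable N (M \<Otimes>\<^sub>M borel)" by measurable
  from measurable_compose[OF this T_meas] show ?thesis by simp
qed

lemma J_measurable[measurable (raw)]:
  assumes [measurable]: "f \<in> measurable N M" "g \<in> borel_measurable N"
  shows "(\<lambda>x. J (f x) (g x)) \<in> borel_measurable N"
  unfolding J_def by measurable

lemma J_nonneg: "0 \<le> J \<omega> v" by (simp add: J_def)

lemma J_bound: "\<omega> \<in> space M \<Longrightarrow> norm v \<le> r \<Longrightarrow> J \<omega> v \<le> k\<^sup>2"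
proof -
  assume "\<omega> \<in> space M" "norm v \<le> r"
  then have "(norm (T \<omega> v - d))\<^sup>2 \<le> k\<^sup>2" using T_bound' by (intro power_mono) auto
  then show ?thesis unfolding J_def using zero_le_power2[of k] by linarith
qed

lemma J_integrable: "integrable M (\<lambda>\<omega>. J \<omega> v)"
proof (rule M.integrable_const_bound)
  show "AE \<omega> in M. norm (J \<omega> v) \<le> 1/2 * (c * norm v + norm d)\<^sup>2"
  proof (rule AE_I2)
    fix \<omega> assume "\<omega> \<in> space M"
    then have "norm (T \<omega> v - d) \<le> c * norm v + norm d"
      using norm_triangle_ineq4[of "T \<omega> v" d] T_bound[of \<omega> v] by linarith
    then show "norm (J \<omega> v) \<le> 1/2 * (c * norm v + norm d)\<^sup>2"
      by (simp add: J_def power_mono)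
  qed
qed measurable

lemma j0_measurable[measurable]: "j0 \<in> borel_measurable borel"
proof -
  have "(\<lambda>v. \<integral>\<omega>. J \<omega> v \<partial>M) \<in> borel_measurable borel"
    by (rule M.borel_measurable_lebesgue_integral) measurable
  then show ?thesis unfolding j0_def .
qed

lemma j0_bound:
  assumes "norm v \<le> r"
  shows "0 \<le> j0 v" "j0 v \<le> k\<^sup>2"
proof -
  show "0 \<le> j0 v" unfolding j0_def by (simp add: J_nonneg)
  have "j0 v \<le> (\<integral>\<omega>. k\<^sup>2 \<partial>M)"
    unfolding j0_def using J_integrable J_bound assms by (intro integral_mono) auto
  then show "j0 v \<le> k\<^sup>2" by (simp add: M.prob_space)
qed

text \<open>The tracking term is the average of squared norms of affine maps and is merely convex.
  The whole modulus comes from the penalty, through an exact identity for squared norms.\<close>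

lemma j_strongly_convex:
  assumes "0 \<le> t" "t \<le> 1"
  shows "j ((1 - t) *\<^sub>R v + t *\<^sub>R w) \<le> (1 - t) * j v + t * j w - lam / 2 * (t * (1 - t)) * (norm (v - w))\<^sup>2"
proof -
  have "j0 ((1 - t) *\<^sub>R v + t *\<^sub>R w) \<le> (\<integral>\<omega>. (1 - t) * J \<omega> v + t * J \<omega> w \<partial>M)"
    unfolding j0_def
  proof (rule integral_mono)
    fix \<omega> assume "\<omega> \<in> space M"
    then interpret linear "T \<omega>" by (rule T_linear)
    have "T \<omega> ((1 - t) *\<^sub>R v + t *\<^sub>R w) - d = (1 - t) *\<^sub>R (T \<omega> v - d) + t *\<^sub>R (T \<omega> w - d)"
      by (simp add: add scaleR) (simp add: algebra_simps)
    then have "(norm (T \<omega> ((1 - t) *\<^sub>R v + t *\<^sub>R w) - d))\<^sup>2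
        \<le> (1 - t) * (norm (T \<omega> v - d))\<^sup>2 + t * (norm (T \<omega> w - d))\<^sup>2"
      using assms by (simp only: norm_sq_convex_combination) simp
    also have "\<dots> = 2 * ((1 - t) * J \<omega> v + t * J \<omega> w)"
      unfolding J_def by (simp add: field_simps)
    finally show "J \<omega> ((1 - t) *\<^sub>R v + t *\<^sub>R w) \<le> (1 - t) * J \<omega> v + t * J \<omega> w"
      by (simp add: J_def[of _ "(1 - t) *\<^sub>R v + t *\<^sub>R w"])
  qed (intro Bochner_Integration.integrable_add integrable_mult_right J_integrable)+
  also have "\<dots> = (1 - t) * j0 v + t * j0 w"
    by (simp add: j0_def J_integrable)
  finally have "j0 ((1 - t) *\<^sub>R v + t *\<^sub>R w) \<le> (1 - t) * j0 v + t * j0 w" .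
  moreover have "lam / 2 * (norm ((1 - t) *\<^sub>R v + t *\<^sub>R w))\<^sup>2 = (1 - t) * (lam / 2 * (norm v)\<^sup>2)
      + t * (lam / 2 * (norm w)\<^sup>2) - lam / 2 * (t * (1 - t)) * (norm (v - w))\<^sup>2"
    unfolding norm_sq_convex_combination by (simp add: field_simps)
  ultimately show ?thesis unfolding j_def distrib_left by linarith
qed

lemma J_lipschitz:
  assumes "\<omega> \<in> space M" "norm v \<le> r" "norm w \<le> r"
  shows "\<bar>J \<omega> v - J \<omega> w\<bar> \<le> k * \<bar>c\<bar> * norm (v - w)"
proof -
  interpret linear "T \<omega>" using assms(1) by (rule T_linear)
  define a b where "a = norm (T \<omega> v - d)" and "b = norm (T \<omega> w - d)"
  have ab: "0 \<le> a" "0 \<le> b" "a \<le> k" "b \<le> k"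
    using T_bound' assms by (auto simp: a_def b_def)
  have "\<bar>a - b\<bar> \<le> norm ((T \<omega> v - d) - (T \<omega> w - d))"
    unfolding a_def b_def by (rule norm_triangle_ineq3)
  also have "\<dots> = norm (T \<omega> (v - w))" by (simp add: diff)
  also have "\<dots> \<le> \<bar>c\<bar> * norm (v - w)"
    using T_bound[OF assms(1), of "v - w"] by (rule order_trans) (simp add: mult_right_mono)
  finally have "\<bar>a - b\<bar> * (a + b) \<le> \<bar>c\<bar> * norm (v - w) * (2 * k)"
    using ab by (intro mult_mono) auto
  moreover have eq: "J \<omega> v - J \<omega> w = (a - b) * (a + b) / 2"
    by (simp add: J_def a_def[symmetric] b_def[symmetric] field_simps power2_eq_square)
  have "\<bar>J \<omega> v - J \<omega> w\<bar> = \<bar>a - b\<bar> * (a + b) / 2"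
    unfolding eq using ab by (simp add: abs_mult)
  ultimately show ?thesis by (simp add: mult_ac)
qed

text \<open>The summands are the Lipschitz constants, on the ball of radius \<open>r\<close>, of the
  tracking term and of the penalty.\<close>

definition L :: real where "L = k * \<bar>c\<bar> + lam * r"

lemma L_nonneg: "0 \<le> L" using k_nonneg lam r(1) by (simp add: L_def)

lemma j_lipschitz:
  assumes "norm v \<le> r" "norm w \<le> r"
  shows "\<bar>j v - j w\<bar> \<le> L * norm (v - w)"
proof -
  have "\<bar>j0 v - j0 w\<bar> = \<bar>\<integral>\<omega>. J \<omega> v - J \<omega> w \<partial>M\<bar>"
    by (simp add: j0_def J_integrable)
  also have "\<dots> \<le> (\<integral>\<omega>. \<bar>J \<omega> v - J \<omega> w\<bar> \<partial>M)" by (rule integral_abs_bound)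
  also have "\<dots> \<le> (\<integral>\<omega>. k * \<bar>c\<bar> * norm (v - w) \<partial>M)"
    using J_lipschitz assms J_integrable by (intro integral_mono) auto
  finally have 1: "\<bar>j0 v - j0 w\<bar> \<le> k * \<bar>c\<bar> * norm (v - w)" by (simp add: M.prob_space)
  have "\<bar>norm v - norm w\<bar> * (norm v + norm w) \<le> norm (v - w) * (2 * r)"
    using assms by (intro mult_mono norm_triangle_ineq3) auto
  then have "lam / 2 * (\<bar>norm v - norm w\<bar> * (norm v + norm w)) \<le> lam / 2 * (norm (v - w) * (2 * r))"
    using lam by (intro mult_left_mono) auto
  moreover have eq: "lam / 2 * (norm v)\<^sup>2 - lam / 2 * (norm w)\<^sup>2 = lam / 2 * ((norm v - norm w) * (norm v + norm w))"
    by (simp add: field_simps power2_eq_square)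
  have "\<bar>lam / 2 * (norm v)\<^sup>2 - lam / 2 * (norm w)\<^sup>2\<bar> = lam / 2 * (\<bar>norm v - norm w\<bar> * (norm v + norm w))"
    unfolding eq using lam by (simp add: abs_mult)
  moreover have "L * norm (v - w) = k * \<bar>c\<bar> * norm (v - w) + lam / 2 * (norm (v - w) * (2 * r))"
    by (simp add: L_def algebra_simps)
  ultimately show ?thesis using 1 unfolding j_def by linarith
qed

text \<open>Serves twice: nested sublevel sets give existence of a minimizer, and a sublevel set
  containing a tail of the iterates also contains its closed convex hull.\<close>

lemma sublevel_closed_convex: "closed {v \<in> K. j v \<le> a}" "convex {v \<in> K. j v \<le> a}"
proof -
  have "continuous_on K j"
  proof (rule continuous_onI)
    fix v e assume v: "v \<in> K" and e: "(e::real) > 0"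
    \<comment> \<open>The radius uses \<open>L + 1\<close> because \<open>L\<close> may be
      0.\<close>
    show "\<exists>b>0. \<forall>w\<in>K. dist w v < b \<longrightarrow> dist (j w) (j v) \<le> e"
    proof (intro exI[of _ "e / (L + 1)"] conjI ballI impI)
      fix w assume "w \<in> K" "dist w v < e / (L + 1)"
      then have "\<bar>j w - j v\<bar> \<le> L * norm (w - v)" "norm (w - v) * (L + 1) < e"
        using j_lipschitz v r(3) L_nonneg by (auto simp: dist_norm pos_less_divide_eq)
      moreover have "norm (w - v) * (L + 1) = L * norm (w - v) + norm (w - v)"
        by (simp add: algebra_simps)
      ultimately show "dist (j w) (j v) \<le> e"
        unfolding dist_real_def using norm_ge_zero[of "w - v"] by linarith
    qed (use e L_nonneg in auto)
  qed
  from continuous_on_closed_Collect_le[OF this continuous_on_const K(1)]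
  show "closed {v \<in> K. j v \<le> a}" .
  show "convex {v \<in> K. j v \<le> a}"
    unfolding convex_alt
  proof (intro ballI allI impI)
    fix v w t assume vw: "v \<in> {v \<in> K. j v \<le> a}" "w \<in> {v \<in> K. j v \<le> a}" and t: "0 \<le> t \<and> (t::real) \<le> 1"
    have "0 \<le> lam / 2 * (t * (1 - t)) * (norm (v - w))\<^sup>2" using lam t by simp
    then have "j ((1 - t) *\<^sub>R v + t *\<^sub>R w) \<le> (1 - t) * j v + t * j w"
      using j_strongly_convex[of t v w] t by linarith
    also have "\<dots> \<le> (1 - t) * a + t * a"
      using vw t by (intro add_mono mult_left_mono) auto
    finally show "(1 - t) *\<^sub>R v + t *\<^sub>R w \<in> {v \<in> K. j v \<le> a}"
      using convexD_alt[OF K(2)] vw t by (auto simp: algebra_simps)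
  qed
qed

text \<open>For \<open>lam = 0\<close> a minimizing sequence need not converge strongly. The
  sublevel sets slightly above the infimum are nested, bounded, closed and convex, and any common
  point of them is a minimizer.\<close>

lemma minimizer_exists: "minimizers \<noteq> {}"
proof -
  have j_nonneg: "0 \<le> j v" if "v \<in> K" for v
    using j0_bound(1)[OF r(3)[OF that]] lam by (simp add: j_def)
  have bdd: "bdd_below (j ` K)" using j_nonneg by (auto intro!: bdd_belowI)
  define m where "m = (INF v\<in>K. j v)"
  define C where "C n = {v \<in> K. j v \<le> m + inverse (real (Suc n))}" for n
  obtain x where x: "\<And>n. x \<in> C n"
  proof (rule decreasing_convex_Inter_nonempty[of C])
    show "closed (C n)" "convex (C n)" for n
      unfolding C_def by (rule sublevel_closed_convex)+
    show "C n \<noteq> {}" for n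
    proof -
      have "(INF v\<in>K. j v) < m + inverse (real (Suc n))" by (simp add: m_def)
      then show ?thesis using cINF_less_iff[OF K(4) bdd] by (auto simp: C_def intro: less_imp_le)
    qed
    show "C n \<subseteq> C i" if "i \<le> n" for i n
    proof
      fix v assume "v \<in> C n"
      moreover have "inverse (real (Suc n)) \<le> inverse (real (Suc i))"
        using that by (intro le_imp_inverse_le) auto
      ultimately have "v \<in> K" "j v \<le> m + inverse (real (Suc i))"
        unfolding C_def mem_Collect_eq by linarith+
      then show "v \<in> C i" by (simp add: C_def)
    qed
    show "bounded (C 0)" by (rule bounded_subset[OF K(3)]) (auto simp: C_def)
  qed blast
  have "(\<lambda>n. m + inverse (real (Suc n))) \<longlonglongrightarrow> m + 0"
    by (intro tendsto_intros LIMSEQ_inverse_real_of_nat)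
  then have "j x \<le> m + 0"
    by (rule LIMSEQ_le_const) (use x in \<open>auto simp: C_def\<close>)
  moreover have "m \<le> j w" if "w \<in> K" for w
    unfolding m_def using bdd that by (rule cINF_lower)
  ultimately show ?thesis using x[of 0] by (force simp: C_def minimizers_def)
qed

text \<open>Strong convexity at the midpoint has defect \<open>lam / 8\<close> times the squared
  distance; cancelling half of \<open>j w\<close> doubles it to \<open>lam / 4\<close>.\<close>

lemma minimizer_growth:
  assumes w: "w \<in> minimizers" and v: "v \<in> K"
  shows "lam / 4 * (norm (v - w))\<^sup>2 \<le> j v - j w"
proof -
  have "(1 - 1/2) *\<^sub>R v + (1/2) *\<^sub>R w \<in> K"
    using w v by (intro convexD_alt[OF K(2)]) (auto simp: minimizers_def)
  then have "j w \<le> j ((1 - 1/2) *\<^sub>R v + (1/2) *\<^sub>R w)"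
    using w by (simp add: minimizers_def)
  also have "\<dots> \<le> (1 - 1/2) * j v + (1/2) * j w - lam / 2 * (1/2 * (1 - 1/2)) * (norm (v - w))\<^sup>2"
    by (rule j_strongly_convex) auto
  finally show ?thesis by simp
qed

section \<open>Measurability of the iterates and the filtration of the samples\<close>

lemma u_traj: "s \<in> space P \<Longrightarrow> u n s = traj n (\<lambda>i. \<xi> i s)"
  by (induction n) (auto simp: u_0 u_Suc step_def G_def)

lemma traj_cong: "(\<And>i. i < n \<Longrightarrow> \<alpha> i = \<beta> i) \<Longrightarrow> traj n \<alpha> = traj n \<beta>"
  by (induction n) auto

lemma traj_bound: "norm (traj n \<alpha>) \<le> r"
  by (cases n) (auto simp: r step_def hproj_in K)

lemma u_bound: "s \<in> space P \<Longrightarrow> norm (u n s) \<le> r"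
  by (simp add: u_traj traj_bound)

lemma u_Suc_in: "s \<in> space P \<Longrightarrow> u (Suc n) s \<in> K"
  by (simp add: u_Suc hproj_in K)

lemma hproj_measurable[measurable]: "hproj K \<in> borel_measurable borel"
proof (rule borel_measurable_continuous_onI)
  have "1-lipschitz_on UNIV (hproj K)"
    using hproj_nonexpansive[OF K(1,2,4)] by (intro lipschitz_onI) (auto simp: dist_norm)
  then show "continuous_on UNIV (hproj K)" by (rule lipschitz_on_continuous_on)
qed

text \<open>The history length \<open>m\<close> is decoupled from \<open>n\<close>: the noise at
  step \<open>n\<close> combines the iterate \<open>n\<close> with the sample \<open>n\<close>, so
  the iterate must also be read off a history of length \<open>Suc n\<close>.\<close>

lemma traj_measurable: "n \<le> m \<Longrightarrow> traj n \<in> borel_measurable (PiM {..<m} (\<lambda>_. M))"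
proof (induction n)
  case 0
  have "traj 0 = (\<lambda>_. u0)" by (rule ext) simp
  then show ?case by simp
next
  case (Suc n)
  then have [measurable]: "traj n \<in> borel_measurable (PiM {..<m} (\<lambda>_. M))"
    and [measurable]: "(\<lambda>\<alpha>. \<alpha> n) \<in> measurable (PiM {..<m} (\<lambda>_. M)) M"
    by (auto intro: measurable_component_singleton)
  have "traj (Suc n) = (\<lambda>\<alpha>. step n (\<alpha> n) (traj n \<alpha>))" by (rule ext) simp
  then show ?case unfolding step_def G_def by simp
qed

definition past :: "nat \<Rightarrow> 's \<Rightarrow> nat \<Rightarrow> 'w" where "past n s = (\<lambda>i\<in>{..<n}. \<xi> i s)"

text \<open>The sigma-algebra generated by the first \<open>n\<close> samples. Its sets are
  preimages under \<open>past n\<close>, so conditions over them become integrals against the law of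
  the past.\<close>

definition F :: "nat \<Rightarrow> 's measure" where
  "F n = vimage_algebra (space P) (past n) (PiM {..<n} (\<lambda>_. M))"

lemma past_measurable: "past n \<in> measurable P (PiM {..<n} (\<lambda>_. M))"
  unfolding past_def by (rule measurable_restrict) (rule \<xi>_meas)

lemma past_measurable_F: "past n \<in> measurable (F n) (PiM {..<n} (\<lambda>_. M))"
  unfolding F_def using past_measurable
  by (intro measurable_vimage_algebra1) (auto simp: measurable_def)

lemma u_past: "s \<in> space P \<Longrightarrow> n \<le> m \<Longrightarrow> u n s = traj n (past m s)"
  unfolding u_traj by (rule traj_cong) (simp add: past_def)

text \<open>A family over the one-element index set \<open>{n}\<close> and not the bare variable, so
  that independence of disjoint blocks of indices applies directly.\<close>

definition present :: "nat \<Rightarrow> 's \<Rightarrow> nat \<Rightarrow> 'w" where "present n s = (\<lambda>i\<in>{n}. \<xi> i s)"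

lemma present_measurable: "present n \<in> measurable P (PiM {n} (\<lambda>_. M))"
  unfolding present_def by (rule measurable_restrict) (rule \<xi>_meas)

lemma indep_past_present:
  "P.indep_var (PiM {..<n} (\<lambda>_. M)) (past n) (PiM {n} (\<lambda>_. M)) (present n)"
  using P.indep_var_restrict[OF \<xi>_indep, of "{..<n}" "{n}"]
  by (simp add: past_def[abs_def] present_def[abs_def])

text \<open>Sampled gap minus expected gap between \<open>v\<close> and \<open>w\<close>. The
  penalty terms agree in both gaps and cancel.\<close>

definition noise :: "'h \<Rightarrow> 'w \<Rightarrow> 'h \<Rightarrow> real" where
  "noise w \<omega> v = (J \<omega> v - j0 v) - (J \<omega> w - j0 w)"

lemma noise_measurable[measurable (raw)]:
  assumes [measurable]: "f \<in> measurable N M" "g \<in> borel_measurable N"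
  shows "(\<lambda>x. noise w (f x) (g x)) \<in> borel_measurable N"
  unfolding noise_def by measurable

text \<open>\<open>J\<close> and its mean both lie between 0 and \<open>k\<^sup>2\<close>, so each
  of the two centred terms is at most \<open>k\<^sup>2\<close> in modulus.\<close>

lemma noise_bound:
  assumes "\<omega> \<in> space M" "norm v \<le> r" "norm w \<le> r"
  shows "\<bar>noise w \<omega> v\<bar> \<le> 2 * k\<^sup>2"
  using assms J_bound[of \<omega> v] J_bound[of \<omega> w] J_nonneg[of \<omega> v] J_nonneg[of \<omega> w]
    j0_bound[of v] j0_bound[of w] unfolding noise_def by linarith

lemma noise_mean: "(\<integral>\<omega>. noise w \<omega> v \<partial>M) = 0"
  unfolding noise_def by (simp add: J_integrable j0_def M.prob_space)

text \<open>Given the past, the iterate is frozen and the sample is a fresh draw from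
  \<open>M\<close>, so the centred noise averages to 0. With increments of size O(tau_n) and square
  summable steps, the martingale difference theorem applies.\<close>

lemma noise_summable:
  assumes w: "norm w \<le> r"
  shows "AE s in P. summable (\<lambda>n. \<tau> n * noise w (\<xi> n s) (u n s))"
proof -
  interpret X: bounded_martingale_differences P F "\<lambda>n s. \<tau> n * noise w (\<xi> n s) (u n s)" "\<lambda>n. \<tau> n * (2 * k\<^sup>2)"
  proof
    fix n
    show sub: "subalgebra P (F n)"
      unfolding subalgebra_def F_def
      using past_measurable[of n] by (auto simp: sets_vimage_algebra2 measurable_def)
    have restr: "(\<lambda>\<alpha>. restrict \<alpha> {..<n}) \<in> measurable (PiM {..<Suc n} (\<lambda>_. M)) (PiM {..<n} (\<lambda>_. M))"
      by (rule measurable_restrict_subset) auto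
    have "past n \<in> measurable (F (Suc n)) (PiM {..<n} (\<lambda>_. M))"
    proof -
      have "past n = (\<lambda>s. restrict (past (Suc n) s) {..<n})"
        by (auto simp: past_def fun_eq_iff)
      then show ?thesis using measurable_compose[OF past_measurable_F restr] by simp
    qed
    then show "sets (F n) \<subseteq> sets (F (Suc n))"
      unfolding F_def[of n] using past_measurable[of n]
      by (auto simp: sets_vimage_algebra2 measurable_def F_def)
    \<comment> \<open>The iterate agrees with the trajectory only on \<open>space P\<close>.
      Measurability is therefore shown for the trajectory of the past and then transferred by
      congruence.\<close>
    have "(\<lambda>s. \<tau> n * noise w (past (Suc n) s n) (traj n (past (Suc n) s))) \<in> borel_measurable (F (Suc n))"
    proof -
      have [measurable]: "traj n \<in> borel_measurable (PiM {..<Suc n} (\<lambda>_. M))" "(\<lambda>\<alpha>. \<alpha> n) \<in> measurable (PiM {..<Suc n} (\<lambda>_. M)) M"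
        by (auto intro: traj_measurable measurable_component_singleton)
      have "(\<lambda>\<alpha>. \<tau> n * noise w (\<alpha> n) (traj n \<alpha>)) \<in> borel_measurable (PiM {..<Suc n} (\<lambda>_. M))"
        by measurable
      from measurable_compose[OF past_measurable_F this] show ?thesis .
    qed
    also have "?this \<longleftrightarrow> (\<lambda>s. \<tau> n * noise w (\<xi> n s) (u n s)) \<in> borel_measurable (F (Suc n))"
    proof (rule measurable_cong)
      fix s assume "s \<in> space (F (Suc n))"
      then have "s \<in> space P" by (simp add: F_def)
      then show "\<tau> n * noise w (past (Suc n) s n) (traj n (past (Suc n) s)) = \<tau> n * noise w (\<xi> n s) (u n s)"
        using u_past[of s n "Suc n"] by (simp add: past_def)
    qed
    finally show "(\<lambda>s. \<tau> n * noise w (\<xi> n s) (u n s)) \<in> borel_measurable (F (Suc n))" .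
    show "\<bar>\<tau> n * noise w (\<xi> n s) (u n s)\<bar> \<le> \<tau> n * (2 * k\<^sup>2)" if "s \<in> space P" for s
      using noise_bound[of "\<xi> n s" "u n s" w] measurable_space[OF \<xi>_meas that] u_bound[OF that] w \<tau>_pos[of n]
      by (simp add: abs_mult)
    show "(\<integral>s\<in>A. \<tau> n * noise w (\<xi> n s) (u n s) \<partial>P) = 0" if A: "A \<in> sets (F n)" for A
    proof -
      obtain A' where A': "A' \<in> sets (PiM {..<n} (\<lambda>_. M))" "A = past n -` A' \<inter> space P"
        using A past_measurable[of n] by (auto simp: F_def sets_vimage_algebra2 measurable_def)
      \<comment> \<open>The integrand split along independent blocks: the past decides membership in
        \<open>A\<close> and the iterate, the present supplies the sample. Fubini can then integrate
        out the present first.\<close>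
      define f where "f = (\<lambda>(\<alpha>, \<beta>). indicator A' \<alpha> * noise w (\<beta> n) (traj n \<alpha>))"
      have [measurable]: "traj n \<in> borel_measurable (PiM {..<n} (\<lambda>_. M))"
        by (rule traj_measurable) simp
      have comp[measurable]: "(\<lambda>\<beta>. \<beta> n) \<in> measurable (PiM {n} (\<lambda>_. M)) M"
        by (rule measurable_component_singleton) simp
      have [measurable]: "f \<in> borel_measurable (PiM {..<n} (\<lambda>_. M) \<Otimes>\<^sub>M PiM {n} (\<lambda>_. M))"
        unfolding f_def using A'(1) by measurable
      define Q where "Q = distr P (PiM {..<n} (\<lambda>_. M)) (past n)"
      define R where "R = distr P (PiM {n} (\<lambda>_. M)) (present n)"
      interpret Q: prob_space Q unfolding Q_def by (rule P.prob_space_distr[OF past_measurable])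
      interpret R: prob_space R unfolding R_def by (rule P.prob_space_distr[OF present_measurable])
      interpret QR: pair_prob_space Q R ..
      have setsQ[measurable_cong]: "sets Q = sets (PiM {..<n} (\<lambda>_. M))" by (simp add: Q_def)
      have setsR[measurable_cong]: "sets R = sets (PiM {n} (\<lambda>_. M))" by (simp add: R_def)
      have joint: "Q \<Otimes>\<^sub>M R = distr P (PiM {..<n} (\<lambda>_. M) \<Otimes>\<^sub>M PiM {n} (\<lambda>_. M)) (\<lambda>s. (past n s, present n s))"
        using indep_past_present[of n] unfolding P.indep_var_distribution_eq Q_def R_def by simp
      \<comment> \<open>The fresh sample has law \<open>M\<close>, so the inner integral is the mean
        of the noise at a fixed iterate, which is 0.\<close>
      have R_M: "distr R M (\<lambda>\<beta>. \<beta> n) = M"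
        unfolding R_def using \<xi>_distr[of n] present_measurable comp
        by (subst distr_distr) (auto simp: comp_def present_def)
      have "(\<integral>s\<in>A. \<tau> n * noise w (\<xi> n s) (u n s) \<partial>P) = (\<integral>s. \<tau> n * f (past n s, present n s) \<partial>P)"
        unfolding set_lebesgue_integral_def
        by (intro Bochner_Integration.integral_cong)
          (auto simp: f_def A'(2) indicator_def u_past[OF _ order_refl] present_def)
      also have "\<dots> = \<tau> n * (\<integral>s. f (past n s, present n s) \<partial>P)" by simp
      also have "(\<integral>s. f (past n s, present n s) \<partial>P) = (\<integral>x. f x \<partial>(Q \<Otimes>\<^sub>M R))"
        unfolding joint using past_measurable[of n] present_measurable[of n]
        by (subst integral_distr) auto
      also have "\<dots> = (\<integral>\<alpha>. (\<integral>\<beta>. f (\<alpha>, \<beta>) \<partial>R) \<partial>Q)"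
      proof (rule QR.integral_fst'[symmetric])
        show "integrable (Q \<Otimes>\<^sub>M R) f"
        proof (rule QR.integrable_const_bound[of _ "2 * k\<^sup>2"])
          show "AE x in Q \<Otimes>\<^sub>M R. norm (f x) \<le> 2 * k\<^sup>2"
          proof (rule AE_I2)
            fix x assume "x \<in> space (Q \<Otimes>\<^sub>M R)"
            then have "snd x \<in> space (PiM {n} (\<lambda>_. M))"
              by (auto simp: space_pair_measure R_def)
            then have "snd x n \<in> space M" by (auto simp: space_PiM)
            then have "\<bar>noise w (snd x n) (traj n (fst x))\<bar> \<le> 2 * k\<^sup>2"
              using traj_bound w by (rule noise_bound)
            then show "norm (f x) \<le> 2 * k\<^sup>2"
              by (auto simp: f_def indicator_def split_beta)
          qed
        qed measurable
      qed
      also have "\<dots> = 0"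
      proof -
        have "(\<integral>\<beta>. noise w (\<beta> n) v \<partial>R) = (\<integral>\<omega>. noise w \<omega> v \<partial>distr R M (\<lambda>\<beta>. \<beta> n))" for v
          by (rule integral_distr[symmetric]) measurable
        then show ?thesis unfolding f_def R_M by (simp add: noise_mean)
      qed
      finally show ?thesis by simp
    qed
    show "summable (\<lambda>n. (\<tau> n * (2 * k\<^sup>2))\<^sup>2)"
      using summable_mult2[OF \<tau>_sq, of "(2 * k\<^sup>2)\<^sup>2"] by (simp add: power_mult_distrib)
  qed
  show ?thesis by (rule X.AE_summable)
qed

section \<open>The descent estimate and the two convergence statements\<close>

definition g :: real where "g = lam * r + \<bar>c\<bar> * k"

lemma G_bound:
  assumes "\<omega> \<in> space M" "norm v \<le> r"
  shows "norm (G \<omega> v) \<le> g"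
proof -
  have "norm (T \<omega> (d - T \<omega> v)) \<le> \<bar>c\<bar> * norm (d - T \<omega> v)"
    using T_bound[OF assms(1)] by (rule order_trans) (simp add: mult_right_mono)
  also have "\<dots> \<le> \<bar>c\<bar> * k"
    using T_bound'[OF assms] by (intro mult_left_mono) (auto simp: norm_minus_commute)
  finally have "norm (T \<omega> (d - T \<omega> v)) \<le> \<bar>c\<bar> * k" .
  moreover have "norm (lam *\<^sub>R v) \<le> lam * r"
    using assms(2) lam by (simp add: mult_left_mono)
  ultimately show ?thesis
    unfolding G_def g_def using norm_triangle_ineq4[of "lam *\<^sub>R v" "T \<omega> (d - T \<omega> v)"] by linarith
qed

text \<open>Symmetry of \<open>T \<omega>\<close> moves the operator to the other side, turning the
  tracking part of the inner product into that of \<open>T \<omega> v - d\<close> with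
  \<open>T \<omega> (v - w)\<close>. The convexity inequality for half the squared norm is then used
  once for the tracking term and once, scaled by \<open>lam\<close>, for the penalty.\<close>

lemma G_subgradient:
  assumes "\<omega> \<in> space M"
  shows "(J \<omega> v + lam / 2 * (norm v)\<^sup>2) - (J \<omega> w + lam / 2 * (norm w)\<^sup>2) \<le> G \<omega> v \<bullet> (v - w)"
proof -
  interpret linear "T \<omega>" using assms by (rule T_linear)
  have half: "1/2 * (norm a)\<^sup>2 - 1/2 * (norm b)\<^sup>2 \<le> a \<bullet> (a - b)" for a b :: 'h
  proof -
    have "0 \<le> 1/2 * (norm (a - b))\<^sup>2" by simp
    then show ?thesis
      by (simp add: power2_norm_eq_inner inner_diff_left inner_diff_right inner_commute algebra_simps)
  qed
  have "G \<omega> v \<bullet> (v - w) = lam * (v \<bullet> (v - w)) + (T \<omega> v - d) \<bullet> T \<omega> (v - w)"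
    using T_sym[OF assms, of "d - T \<omega> v" "v - w"]
    by (simp add: G_def inner_diff_left algebra_simps)
  also have "T \<omega> (v - w) = (T \<omega> v - d) - (T \<omega> w - d)" by (simp add: diff)
  finally show ?thesis
    using half[of "T \<omega> v - d" "T \<omega> w - d"] mult_left_mono[OF half[of v w] lam]
    by (simp add: J_def algebra_simps)
qed

text \<open>A point \<open>w\<close> of \<open>K\<close> is its own projection, so nonexpansiveness
  compares the new iterate with \<open>w\<close> before projection; expanding the square leaves the
  subgradient inequality. Only \<open>w\<close> has to lie in \<open>K\<close>, not the current
  iterate.\<close>

lemma descent:
  assumes s: "s \<in> space P" and w: "w \<in> K"
  shows "(norm (u (Suc n) s - w))\<^sup>2 \<le> (norm (u n s - w))\<^sup>2 - 2 * \<tau> n * (j (u n s) - j w)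
    + ((\<tau> n)\<^sup>2 * g\<^sup>2 - 2 * (\<tau> n * noise w (\<xi> n s) (u n s)))"
proof -
  define v \<omega> where "v = u n s" and "\<omega> = \<xi> n s"
  have \<omega>: "\<omega> \<in> space M" unfolding \<omega>_def using measurable_space[OF \<xi>_meas s] .
  have v: "norm v \<le> r" unfolding v_def using u_bound[OF s] .
  have "norm (u (Suc n) s - w) = norm (hproj K (v - \<tau> n *\<^sub>R G \<omega> v) - hproj K w)"
    using s w by (simp add: u_Suc v_def \<omega>_def G_def hproj_id K)
  also have "\<dots> \<le> norm (v - \<tau> n *\<^sub>R G \<omega> v - w)" by (rule hproj_nonexpansive[OF K(1,2,4)])
  finally have "(norm (u (Suc n) s - w))\<^sup>2 \<le> (norm (v - \<tau> n *\<^sub>R G \<omega> v - w))\<^sup>2"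
    by (rule power_mono) simp
  also have "\<dots> = (norm (v - w))\<^sup>2 - 2 * \<tau> n * (G \<omega> v \<bullet> (v - w)) + (\<tau> n)\<^sup>2 * (norm (G \<omega> v))\<^sup>2"
    using norm_sq_diff_scaleR[of "v - w" "\<tau> n" "G \<omega> v"] by (simp add: algebra_simps)
  also have "\<dots> \<le> (norm (v - w))\<^sup>2 - 2 * \<tau> n * (j v - j w + noise w \<omega> v) + (\<tau> n)\<^sup>2 * g\<^sup>2"
  proof -
    have "j v - j w + noise w \<omega> v \<le> G \<omega> v \<bullet> (v - w)"
      using G_subgradient[OF \<omega>, of v w] by (simp add: j_def noise_def)
    then have "2 * \<tau> n * (j v - j w + noise w \<omega> v) \<le> 2 * \<tau> n * (G \<omega> v \<bullet> (v - w))"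
      using \<tau>_pos[of n] by (intro mult_left_mono) auto
    moreover have "(\<tau> n)\<^sup>2 * (norm (G \<omega> v))\<^sup>2 \<le> (\<tau> n)\<^sup>2 * g\<^sup>2"
      using G_bound[OF \<omega> v] by (intro mult_left_mono power_mono) auto
    ultimately show ?thesis by linarith
  qed
  finally show ?thesis by (simp add: v_def \<omega>_def algebra_simps)
qed

lemma descent_limits:
  assumes s: "s \<in> space P" and w: "w \<in> minimizers"
    and noise: "summable (\<lambda>n. \<tau> n * noise w (\<xi> n s) (u n s))"
  shows "convergent (\<lambda>n. norm (u n s - w))"
    and "summable (\<lambda>n. \<tau> (Suc n) * (j (u (Suc n) s) - j w))"
proof -
  \<comment> \<open>The gap is nonnegative only for iterates in \<open>K\<close>, that is from index
    1 on; hence the shifted recursion below.\<close>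
  have wK: "w \<in> K" and gap: "\<And>n. 0 \<le> j (u (Suc n) s) - j w"
    using w u_Suc_in[OF s] by (auto simp: minimizers_def)
  define q where "q n = (\<tau> n)\<^sup>2 * g\<^sup>2 - 2 * (\<tau> n * noise w (\<xi> n s) (u n s))" for n
  have "summable q"
    unfolding q_def by (intro summable_diff summable_mult summable_mult2 \<tau>_sq noise)
  then have q: "summable (\<lambda>n. q (Suc n))" by (simp add: summable_Suc_iff)
  have step: "(norm (u (Suc (Suc n)) s - w))\<^sup>2 \<le> (norm (u (Suc n) s - w))\<^sup>2
      - 2 * \<tau> (Suc n) * (j (u (Suc n) s) - j w) + q (Suc n)" for n
    using descent[OF s wK, of "Suc n"] by (simp add: q_def)
  have nonneg: "0 \<le> 2 * \<tau> (Suc n) * (j (u (Suc n) s) - j w)" for n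
    using \<tau>_pos[of "Suc n"] gap[of n] by simp
  note lim = perturbed_descent_converges[of "\<lambda>n. (norm (u (Suc n) s - w))\<^sup>2"
      "\<lambda>n. 2 * \<tau> (Suc n) * (j (u (Suc n) s) - j w)" "\<lambda>n. q (Suc n)", OF _ nonneg step q, simplified]
  show "summable (\<lambda>n. \<tau> (Suc n) * (j (u (Suc n) s) - j w))"
    using summable_mult[OF lim(2), of "1/2"] by (simp add: mult_ac)
  obtain l where "(\<lambda>n. (norm (u (Suc n) s - w))\<^sup>2) \<longlonglongrightarrow> l"
    using lim(1) by (auto simp: convergent_def)
  then have "(\<lambda>n. sqrt ((norm (u (Suc n) s - w))\<^sup>2)) \<longlonglongrightarrow> sqrt l" by (rule tendsto_real_sqrt)
  then have "(\<lambda>n. norm (u (Suc n) s - w)) \<longlonglongrightarrow> sqrt l" by simp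
  then show "convergent (\<lambda>n. norm (u n s - w))"
    unfolding convergent_def using LIMSEQ_imp_Suc[of "\<lambda>n. norm (u n s - w)"] by blast
qed

lemma objective_converges:
  assumes s: "s \<in> space P" and w: "w \<in> minimizers"
    and noise: "summable (\<lambda>n. \<tau> n * noise w (\<xi> n s) (u n s))"
  shows "(\<lambda>n. j (u n s)) \<longlonglongrightarrow> j w"
proof -
  define b where "b n = j (u (Suc n) s) - j w" for n
  have "b \<longlonglongrightarrow> 0"
  proof (rule weighted_summable_slowly_varying_tendsto_0)
    show "0 < \<tau> (Suc n)" for n by (rule \<tau>_pos)
    show "\<not> summable (\<lambda>n. \<tau> (Suc n))" using \<tau>_sum by (simp add: summable_Suc_iff)
    show "0 \<le> b n" for n
      using w u_Suc_in[OF s] by (auto simp: minimizers_def b_def)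
    show "summable (\<lambda>n. \<tau> (Suc n) * b n)"
      unfolding b_def by (rule descent_limits[OF s w noise])
    \<comment> \<open>The iterate \<open>u (Suc n)\<close> lies in \<open>K\<close> and is its own
      projection, so one step moves it by at most the step size times \<open>g\<close>. Lipschitz
      continuity of \<open>j\<close> turns this into slow variation of the gap.\<close>
    show "\<bar>b (Suc n) - b n\<bar> \<le> (L * g) * \<tau> (Suc n)" for n
    proof -
      define v \<omega> where "v = u (Suc n) s" and "\<omega> = \<xi> (Suc n) s"
      have \<omega>: "\<omega> \<in> space M" unfolding \<omega>_def using measurable_space[OF \<xi>_meas s] .
      have vK: "v \<in> K" unfolding v_def by (rule u_Suc_in[OF s])
      have "norm (u (Suc (Suc n)) s - v) = norm (hproj K (v - \<tau> (Suc n) *\<^sub>R G \<omega> v) - hproj K v)"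
        using s vK by (simp add: u_Suc[of s "Suc n"] v_def[symmetric] \<omega>_def G_def hproj_id K)
      also have "\<dots> \<le> norm (v - \<tau> (Suc n) *\<^sub>R G \<omega> v - v)" by (rule hproj_nonexpansive[OF K(1,2,4)])
      also have "\<dots> = \<tau> (Suc n) * norm (G \<omega> v)" using \<tau>_pos[of "Suc n"] by simp
      also have "\<dots> \<le> \<tau> (Suc n) * g"
        using G_bound[OF \<omega> r(3)[OF vK]] \<tau>_pos[of "Suc n"] by (intro mult_left_mono) auto
      finally have "L * norm (u (Suc (Suc n)) s - v) \<le> L * (\<tau> (Suc n) * g)"
        using L_nonneg by (rule mult_left_mono)
      then show ?thesis
        using j_lipschitz[OF u_bound[OF s, of "Suc (Suc n)"] u_bound[OF s, of "Suc n"]]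
        by (simp add: b_def v_def mult_ac)
    qed
  qed
  then have "(\<lambda>n. b n + j w) \<longlonglongrightarrow> 0 + j w" by (intro tendsto_intros)
  then have "(\<lambda>n. j (u (Suc n) s)) \<longlonglongrightarrow> j w" by (simp add: b_def)
  then show ?thesis by (rule LIMSEQ_imp_Suc)
qed

theorem strong_convergence:
  assumes "lam \<noteq> 0"
  shows "\<exists>w\<in>minimizers. (\<forall>v\<in>minimizers. v = w) \<and> (AE s in P. (\<lambda>n. u n s) \<longlonglongrightarrow> w)"
proof -
  obtain w where w: "w \<in> minimizers" using minimizer_exists by blast
  have pos: "lam > 0" using lam assms by simp
  have uniq: "v = w" if "v \<in> minimizers" for v
  proof -
    have "j v - j w \<le> 0" "v \<in> K" using that w by (auto simp: minimizers_def)
    then have "lam / 4 * (norm (v - w))\<^sup>2 \<le> 0" using minimizer_growth[OF w, of v] by linarith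
    then show ?thesis using pos by (simp add: mult_le_0_iff)
  qed
  have "AE s in P. summable (\<lambda>n. \<tau> n * noise w (\<xi> n s) (u n s))"
    using w by (intro noise_summable r(3)) (simp add: minimizers_def)
  then have "AE s in P. (\<lambda>n. u n s) \<longlonglongrightarrow> w"
    using AE_space
  proof eventually_elim
    case (elim s)
    then have noise: "summable (\<lambda>n. \<tau> n * noise w (\<xi> n s) (u n s))" and s: "s \<in> space P" by auto
    have "(\<lambda>n. j (u (Suc n) s) - j w) \<longlonglongrightarrow> j w - j w"
      by (rule tendsto_diff[OF LIMSEQ_Suc[OF objective_converges[OF s w noise]] tendsto_const])
    then have "(\<lambda>n. 4 / lam * (j (u (Suc n) s) - j w)) \<longlonglongrightarrow> 4 / lam * (j w - j w)"
      by (rule tendsto_mult_left)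
    then have lim: "(\<lambda>n. 4 / lam * (j (u (Suc n) s) - j w)) \<longlonglongrightarrow> 0" by simp
    have "(\<lambda>n. (norm (u (Suc n) s - w))\<^sup>2) \<longlonglongrightarrow> 0"
    proof (rule tendsto_sandwich[OF _ _ tendsto_const lim])
      show "\<forall>\<^sub>F n in sequentially. (norm (u (Suc n) s - w))\<^sup>2 \<le> 4 / lam * (j (u (Suc n) s) - j w)"
        using minimizer_growth[OF w u_Suc_in[OF s]] pos
        by (intro always_eventually allI) (simp add: field_simps)
    qed auto
    then have "(\<lambda>n. sqrt ((norm (u (Suc n) s - w))\<^sup>2)) \<longlonglongrightarrow> sqrt 0" by (rule tendsto_real_sqrt)
    then have "(\<lambda>n. u (Suc n) s - w) \<longlonglongrightarrow> 0" by (simp add: tendsto_norm_zero_iff)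
    then have "(\<lambda>n. u (Suc n) s) \<longlonglongrightarrow> w" by (rule LIM_zero_cancel)
    then show ?case by (rule LIMSEQ_imp_Suc)
  qed
  then show ?thesis using w uniq by blast
qed

text \<open>The exceptional set of the noise depends on \<open>w\<close>. A countable dense set of
  minimizers yields one common null set, and since the distance to \<open>w\<close> is 1-Lipschitz
  in \<open>w\<close>, convergence of the distances extends to all minimizers.\<close>

theorem weak_convergence:
  "AE s in P. \<exists>w\<in>minimizers. \<forall>v. (\<lambda>n. u n s \<bullet> v) \<longlonglongrightarrow> w \<bullet> v"
proof -
  obtain S where S: "countable S" "S \<subseteq> minimizers" "minimizers \<subseteq> closure S"
    using separable by blast
  have "AE s in P. \<forall>w\<in>S. summable (\<lambda>n. \<tau> n * noise w (\<xi> n s) (u n s))"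
    using S noise_summable r(3) by (subst AE_ball_countable) (auto simp: minimizers_def)
  then show ?thesis
    using AE_space
  proof eventually_elim
    case (elim s)
    then have s: "s \<in> space P" by simp
    obtain w0 where w0: "w0 \<in> S"
      using minimizer_exists S(3) by fastforce
    then have w0m: "w0 \<in> minimizers" using S by blast
    have conv: "convergent (\<lambda>n. norm (u n s - w))" if wm: "w \<in> minimizers" for w
    proof -
      have "Cauchy (\<lambda>n. norm (u n s - w))"
      proof (rule metric_CauchyI)
        fix e :: real assume "e > 0"
        obtain w' where w': "w' \<in> S" "dist w' w < e/3"
          using S(3) wm \<open>e > 0\<close> closure_approachableD[of w S "e/3"] by (auto simp: dist_commute)
        have "Cauchy (\<lambda>n. norm (u n s - w'))"
          using descent_limits(1)[OF s, of w'] w' S elim by (intro convergent_Cauchy) auto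
        then obtain N where N: "\<And>m n. m \<ge> N \<Longrightarrow> n \<ge> N \<Longrightarrow> dist (norm (u m s - w')) (norm (u n s - w')) < e/3"
          using \<open>e > 0\<close> unfolding Cauchy_def by (metis divide_pos_pos zero_less_numeral)
        have near: "\<bar>norm (u n s - w) - norm (u n s - w')\<bar> < e/3" for n
          using norm_triangle_ineq3[of "u n s - w" "u n s - w'"] w'(2) by (simp add: dist_norm)
        have "dist (norm (u m s - w)) (norm (u n s - w)) < e" if "m \<ge> N" "n \<ge> N" for m n
          using N[OF that] near[of m] near[of n] unfolding dist_real_def by linarith
        then show "\<exists>N. \<forall>m\<ge>N. \<forall>n\<ge>N. dist (norm (u m s - w)) (norm (u n s - w)) < e" by blast
      qed
      then show ?thesis by (rule Cauchy_convergent)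
    qed
    have lim: "(\<lambda>n. j (u n s)) \<longlonglongrightarrow> j w0"
      using objective_converges[OF s w0m] w0 elim by blast
    show ?case
    proof (rule weak_convergence_Opial[OF _ conv])
      show "bounded (range (\<lambda>n. u n s))"
        using u_bound[OF s] by (auto simp: bounded_iff)
      fix z assume z: "\<And>m. z \<in> closure (convex hull ((\<lambda>n. u n s) ` {m..}))"
      \<comment> \<open>A tail of the iterates lies in this closed convex sublevel set, hence so
        does its closed convex hull. Starting the tail at \<open>Suc m\<close> skips the initial
        point, which may lie outside \<open>K\<close>.\<close>
      have "z \<in> {v \<in> K. j v \<le> j w0 + e}" if "e > 0" for e
      proof -
        have "\<forall>\<^sub>F n in sequentially. j (u n s) < j w0 + e"
          using order_tendstoD(2)[OF lim] that by simp
        then obtain m where m: "\<And>n. n \<ge> m \<Longrightarrow> j (u n s) < j w0 + e"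
          by (auto simp: eventually_sequentially)
        have "(\<lambda>n. u n s) ` {Suc m..} \<subseteq> {v \<in> K. j v \<le> j w0 + e}"
        proof (rule image_subsetI)
          fix n assume n: "n \<in> {Suc m..}"
          then obtain i where "n = Suc i" by (cases n) auto
          then show "u n s \<in> {v \<in> K. j v \<le> j w0 + e}"
            using m[of n] n u_Suc_in[OF s, of i] by auto
        qed
        then have "closure (convex hull ((\<lambda>n. u n s) ` {Suc m..})) \<subseteq> {v \<in> K. j v \<le> j w0 + e}"
          by (intro closure_minimal hull_minimal sublevel_closed_convex)
        then show ?thesis using z by blast
      qed
      then have z': "z \<in> K" "\<And>e. e > 0 \<Longrightarrow> j z \<le> j w0 + e"
        using zero_less_one by blast+
      from z'(2) have "j z \<le> j w0" by (rule field_le_epsilon)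
      with z'(1) show "z \<in> minimizers"
        using w0m by (auto simp: minimizers_def intro: order_trans)
    qed
  qed
qed

end


subsection \<open>The Hilbert space of square integrable functions\<close>

text \<open>Functions on the whole space: a domain enters only later through extension by zero, so
  L2 is one type and not a family indexed by sets.\<close>

definition sqint :: "('a::euclidean_space \<Rightarrow> 'b::euclidean_space) \<Rightarrow> bool" where
  "sqint f \<longleftrightarrow> f \<in> borel_measurable lebesgue \<and> integrable lebesgue (\<lambda>x. (norm (f x))\<^sup>2)"

lemma sqint_meas: "sqint f \<Longrightarrow> f \<in> borel_measurable lebesgue"
  and sqint_int: "sqint f \<Longrightarrow> integrable lebesgue (\<lambda>x. (norm (f x))\<^sup>2)"
  by (auto simp: sqint_def)

lemma sqint_dominated:
  assumes g: "integrable lebesgue g" and f: "f \<in> borel_measurable lebesgue"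
    and le: "\<And>x. (norm (f x))\<^sup>2 \<le> g x"
  shows "sqint f"
  unfolding sqint_def
proof
  show "integrable lebesgue (\<lambda>x. (norm (f x))\<^sup>2)"
    by (rule Bochner_Integration.integrable_bound[OF g])
      (use f le in \<open>auto intro!: AE_I2 order_trans[OF le]\<close>)
qed fact

lemma sqint_zero: "sqint (\<lambda>x. 0)"
  by (simp add: sqint_def)

lemma sqint_scaleR: "sqint f \<Longrightarrow> sqint (\<lambda>x. c *\<^sub>R f x)"
  by (auto simp: sqint_def power_mult_distrib)

lemma norm_sq_add_le: "(norm (x + y))\<^sup>2 \<le> 2 * (norm x)\<^sup>2 + 2 * (norm (y::'b::real_inner))\<^sup>2"
proof -
  have "(norm (x + y))\<^sup>2 + (norm (x - y))\<^sup>2 = 2 * (norm x)\<^sup>2 + 2 * (norm y)\<^sup>2"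
    by (simp add: power2_norm_eq_inner inner_add_left inner_add_right inner_diff_left inner_diff_right inner_commute)
  moreover have "0 \<le> (norm (x - y))\<^sup>2" by simp
  ultimately show ?thesis by linarith
qed

lemma sqint_add:
  assumes "sqint f" "sqint g"
  shows "sqint (\<lambda>x. f x + g x)"
  by (rule sqint_dominated[where g="\<lambda>x. 2 * (norm (f x))\<^sup>2 + 2 * (norm (g x))\<^sup>2"])
    (use assms in \<open>auto simp: sqint_def norm_sq_add_le\<close>)

lemma sqint_uminus: "sqint f \<Longrightarrow> sqint (\<lambda>x. - f x)"
  by (auto simp: sqint_def)

lemma sqint_diff: "sqint f \<Longrightarrow> sqint g \<Longrightarrow> sqint (\<lambda>x. f x - g x)"
  using sqint_add[OF _ sqint_uminus, of f g] by simp

lemma sqint_inner: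
  assumes "sqint f" "sqint g"
  shows "integrable lebesgue (\<lambda>x. f x \<bullet> g x)"
proof (rule Bochner_Integration.integrable_bound)
  show "integrable lebesgue (\<lambda>x. (norm (f x))\<^sup>2 + (norm (g x))\<^sup>2)"
    using assms by (auto simp: sqint_def)
  show "(\<lambda>x. f x \<bullet> g x) \<in> borel_measurable lebesgue"
    using assms by (auto simp: sqint_def)
  show "AE x in lebesgue. norm (f x \<bullet> g x) \<le> norm ((norm (f x))\<^sup>2 + (norm (g x))\<^sup>2)"
  proof (rule AE_I2)
    fix x
    have "\<bar>f x \<bullet> g x\<bar> \<le> norm (f x) * norm (g x)" by (rule Cauchy_Schwarz_ineq2)
    moreover have "2 * (norm (f x) * norm (g x)) \<le> (norm (f x))\<^sup>2 + (norm (g x))\<^sup>2"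
      using sum_squares_bound[of "norm (f x)" "norm (g x)"] by simp
    moreover have "0 \<le> norm (f x) * norm (g x)" by simp
    ultimately show "norm (f x \<bullet> g x) \<le> norm ((norm (f x))\<^sup>2 + (norm (g x))\<^sup>2)"
      unfolding real_norm_def by linarith
  qed
qed

\<comment> \<open>The relation is partial because only square integrable functions have a class.
  \<open>rep_l2\<close> picks an arbitrary representative, so pointwise facts about it hold only
  almost everywhere.\<close>
quotient_type (overloaded) ('a, 'b) l2 = "'a::euclidean_space \<Rightarrow> 'b::euclidean_space" /
  partial: "\<lambda>f g. sqint f \<and> sqint g \<and> (AE x in lebesgue. f x = g x)"
proof (rule part_equivpI)
  show "\<exists>f. sqint f \<and> sqint f \<and> (AE x in lebesgue. f x = f x)"
    using sqint_zero by auto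
  show "symp (\<lambda>f g :: 'a \<Rightarrow> 'b. sqint f \<and> sqint g \<and> (AE x in lebesgue. f x = g x))"
    by (auto simp: symp_def elim!: eventually_mono)
  show "transp (\<lambda>f g :: 'a \<Rightarrow> 'b. sqint f \<and> sqint g \<and> (AE x in lebesgue. f x = g x))"
    by (rule transpI) (auto elim!: eventually_elim2)
qed

instantiation l2 :: (euclidean_space, euclidean_space) real_vector
begin

lift_definition zero_l2 :: "('a, 'b) l2" is "\<lambda>x. 0" by (simp add: sqint_zero)

lift_definition plus_l2 :: "('a, 'b) l2 \<Rightarrow> ('a, 'b) l2 \<Rightarrow> ('a, 'b) l2" is "\<lambda>f g x. f x + g x"
  by (auto intro: sqint_add elim!: eventually_elim2)

lift_definition minus_l2 :: "('a, 'b) l2 \<Rightarrow> ('a, 'b) l2 \<Rightarrow> ('a, 'b) l2" is "\<lambda>f g x. f x - g x"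
  by (auto intro: sqint_diff elim!: eventually_elim2)

lift_definition uminus_l2 :: "('a, 'b) l2 \<Rightarrow> ('a, 'b) l2" is "\<lambda>f x. - f x"
  by (auto intro: sqint_uminus elim!: eventually_mono)

lift_definition scaleR_l2 :: "real \<Rightarrow> ('a, 'b) l2 \<Rightarrow> ('a, 'b) l2" is "\<lambda>c f x. c *\<^sub>R f x"
  by (auto intro: sqint_scaleR elim!: eventually_mono)

instance
proof
  fix x y z :: "('a, 'b) l2" and a b :: real
  show "x + y + z = x + (y + z)" by transfer (auto simp: add.assoc intro: sqint_add)
  show "x + y = y + x" by transfer (auto simp: add.commute intro: sqint_add)
  show "0 + x = x" by transfer auto
  show "- x + x = 0" by transfer (auto intro: sqint_zero)
  show "x - y = x + - y" by transfer (auto intro: sqint_diff)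
  show "a *\<^sub>R (x + y) = a *\<^sub>R x + a *\<^sub>R y"
    by transfer (auto simp: scaleR_add_right intro: sqint_add sqint_scaleR)
  show "(a + b) *\<^sub>R x = a *\<^sub>R x + b *\<^sub>R x"
    by transfer (auto simp: scaleR_add_left intro: sqint_add sqint_scaleR)
  show "a *\<^sub>R b *\<^sub>R x = (a * b) *\<^sub>R x" by transfer (auto intro: sqint_scaleR)
  show "1 *\<^sub>R x = x" by transfer auto
qed

end

instantiation l2 :: (euclidean_space, euclidean_space) real_inner
begin

lift_definition inner_l2 :: "('a, 'b) l2 \<Rightarrow> ('a, 'b) l2 \<Rightarrow> real" is "\<lambda>f g. \<integral>x. f x \<bullet> g x \<partial>lebesgue"
  by (rule integral_cong_AE) (auto intro: borel_measurable_inner dest: sqint_meas elim!: eventually_elim2)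

definition "norm (h :: ('a, 'b) l2) = sqrt (inner h h)"
definition "dist (h :: ('a, 'b) l2) k = norm (h - k)"
definition "sgn (h :: ('a, 'b) l2) = h /\<^sub>R norm h"
definition [code del]: "(uniformity :: (('a, 'b) l2 \<times> ('a, 'b) l2) filter)
  = (INF e\<in>{0 <..}. principal {(x, y). dist x y < e})"
definition [code del]: "open (U :: ('a, 'b) l2 set)
  \<longleftrightarrow> (\<forall>x\<in>U. eventually (\<lambda>(x', y). x' = x \<longrightarrow> y \<in> U) uniformity)"

instance
proof
  fix x y z :: "('a, 'b) l2" and a :: real
  show "x \<bullet> y = y \<bullet> x" by transfer (simp add: inner_commute)
  show "(x + y) \<bullet> z = x \<bullet> z + y \<bullet> z"
    by transfer (simp add: inner_add_left sqint_inner)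
  show "a *\<^sub>R x \<bullet> y = a * (x \<bullet> y)" by transfer simp
  show "0 \<le> x \<bullet> x" by transfer simp
  show "x \<bullet> x = 0 \<longleftrightarrow> x = 0"
  proof transfer
    fix f :: "'a \<Rightarrow> 'b"
    assume "sqint f \<and> sqint f \<and> (AE x in lebesgue. f x = f x)"
    then have f: "sqint f" by simp
    have "(\<integral>x. f x \<bullet> f x \<partial>lebesgue) = 0 \<longleftrightarrow> (AE x in lebesgue. f x \<bullet> f x = 0)"
      by (rule integral_nonneg_eq_0_iff_AE) (auto simp: sqint_inner f)
    then show "((\<integral>x. f x \<bullet> f x \<partial>lebesgue) = 0) =
      (sqint f \<and> sqint (\<lambda>x. 0::'b) \<and> (AE x in lebesgue. f x = 0))"
      by (simp add: f sqint_zero)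
  qed
qed (simp_all add: norm_l2_def dist_l2_def sgn_l2_def uniformity_l2_def open_l2_def)

end

section \<open>Classes and their representatives\<close>

lemma sqint_rep: "sqint (rep_l2 h)"
  using Quotient3_rep_reflp[OF Quotient3_l2] by blast

lemma abs_rep_l2: "abs_l2 (rep_l2 h) = h"
  by (rule Quotient3_abs_rep[OF Quotient3_l2])

lemma rep_abs_l2: "sqint f \<Longrightarrow> AE x in lebesgue. rep_l2 (abs_l2 f) x = f x"
  using Quotient3_rep_abs[OF Quotient3_l2, of f] by auto

lemma abs_l2_eqI: "sqint f \<Longrightarrow> sqint g \<Longrightarrow> AE x in lebesgue. f x = g x \<Longrightarrow> abs_l2 f = abs_l2 g"
  using Quotient3_rel_abs[OF Quotient3_l2, of f g] by auto

lemma inner_abs_l2: "sqint f \<Longrightarrow> sqint g \<Longrightarrow> abs_l2 f \<bullet> abs_l2 g = (\<integral>x. f x \<bullet> g x \<partial>lebesgue)"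
  by (rule inner_l2.abs_eq) auto

lemma norm_abs_l2: "sqint f \<Longrightarrow> (norm (abs_l2 f))\<^sup>2 = (\<integral>x. (norm (f x))\<^sup>2 \<partial>lebesgue)"
  by (simp add: power2_norm_eq_inner inner_abs_l2)

lemma plus_abs_l2: "sqint f \<Longrightarrow> sqint g \<Longrightarrow> abs_l2 f + abs_l2 g = abs_l2 (\<lambda>x. f x + g x)"
  by (rule plus_l2.abs_eq) auto

lemma minus_abs_l2: "sqint f \<Longrightarrow> sqint g \<Longrightarrow> abs_l2 f - abs_l2 g = abs_l2 (\<lambda>x. f x - g x)"
  by (rule minus_l2.abs_eq) auto

lemma scaleR_abs_l2: "sqint f \<Longrightarrow> c *\<^sub>R abs_l2 f = abs_l2 (\<lambda>x. c *\<^sub>R f x)"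
  by (rule scaleR_l2.abs_eq) auto

lemma norm_diff_abs_l2:
  "sqint f \<Longrightarrow> sqint g \<Longrightarrow> (norm (abs_l2 f - abs_l2 g))\<^sup>2 = (\<integral>x. (norm (f x - g x))\<^sup>2 \<partial>lebesgue)"
  by (simp add: minus_abs_l2 norm_abs_l2 sqint_diff)

lemma norm_sq_l2: "(norm (h - k))\<^sup>2 = (\<integral>x. (norm (rep_l2 h x - rep_l2 k x))\<^sup>2 \<partial>lebesgue)"
  using norm_diff_abs_l2[OF sqint_rep sqint_rep, of h k] by (simp add: abs_rep_l2)


lemma Cauchy_fast_subseq:
  fixes X :: "nat \<Rightarrow> 'c::metric_space"
  assumes "Cauchy X" and e: "\<And>k. 0 < (e k::real)"
  obtains r where "strict_mono r" "\<And>k. dist (X (r (Suc k))) (X (r k)) < e k"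
proof -
  have "\<exists>N. \<forall>m\<ge>N. \<forall>n\<ge>N. dist (X m) (X n) < e k" for k
    using assms unfolding Cauchy_def by blast
  then obtain N where N: "\<And>k m n. m \<ge> N k \<Longrightarrow> n \<ge> N k \<Longrightarrow> dist (X m) (X n) < e k" by metis
  \<comment> \<open>The sum dominates every threshold up to \<open>k\<close>, and the summand
    \<open>k\<close> makes the sequence strictly increasing.\<close>
  define r where "r k = k + (\<Sum>i\<le>k. N i)" for k
  have r_N: "N k \<le> r k" "N k \<le> r (Suc k)" for k
    using member_le_sum[of k "{..k}" N] by (auto simp: r_def)
  have "strict_mono r"
    by (auto simp: strict_mono_Suc_iff r_def)
  moreover have "dist (X (r (Suc k))) (X (r k)) < e k" for k
    by (rule N[OF r_N(2,1)])
  ultimately show ?thesis using that by blast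
qed

text \<open>Riesz-Fischer. The weights 4 ^ k make the increments of a fast subsequence summable
  almost everywhere by monotone convergence alone.\<close>

instance l2 :: (euclidean_space, euclidean_space) complete_space
proof
  fix X :: "nat \<Rightarrow> ('a, 'b) l2"
  assume X: "Cauchy X"
  \<comment> \<open>Squared increments below \<open>(1/8)^k\<close> still leave
    \<open>(1/2)^k\<close> after multiplication by the weight \<open>4^k\<close>.\<close>
  obtain r where r: "strict_mono r" "\<And>k. dist (X (r (Suc k))) (X (r k)) < sqrt ((1/8)^k)"
    using Cauchy_fast_subseq[OF X, of "\<lambda>k. sqrt ((1/8)^k)"] by auto
  define f where "f k = rep_l2 (X (r k))" for k
  define g where "g k x = f (Suc k) x - f k x" for k x
  have f_sq: "sqint (f k)" for k by (simp add: f_def sqint_rep)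
  then have g_sq: "sqint (g k)" for k unfolding g_def by (intro sqint_diff)
  note [measurable] = f_sq[THEN sqint_meas] g_sq[THEN sqint_meas]
  have g_le: "(\<integral>x. (norm (g k x))\<^sup>2 \<partial>lebesgue) \<le> (1/8)^k" for k
  proof -
    have "(norm (X (r (Suc k)) - X (r k)))\<^sup>2 \<le> (sqrt ((1/8)^k))\<^sup>2"
      using r(2)[of k] by (intro power_mono) (auto simp: dist_norm)
    then show ?thesis by (simp add: norm_sq_l2 g_def f_def)
  qed
  have "(\<integral>\<^sup>+x. (\<Sum>k. ennreal (4^k * (norm (g k x))\<^sup>2)) \<partial>lebesgue)
      = (\<Sum>k. \<integral>\<^sup>+x. ennreal (4^k * (norm (g k x))\<^sup>2) \<partial>lebesgue)"
    by (rule nn_integral_suminf) measurable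
  also have "\<dots> = (\<Sum>k. ennreal (\<integral>x. 4^k * (norm (g k x))\<^sup>2 \<partial>lebesgue))"
    by (intro arg_cong[where f=suminf] ext nn_integral_eq_integral)
      (auto intro!: sqint_int g_sq)
  also have "\<dots> \<le> (\<Sum>k. ennreal ((1/2)^k))"
  proof (rule suminf_le)
    fix k
    have "4^k * (\<integral>x. (norm (g k x))\<^sup>2 \<partial>lebesgue) \<le> 4^k * (1/8)^k"
      using g_le[of k] by (intro mult_left_mono) auto
    also have "\<dots> = (1/2)^k" by (simp flip: power_mult_distrib)
    finally show "ennreal (\<integral>x. 4^k * (norm (g k x))\<^sup>2 \<partial>lebesgue) \<le> ennreal ((1/2)^k)"
      by (simp add: ennreal_leI)
  qed auto
  also have "\<dots> < \<infinity>"
  proof -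
    have "(\<Sum>k. ennreal ((1/2)^k)) \<noteq> top"
      by (rule ennreal_suminf_neq_top) (simp_all add: summable_geometric)
    then show ?thesis by (simp only: less_top infinity_ennreal_def)
  qed
  finally have "(\<integral>\<^sup>+x. (\<Sum>k. ennreal (4^k * (norm (g k x))\<^sup>2)) \<partial>lebesgue) \<noteq> \<infinity>" by simp
  then have "AE x in lebesgue. (\<Sum>k. ennreal (4^k * (norm (g k x))\<^sup>2)) \<noteq> \<infinity>"
    by (intro nn_integral_PInf_AE) measurable
  then have conv: "AE x in lebesgue. convergent (\<lambda>k. f k x)"
  proof eventually_elim
    case (elim x)
    then have "summable (\<lambda>k. 4^k * (norm (g k x))\<^sup>2)"
      by (intro summable_suminf_not_top) auto
    \<comment> \<open>Boundedness of the weighted squares already gives increments of order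
      \<open>(1/2)^k\<close>, so the subsequence converges at \<open>x\<close> by comparison with a
      geometric series.\<close>
    then have "Bseq (\<lambda>k. 4^k * (norm (g k x))\<^sup>2)"
      using summable_imp_Bseq by blast
    then obtain C where C: "\<And>k. 4^k * (norm (g k x))\<^sup>2 \<le> C"
      by (auto simp: Bseq_def)
    have "norm (g k x) \<le> sqrt C * (1/2)^k" for k
    proof -
      have "(2^k * norm (g k x))\<^sup>2 \<le> C"
        using C[of k] by (simp add: power_mult_distrib power_mult[symmetric] mult.commute[of k])
          (simp add: power_mult power2_eq_square)
      then have "2^k * norm (g k x) \<le> sqrt C" by (rule real_le_rsqrt)
      then show ?thesis by (simp add: field_simps power_divide)
    qed
    moreover have "summable (\<lambda>k. sqrt C * (1/2::real)^k)"
      by (intro summable_mult summable_geometric) simp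
    ultimately have "summable (\<lambda>k. g k x)"
      using summable_comparison_test'[of "\<lambda>k. sqrt C * (1/2::real)^k" 0 "\<lambda>k. g k x"] by simp
    then have "convergent (\<lambda>n. f 0 x + (\<Sum>k<n. g k x))"
      by (intro convergent_add convergent_const) (simp add: summable_iff_convergent)
    moreover have "f 0 x + (\<Sum>k<n. g k x) = f n x" for n
      using sum_lessThan_telescope[of "\<lambda>k. f k x" n] by (simp add: g_def)
    ultimately show "convergent (\<lambda>k. f k x)" by simp
  qed
  define F where "F x = lim (\<lambda>k. f k x)" for x
  have F_meas[measurable]: "F \<in> borel_measurable lebesgue"
    unfolding F_def[abs_def] by (rule borel_measurable_lim_metric) measurable
  have F_lim: "AE x in lebesgue. (\<lambda>k. f k x) \<longlonglongrightarrow> F x"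
    using conv by eventually_elim (simp add: F_def convergent_LIMSEQ_iff)
  \<comment> \<open>With a member of the Cauchy sequence as \<open>h\<close>, this yields both that
    \<open>F - rep_l2 h\<close> is square integrable and that its norm is small. Adding the
    representative back shows that \<open>F\<close> itself is square integrable.\<close>
  have fatou: "(\<integral>\<^sup>+x. ennreal ((norm (F x - rep_l2 h x))\<^sup>2) \<partial>lebesgue) \<le> ennreal (e\<^sup>2)"
    if h: "\<forall>\<^sub>F k in sequentially. norm (X (r k) - h) \<le> e" for h e
  proof -
    have [measurable]: "rep_l2 h \<in> borel_measurable lebesgue" by (rule sqint_meas[OF sqint_rep])
    have "(\<integral>\<^sup>+x. ennreal ((norm (F x - rep_l2 h x))\<^sup>2) \<partial>lebesgue)
        = (\<integral>\<^sup>+x. liminf (\<lambda>k. ennreal ((norm (f k x - rep_l2 h x))\<^sup>2)) \<partial>lebesgue)"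
    proof (rule nn_integral_cong_AE)
      show "AE x in lebesgue. ennreal ((norm (F x - rep_l2 h x))\<^sup>2) = liminf (\<lambda>k. ennreal ((norm (f k x - rep_l2 h x))\<^sup>2))"
        using F_lim
      proof eventually_elim
        case (elim x)
        have "(\<lambda>k. ennreal ((norm (f k x - rep_l2 h x))\<^sup>2)) \<longlonglongrightarrow> ennreal ((norm (F x - rep_l2 h x))\<^sup>2)"
          by (intro tendsto_intros elim)
        from lim_imp_Liminf[OF sequentially_bot this] show ?case by simp
      qed
    qed
    also have "\<dots> \<le> liminf (\<lambda>k. \<integral>\<^sup>+x. ennreal ((norm (f k x - rep_l2 h x))\<^sup>2) \<partial>lebesgue)"
      by (rule nn_integral_liminf) measurable
    also have "\<dots> = liminf (\<lambda>k. ennreal ((norm (X (r k) - h))\<^sup>2))"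
      unfolding norm_sq_l2 f_def
      by (intro arg_cong[where f=liminf] ext nn_integral_eq_integral)
        (auto intro!: sqint_int sqint_diff sqint_rep)
    also have "\<dots> \<le> liminf (\<lambda>k. ennreal (e\<^sup>2))"
      using h by (intro Liminf_mono) (auto elim!: eventually_mono intro!: ennreal_leI power_mono)
    finally show ?thesis by (simp add: Liminf_const)
  qed
  have close: "sqint F \<and> norm (abs_l2 F - X n) \<le> e"
    if "0 < e" "\<forall>m\<ge>N. dist (X m) (X n) < e" for e N n
  proof -
    have "\<forall>\<^sub>F k in sequentially. norm (X (r k) - X n) \<le> e"
      unfolding eventually_sequentially
    proof (intro exI allI impI)
      fix k assume "N \<le> k"
      then have "N \<le> r k" using seq_suble[OF r(1), of k] by simp
      then show "norm (X (r k) - X n) \<le> e" using that by (auto simp: dist_norm intro: less_imp_le)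
    qed
    from fatou[OF this]
    have le: "(\<integral>\<^sup>+x. ennreal ((norm (F x - rep_l2 (X n) x))\<^sup>2) \<partial>lebesgue) \<le> ennreal (e\<^sup>2)" .
    have [measurable]: "rep_l2 (X n) \<in> borel_measurable lebesgue" by (rule sqint_meas[OF sqint_rep])
    have int: "integrable lebesgue (\<lambda>x. (norm (F x - rep_l2 (X n) x))\<^sup>2)"
      using le by (intro integrableI_bounded) (auto simp: less_top[symmetric] top_unique)
    then have sq: "sqint (\<lambda>x. F x - rep_l2 (X n) x)"
      by (simp add: sqint_def)
    have F: "sqint F" using sqint_add[OF sq sqint_rep[of "X n"]] by simp
    have "ennreal ((norm (abs_l2 F - X n))\<^sup>2) = ennreal (\<integral>x. (norm (F x - rep_l2 (X n) x))\<^sup>2 \<partial>lebesgue)"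
      using norm_diff_abs_l2[OF F sqint_rep, of "X n"] by (simp add: abs_rep_l2)
    also have "\<dots> \<le> ennreal (e\<^sup>2)"
      using le int by (simp add: nn_integral_eq_integral)
    finally have "(norm (abs_l2 F - X n))\<^sup>2 \<le> e\<^sup>2" by simp
    then show ?thesis using F that(1) by (simp add: power2_le_iff_abs_le)
  qed
  have "X \<longlonglongrightarrow> abs_l2 F"
  proof (rule metric_LIMSEQ_I)
    fix e :: real assume e: "0 < e"
    obtain N where N: "\<And>m n. m \<ge> N \<Longrightarrow> n \<ge> N \<Longrightarrow> dist (X m) (X n) < e/2"
      using X e unfolding Cauchy_def by (meson half_gt_zero)
    have "dist (X n) (abs_l2 F) < e" if "n \<ge> N" for n
    proof -
      have "norm (abs_l2 F - X n) \<le> e/2"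
        using close[of "e/2" N n] N that e by simp
      then show ?thesis using e by (simp add: dist_norm norm_minus_commute)
    qed
    then show "\<exists>N. \<forall>n\<ge>N. dist (X n) (abs_l2 F) < e" by blast
  qed
  then show "convergent X" by (rule convergentI)
qed

section \<open>Separability\<close>

lemma total_countable_imp_dense:
  fixes S :: "'h::{real_inner,complete_space} set"
  assumes "countable S" and total: "\<And>h. (\<And>s. s \<in> S \<Longrightarrow> s \<bullet> h = 0) \<Longrightarrow> h = 0"
  obtains Q :: "'h set" where "countable Q" "closure Q = UNIV"
proof -
  define comb where "comb l = (\<Sum>(q, s)\<leftarrow>l. of_rat q *\<^sub>R s)" for l :: "(rat \<times> 'h) list"
  define Q where "Q = comb ` lists (UNIV \<times> S)"
  have "countable Q"
    unfolding Q_def using assms(1) by (intro countable_image countable_lists) auto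
  have Q_add: "x + y \<in> Q" if xy: "x \<in> Q" "y \<in> Q" for x y
  proof -
    obtain l m where "x = comb l" "y = comb m" "l \<in> lists (UNIV \<times> S)" "m \<in> lists (UNIV \<times> S)"
      using xy by (auto simp: Q_def)
    then show ?thesis
      by (auto simp: Q_def comb_def intro!: image_eqI[of _ _ "l @ m"])
  qed
  have Q_scale: "of_rat q *\<^sub>R x \<in> Q" if x: "x \<in> Q" for q x
  proof -
    obtain l where l: "x = comb l" "l \<in> lists (UNIV \<times> S)" using x by (auto simp: Q_def)
    have "of_rat q *\<^sub>R comb l = comb (map (\<lambda>(p, s). (q * p, s)) l)" for l
      by (induction l) (auto simp: comb_def scaleR_add_right of_rat_mult)
    moreover have "map (\<lambda>(p, s). (q * p, s)) l \<in> lists (UNIV \<times> S)"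
      using l(2) by (auto simp: in_lists_conv_set)
    ultimately show ?thesis using l(1) by (auto simp: Q_def)
  qed
  have Q_S: "S \<subseteq> Q"
  proof
    fix s assume "s \<in> S"
    then show "s \<in> Q"
      unfolding Q_def comb_def by (intro image_eqI[of _ _ "[(1, s)]"]) auto
  qed
  have cl_add: "x + y \<in> closure Q" if "x \<in> closure Q" "y \<in> closure Q" for x y
  proof -
    obtain a b where "\<And>n. a n \<in> Q" "a \<longlonglongrightarrow> x" "\<And>n. b n \<in> Q" "b \<longlonglongrightarrow> y"
      using \<open>x \<in> closure Q\<close> \<open>y \<in> closure Q\<close> unfolding closure_sequential by blast
    then have "(\<lambda>n. a n + b n) \<longlonglongrightarrow> x + y" "\<And>n. a n + b n \<in> Q"
      by (auto intro: tendsto_add Q_add)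
    then show ?thesis unfolding closure_sequential by (intro exI[of _ "\<lambda>n. a n + b n"]) auto
  qed
  have cl_scale: "c *\<^sub>R x \<in> closure Q" if x: "x \<in> closure Q" for c x
  proof -
    obtain a where a: "\<And>n. a n \<in> Q" "a \<longlonglongrightarrow> x" using x unfolding closure_sequential by blast
    have "\<exists>q. c < of_rat q \<and> of_rat q < c + inverse (real (Suc n))" for n
      using of_rat_dense[of c "c + inverse (real (Suc n))"] by auto
    then obtain q where q: "\<And>n. c < of_rat (q n)" "\<And>n. of_rat (q n) < c + inverse (real (Suc n))"
      by metis
    have "(\<lambda>n. of_rat (q n)) \<longlonglongrightarrow> c"
    proof (rule tendsto_sandwich[OF _ _ tendsto_const])
      show "(\<lambda>n. c + inverse (real (Suc n))) \<longlonglongrightarrow> c"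
        using tendsto_add[OF tendsto_const LIMSEQ_inverse_real_of_nat, of c] by simp
    qed (use q in \<open>auto intro!: always_eventually less_imp_le\<close>)
    then have "(\<lambda>n. of_rat (q n) *\<^sub>R a n) \<longlonglongrightarrow> c *\<^sub>R x"
      using a(2) by (rule tendsto_scaleR)
    moreover have "of_rat (q n) *\<^sub>R a n \<in> Q" for n by (intro Q_scale a)
    ultimately show ?thesis
      unfolding closure_sequential by (intro exI[of _ "\<lambda>n. of_rat (q n) *\<^sub>R a n"]) auto
  qed
  have conv: "convex (closure Q)"
    unfolding convex_def by (intro ballI allI impI cl_add cl_scale)
  have "0 \<in> Q" unfolding Q_def comb_def by (intro image_eqI[of _ _ "[]"]) auto
  then have ne: "closure Q \<noteq> {}" using closure_subset by blast
  have "x \<in> closure Q" for x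
  proof -
    \<comment> \<open>The closure of the rational combinations is a closed subspace, so the residual
      of the projection onto it is orthogonal to every element of \<open>S\<close>, and totality
      makes it vanish.\<close>
    define h where "h = x - hproj (closure Q) x"
    have p: "hproj (closure Q) x \<in> closure Q" by (intro hproj_in closed_closure conv ne)
    have le: "h \<bullet> v \<le> 0" if "v \<in> closure Q" for v
    proof -
      have "(x - hproj (closure Q) x) \<bullet> ((hproj (closure Q) x + v) - hproj (closure Q) x) \<le> 0"
        by (intro hproj_inner closed_closure conv ne cl_add p that)
      then show ?thesis by (simp add: h_def)
    qed
    have "h = 0"
    proof (rule total)
      fix s assume "s \<in> S"
      then have s: "s \<in> closure Q" using Q_S closure_subset by blast
      have "h \<bullet> s \<le> 0" by (rule le[OF s])
      moreover have "h \<bullet> (-1 *\<^sub>R s) \<le> 0" by (rule le[OF cl_scale[OF s]])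
      ultimately show "s \<bullet> h = 0" by (simp add: inner_commute)
    qed
    then show ?thesis using p by (simp add: h_def)
  qed
  then have "closure Q = UNIV" by auto
  with \<open>countable Q\<close> show ?thesis by (rule that)
qed

lemma countable_dense_imp_second_countable:
  fixes Q :: "'c::metric_space set"
  assumes "countable Q" "closure Q = UNIV"
  shows "\<exists>B::'c set set. countable B \<and> open = generate_topology B"
proof -
  define B where "B = (\<lambda>(q, n). ball q (inverse (real (Suc n)))) ` (Q \<times> UNIV)"
  have "countable B" unfolding B_def using assms(1) by auto
  moreover have "topological_basis B"
  proof (rule topological_basisI)
    show "open b" if "b \<in> B" for b using that by (auto simp: B_def)
    fix U :: "'c set" and x assume U: "open U" "x \<in> U"
    then obtain e where e: "e > 0" "ball x e \<subseteq> U" using open_contains_ball by blast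
    obtain n where n: "inverse (real (Suc n)) < e/2"
      using reals_Archimedean[of "e/2"] e by auto
    have "x \<in> closure Q" using assms(2) by simp
    then obtain q where q: "q \<in> Q" "dist q x < inverse (real (Suc n))"
      using closure_approachableD[of x Q "inverse (real (Suc n))"] by (auto simp: dist_commute)
    have "ball q (inverse (real (Suc n))) \<subseteq> ball x e"
    proof
      fix y assume "y \<in> ball q (inverse (real (Suc n)))"
      then show "y \<in> ball x e"
        using q(2) n dist_triangle[of x y q] unfolding mem_ball dist_commute[of q x] by linarith
    qed
    then show "\<exists>b\<in>B. x \<in> b \<and> b \<subseteq> U"
      using q e by (intro bexI[of _ "ball q (inverse (real (Suc n)))"]) (auto simp: B_def)
  qed
  ultimately show ?thesis using topological_basis_imp_subbasis by blast
qed

text \<open>Dynkin's argument: the sets over which the integral vanishes form a Dynkin system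
  containing an intersection-stable generator, hence contain all Borel sets. The function is first
  replaced by a Borel version, since Lebesgue measure is the completion of the Borel one.\<close>

lemma AE_zero_if_integrals_zero:
  fixes \<phi> :: "'a::euclidean_space \<Rightarrow> real"
  assumes \<phi>: "integrable lebesgue \<phi>"
    and G: "Int_stable G" "sets (borel :: 'a measure) = sigma_sets UNIV G" "UNIV \<in> G"
    and zero: "\<And>A. A \<in> G \<Longrightarrow> (\<integral>x. indicator A x * \<phi> x \<partial>lebesgue) = 0"
  shows "AE x in lebesgue. \<phi> x = 0"
proof -
  obtain \<psi> where \<psi>: "\<psi> \<in> borel_measurable lborel" "AE x in lborel. \<phi> x = \<psi> x"
    using completion_ex_borel_measurable_real[of \<phi> lborel] \<phi> by (auto intro: borel_measurable_integrable)
  have AE: "AE x in lebesgue. \<phi> x = \<psi> x" using \<psi>(2) by (rule AE_completion)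
  have \<psi>_leb: "\<psi> \<in> borel_measurable lebesgue" using \<psi>(1) by (rule measurable_completion)
  have "integrable lebesgue \<psi>"
    using integrable_cong_AE[OF borel_measurable_integrable[OF \<phi>] \<psi>_leb AE] \<phi> by simp
  then have int: "integrable lborel \<psi>" using \<psi>(1) by (simp add: integrable_completion)
  have eq: "(\<integral>x. indicator A x * \<psi> x \<partial>lborel) = (\<integral>x. indicator A x * \<phi> x \<partial>lebesgue)" if "A \<in> sets borel" for A
  proof -
    have "(\<integral>x. indicator A x * \<psi> x \<partial>lborel) = (\<integral>x. indicator A x * \<psi> x \<partial>lebesgue)"
      using that \<psi>(1) by (intro integral_completion[symmetric]) auto
    also have "\<dots> = (\<integral>x. indicator A x * \<phi> x \<partial>lebesgue)"
    proof (rule integral_cong_AE)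
      have A: "A \<in> sets lebesgue" using that by (simp add: sets_completionI_sets)
      show "(\<lambda>x. indicator A x * \<psi> x) \<in> borel_measurable lebesgue"
        using A \<psi>_leb by (intro borel_measurable_times borel_measurable_indicator)
      show "(\<lambda>x. indicator A x * \<phi> x) \<in> borel_measurable lebesgue"
        using A borel_measurable_integrable[OF \<phi>] by (intro borel_measurable_times borel_measurable_indicator)
      show "AE x in lebesgue. indicator A x * \<psi> x = indicator A x * \<phi> x"
        using AE by eventually_elim simp
    qed
    finally show ?thesis .
  qed
  have G_sets: "A \<in> sets borel" if "A \<in> G" for A using G(2) that by auto
  have subset_Pow: "G \<subseteq> Pow UNIV" by simp
  have zero': "(\<integral>x. indicator A x * \<psi> x \<partial>lborel) = 0" if "A \<in> sigma_sets UNIV G" for A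
    using G(1) subset_Pow that
  proof (induction rule: sigma_sets_induct_disjoint)
    case (basic A)
    then show ?case using eq[OF G_sets] zero by simp
  next
    case (compl A)
    then have A: "A \<in> sets borel" using G(2) by simp
    have "(\<integral>x. indicator (UNIV - A) x * \<psi> x \<partial>lborel) = (\<integral>x. indicator UNIV x * \<psi> x - indicator A x * \<psi> x \<partial>lborel)"
      by (intro Bochner_Integration.integral_cong) (auto simp: indicator_def)
    also have "\<dots> = (\<integral>x. indicator UNIV x * \<psi> x \<partial>lborel) - (\<integral>x. indicator A x * \<psi> x \<partial>lborel)"
      using A int by (intro Bochner_Integration.integral_diff) (auto intro: integrable_real_mult_indicator simp: mult.commute)
    also have "\<dots> = 0" using compl eq[OF G_sets[OF G(3)]] zero[OF G(3)] by simp
    finally show ?case .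
  next
    case (union A)
    then have A: "A i \<in> sets lborel" for i using G(2) by auto
    have "set_integrable lborel (\<Union>i. A i) \<psi>"
      unfolding set_integrable_def using A int by (intro integrable_mult_indicator) auto
    then have "(\<Sum>i. (\<integral>x\<in>A i. \<psi> x \<partial>lborel)) = (\<integral>x\<in>(\<Union>i. A i). \<psi> x \<partial>lborel)"
      using A union(1) by (intro lebesgue_integral_countable_add[symmetric])
        (auto simp: disjoint_family_on_def)
    then show ?case using union by (simp add: set_lebesgue_integral_def)
  qed (auto)
  have "AE x in lborel. \<psi> x = 0"
  proof (rule density_unique_real[OF int integrable_zero])
    fix A :: "'a set" assume "A \<in> sets lborel"
    then show "set_lebesgue_integral lborel A \<psi> = (\<integral>x\<in>A. 0 \<partial>lborel)"
      using zero'[of A] G(2) by (simp add: set_lebesgue_integral_def)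
  qed
  then have "AE x in lebesgue. \<psi> x = 0" by (rule AE_completion)
  with AE show ?thesis by eventually_elim simp
qed

text \<open>The total set consists of indicators of generator sets, cut off by balls of integer
  radius to be square integrable, times basis vectors. Orthogonality to all of them makes every
  component vanish on every ball.\<close>

lemma l2_total_countable:
  obtains S :: "('a::euclidean_space, 'b::euclidean_space) l2 set"
  where "countable S" "\<And>h. (\<And>s. s \<in> S \<Longrightarrow> s \<bullet> h = 0) \<Longrightarrow> h = 0"
proof -
  obtain B :: "'a set set" where B: "countable B" "topological_basis B"
    using ex_countable_basis by blast
  \<comment> \<open>Finite intersections make the countable base intersection-stable; the empty
    intersection contributes \<open>UNIV\<close>.\<close>
  define G where "G = Inter ` {F. finite F \<and> F \<subseteq> B}"
  have "countable G"
    unfolding G_def by (intro countable_image countable_Collect_finite_subset B)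
  have "Int_stable G"
    unfolding Int_stable_def G_def
  proof (safe)
    fix F1 F2 assume "finite F1" "F1 \<subseteq> B" "finite F2" "F2 \<subseteq> B"
    then show "\<Inter>F1 \<inter> \<Inter>F2 \<in> Inter ` {F. finite F \<and> F \<subseteq> B}"
      by (intro image_eqI[of _ _ "F1 \<union> F2"]) auto
  qed
  have UNIV_G: "UNIV \<in> G" unfolding G_def by (intro image_eqI[of _ _ "{}"]) auto
  have B_G: "B \<subseteq> G" 
  proof
    fix b assume "b \<in> B"
    then show "b \<in> G" unfolding G_def by (intro image_eqI[of _ _ "{b}"]) auto
  qed
  have open_G: "open A" if "A \<in> G" for A
    using that topological_basis_open[OF B(2)] by (auto simp: G_def intro!: open_Inter)
  have sets_G: "sets (borel :: 'a measure) = sigma_sets UNIV G"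
  proof
    have "sets (borel :: 'a measure) = sigma_sets UNIV B"
      by (subst borel_eq_countable_basis[OF B]) simp
    also have "\<dots> \<subseteq> sigma_sets UNIV G" using B_G by (rule sigma_sets_subseteq)
    finally show "sets (borel :: 'a measure) \<subseteq> sigma_sets UNIV G" .
    show "sigma_sets UNIV G \<subseteq> sets (borel :: 'a measure)"
    proof -
      have "G \<subseteq> sets borel" using open_G by auto
      then show ?thesis using sets.sigma_sets_subset[of G borel] by simp
    qed
  qed
  define i :: "'a set \<times> nat \<times> 'b \<Rightarrow> ('a, 'b) l2"
    where "i = (\<lambda>(A, n, b). abs_l2 (\<lambda>x. indicator (A \<inter> cball 0 (real n)) x *\<^sub>R b))"
  define S where "S = i ` (G \<times> UNIV \<times> Basis)"
  have "countable S"
    unfolding S_def using \<open>countable G\<close> by (intro countable_image countable_SIGMA) (auto intro: countable_finite)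
  moreover have "h = 0" if h: "\<And>s. s \<in> S \<Longrightarrow> s \<bullet> h = 0" for h
  proof -
    define f where "f = rep_l2 h"
    have f: "sqint f" by (simp add: f_def sqint_rep)
    have ind: "sqint (\<lambda>x. indicator (A \<inter> cball 0 (real n)) x *\<^sub>R b)" if "A \<in> sets borel" for A :: "'a set" and n :: nat and b :: 'b
    proof (rule sqint_dominated)
      show "integrable lebesgue (\<lambda>x. indicator (cball 0 (real n)) x * (norm b)\<^sup>2 :: real)"
        by (intro integrable_mult_left integrable_real_indicator)
          (use emeasure_bounded_finite[OF bounded_cball, of 0 "real n"] in auto)
      show "(\<lambda>x. indicator (A \<inter> cball 0 (real n)) x *\<^sub>R b) \<in> borel_measurable lebesgue"
        using that by (intro borel_measurable_scaleR borel_measurable_indicator borel_measurable_const sets_completionI_sets) auto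
    qed (auto simp: indicator_def)
    have zero: "AE x in lebesgue. indicator (cball 0 (real n)) x * (f x \<bullet> b) = 0" if b: "b \<in> Basis" for n b
    proof (rule AE_zero_if_integrals_zero[OF _ \<open>Int_stable G\<close> sets_G UNIV_G])
      have 1: "sqint (\<lambda>x::'a. indicator (UNIV \<inter> cball 0 (real n)) x *\<^sub>R b)" by (rule ind) simp
      show "integrable lebesgue (\<lambda>x. indicator (cball 0 (real n)) x * (f x \<bullet> b))"
        using sqint_inner[OF 1 f] by (simp add: inner_commute)
      fix A assume A: "A \<in> G"
      have 2: "sqint (\<lambda>x. indicator (A \<inter> cball 0 (real n)) x *\<^sub>R b)" using open_G[OF A] by (intro ind) auto
      have "i (A, n, b) \<bullet> h = 0" using A b by (intro h) (auto simp: S_def)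
      then have "(\<integral>x. (indicator (A \<inter> cball 0 (real n)) x *\<^sub>R b) \<bullet> f x \<partial>lebesgue) = 0"
        using inner_abs_l2[OF 2 f] by (simp add: i_def f_def abs_rep_l2)
      then show "(\<integral>x. indicator A x * (indicator (cball 0 (real n)) x * (f x \<bullet> b)) \<partial>lebesgue) = 0"
        by (simp add: indicator_inter_arith mult.assoc inner_commute)
    qed
    then have "AE x in lebesgue. \<forall>b\<in>Basis. \<forall>n::nat. indicator (cball 0 (real n)) x * (f x \<bullet> b) = 0"
      by (intro AE_finite_allI AE_all_countable[THEN iffD2] allI) auto
    then have "AE x in lebesgue. f x = 0"
    proof eventually_elim
      case (elim x)
      obtain n :: nat where "norm x \<le> real n" using real_arch_simple by blast
      then have x: "x \<in> cball 0 (real n)" by simp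
      have "f x \<bullet> b = 0" if "b \<in> Basis" for b
      proof -
        have "indicator (cball 0 (real n)) x * (f x \<bullet> b) = 0" using elim that by blast
        then show ?thesis using x by simp
      qed
      then show ?case by (simp add: euclidean_eq_iff[of "f x" 0])
    qed
    then have "abs_l2 f = abs_l2 (\<lambda>x. 0)"
      by (intro abs_l2_eqI f sqint_zero)
    then show ?thesis by (simp add: f_def abs_rep_l2 zero_l2_def)
  qed
  ultimately show ?thesis using that by blast
qed

instance l2 :: (euclidean_space, euclidean_space) second_countable_topology
proof
  obtain S :: "('a, 'b) l2 set" where "countable S" "\<And>h. (\<And>s. s \<in> S \<Longrightarrow> s \<bullet> h = 0) \<Longrightarrow> h = 0"
    using l2_total_countable by blast
  then obtain Q :: "('a, 'b) l2 set" where "countable Q" "closure Q = UNIV"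
    by (rule total_countable_imp_dense)
  then show "\<exists>B::('a, 'b) l2 set set. countable B \<and> open = generate_topology B"
    by (rule countable_dense_imp_second_countable)
qed


subsection \<open>Test functions\<close>

lemma norm_abs_l2_mono:
  assumes "sqint f" "sqint g" "0 \<le> c" "AE x in lebesgue. norm (f x) \<le> c * norm (g x)"
  shows "norm (abs_l2 f) \<le> c * norm (abs_l2 g)"
proof (rule power2_le_imp_le)
  have "(norm (abs_l2 f))\<^sup>2 \<le> (\<integral>x. c\<^sup>2 * (norm (g x))\<^sup>2 \<partial>lebesgue)"
    unfolding norm_abs_l2[OF assms(1)]
  proof (rule integral_mono_AE)
    show "integrable lebesgue (\<lambda>x. (norm (f x))\<^sup>2)" "integrable lebesgue (\<lambda>x. c\<^sup>2 * (norm (g x))\<^sup>2)"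
      using assms by (auto intro: sqint_int)
    show "AE x in lebesgue. (norm (f x))\<^sup>2 \<le> c\<^sup>2 * (norm (g x))\<^sup>2"
      using assms(4)
    proof eventually_elim
      case (elim x)
      then show ?case
        using power_mono[OF elim norm_ge_zero, of 2] by (simp add: power_mult_distrib)
    qed
  qed
  also have "\<dots> = (c * norm (abs_l2 g))\<^sup>2"
    by (simp add: norm_abs_l2[OF assms(2)] power_mult_distrib)
  finally show "(norm (abs_l2 f))\<^sup>2 \<le> (c * norm (abs_l2 g))\<^sup>2" .
qed (use assms in simp)

lemma integrable_continuous_compact_support:
  fixes f :: "'a::euclidean_space \<Rightarrow> real"
  assumes "continuous_on UNIV f" "compact K" "\<And>x. x \<notin> K \<Longrightarrow> f x = 0"
  shows "integrable lebesgue f"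
proof -
  have "bounded (f ` K)"
    using assms continuous_on_subset compact_continuous_image compact_imp_bounded by (metis subset_UNIV)
  then obtain m where m: "\<And>x. x \<in> K \<Longrightarrow> \<bar>f x\<bar> \<le> m" by (auto simp: bounded_iff)
  show ?thesis
  proof (rule Bochner_Integration.integrable_bound)
    have "emeasure lborel K < \<infinity>" using assms(2) compact_imp_bounded emeasure_bounded_finite by blast
    then show "integrable lebesgue (\<lambda>x. m * indicator K x)"
      using borel_compact[OF assms(2)] by (intro integrable_mult_right integrable_real_indicator) auto
    show "f \<in> borel_measurable lebesgue"
      using assms(1) by (intro measurable_completion) (auto intro: borel_measurable_continuous_onI)
    show "AE x in lebesgue. norm (f x) \<le> norm (m * indicator K x)"
      using m assms(3) by (intro AE_I2) (force simp: indicator_def)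
  qed
qed

lemma sqint_continuous_compact_support:
  fixes f :: "'a::euclidean_space \<Rightarrow> 'b::euclidean_space"
  assumes "continuous_on UNIV f" "compact K" "\<And>x. x \<notin> K \<Longrightarrow> f x = 0"
  shows "sqint f"
  unfolding sqint_def
proof
  show "f \<in> borel_measurable lebesgue"
    using assms(1) by (intro measurable_completion) (auto intro: borel_measurable_continuous_onI)
  show "integrable lebesgue (\<lambda>x. (norm (f x))\<^sup>2)"
    using assms by (intro integrable_continuous_compact_support[of _ K] continuous_intros) auto
qed

lemma frechet_derivative_zero_outside:
  fixes \<psi> :: "'a::euclidean_space \<Rightarrow> real"
  assumes "closed K" "\<And>x. x \<notin> K \<Longrightarrow> \<psi> x = 0" "x \<notin> K"
  shows "frechet_derivative \<psi> (at x) = (\<lambda>h. 0)"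
proof -
  have "(\<psi> has_derivative (\<lambda>h. 0)) (at x)"
    by (rule has_derivative_transform_within_open[of "\<lambda>_. 0" "\<lambda>h. 0" x UNIV "- K"])
      (use assms in auto)
  then show ?thesis by (rule frechet_derivative_at[symmetric])
qed

text \<open>Differentiating the translation invariance of the integral avoids Fubini's theorem.\<close>

lemma integral_partial_derivative_eq_0:
  fixes \<psi> :: "'a::euclidean_space \<Rightarrow> real"
  assumes diff: "\<And>x. \<psi> differentiable (at x)"
    and cont: "continuous_on UNIV (\<lambda>x. frechet_derivative \<psi> (at x) b)"
    and K: "compact K" "\<And>x. x \<notin> K \<Longrightarrow> \<psi> x = 0"
  shows "(\<integral>x. frechet_derivative \<psi> (at x) b \<partial>lebesgue) = 0"
proof -
  define d where "d x = frechet_derivative \<psi> (at x) b" for x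
  have d0: "d x = 0" if "x \<notin> K" for x
    using frechet_derivative_zero_outside[OF compact_imp_closed[OF K(1)] K(2) that] by (simp add: d_def)
  have "bounded (d ` K)"
    using cont K(1) continuous_on_subset compact_continuous_image compact_imp_bounded
    unfolding d_def by (metis subset_UNIV)
  then obtain m0 where "\<And>x. x \<in> K \<Longrightarrow> \<bar>d x\<bar> \<le> m0" by (auto simp: bounded_iff)
  then have m: "\<bar>d x\<bar> \<le> max m0 0" for x using d0[of x] by (cases "x \<in> K") (auto simp: le_max_iff_disj)
  define m where "m = max m0 0"
  have deriv: "((\<lambda>t. \<psi> (x + t *\<^sub>R b)) has_real_derivative d (x + t *\<^sub>R b)) (at t)" for x t
  proof -
    have "(\<psi> has_derivative frechet_derivative \<psi> (at (x + t *\<^sub>R b))) (at (x + t *\<^sub>R b))"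
      using diff frechet_derivative_works by blast
    then have "((\<lambda>t. \<psi> (x + t *\<^sub>R b)) has_derivative (\<lambda>h. frechet_derivative \<psi> (at (x + t *\<^sub>R b)) (h *\<^sub>R b))) (at t)"
      by (rule has_derivative_compose[rotated]) (auto intro!: derivative_eq_intros)
    moreover have "frechet_derivative \<psi> (at (x + t *\<^sub>R b)) (h *\<^sub>R b) = d (x + t *\<^sub>R b) * h" for h
      using linear_frechet_derivative[OF diff] by (simp add: linear_cmul d_def)
    ultimately show ?thesis by (simp add: has_field_derivative_def mult_commute_abs)
  qed
  \<comment> \<open>The mean value theorem bounds all difference quotients by the supremum of the
    derivative, which will serve as the dominating constant.\<close>
  have lip: "\<bar>\<psi> (x + h *\<^sub>R b) - \<psi> x\<bar> \<le> m * h" if h: "0 < h" for x h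
  proof -
    obtain z where "\<psi> (x + h *\<^sub>R b) - \<psi> (x + 0 *\<^sub>R b) = (h - 0) * d (x + z *\<^sub>R b)"
      using MVT2[OF h, of "\<lambda>t. \<psi> (x + t *\<^sub>R b)" "\<lambda>t. d (x + t *\<^sub>R b)"] deriv by blast
    then show ?thesis using m[of "x + z *\<^sub>R b"] h by (simp add: abs_mult m_def mult.commute mult_left_mono)
  qed
  obtain R where R: "\<And>x. x \<in> K \<Longrightarrow> norm x \<le> R"
    using compact_imp_bounded[OF K(1)] by (auto simp: bounded_iff)
  have \<psi>_cont: "continuous_on UNIV \<psi>"
    using diff by (simp add: continuous_on_eq_continuous_at differentiable_imp_continuous_within)
  have \<psi>_meas[measurable]: "\<psi> \<in> borel_measurable borel" using \<psi>_cont by (rule borel_measurable_continuous_onI)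
  have d_meas[measurable]: "d \<in> borel_measurable borel"
    using cont unfolding d_def[abs_def] by (rule borel_measurable_continuous_onI)
  have \<psi>_int: "integrable lborel \<psi>"
    using integrable_continuous_compact_support[OF \<psi>_cont K] by (simp add: integrable_completion)
  \<comment> \<open>The difference quotients have integral 0 because the integral is translation
    invariant, and they converge pointwise to the partial derivative.\<close>
  define f where "f n x = (\<psi> (x + inverse (real (Suc n)) *\<^sub>R b) - \<psi> x) / inverse (real (Suc n))" for n x
  have shift: "integrable lborel (\<lambda>x. \<psi> (x + v))" "(\<integral>x. \<psi> (x + v) \<partial>lborel) = (\<integral>x. \<psi> x \<partial>lborel)" for v
  proof -
    have "integrable (distr lborel borel ((+) v)) \<psi>" using \<psi>_int by (simp add: lborel_distr_plus)
    then show "integrable lborel (\<lambda>x. \<psi> (x + v))"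
      by (subst (asm) integrable_distr_eq) (auto simp: add.commute)
    have "(\<integral>x. \<psi> x \<partial>lborel) = (\<integral>x. \<psi> x \<partial>distr lborel borel ((+) v))" by (simp add: lborel_distr_plus)
    also have "\<dots> = (\<integral>x. \<psi> (v + x) \<partial>lborel)" by (rule integral_distr) auto
    finally show "(\<integral>x. \<psi> (x + v) \<partial>lborel) = (\<integral>x. \<psi> x \<partial>lborel)" by (simp add: add.commute)
  qed
  have f0: "(\<integral>x. f n x \<partial>lborel) = 0" for n
    unfolding f_def using shift \<psi>_int by simp
  have "(\<lambda>n. \<integral>x. f n x \<partial>lborel) \<longlonglongrightarrow> (\<integral>x. d x \<partial>lborel)"
  proof (rule integral_dominated_convergence[where w="\<lambda>x. m * indicator (cball 0 (R + norm b)) x"])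
    \<comment> \<open>Step lengths are at most 1, so shifting moves the support by at most
      \<open>norm b\<close>; outside the enlarged ball every difference quotient vanishes.\<close>
    show "integrable lborel (\<lambda>x. m * indicator (cball 0 (R + norm b)) x)"
      using emeasure_bounded_finite[OF bounded_cball, of 0 "R + norm b"]
      by (intro integrable_mult_right integrable_real_indicator) auto
    show "AE x in lborel. (\<lambda>n. f n x) \<longlonglongrightarrow> d x"
    proof (rule AE_I2)
      fix x
      have "((\<lambda>h. (\<psi> (x + h *\<^sub>R b) - \<psi> x) / h) \<longlongrightarrow> d x) (at 0)"
        using DERIV_D[OF deriv[of x 0]] by simp
      moreover have "filterlim (\<lambda>n. inverse (real (Suc n))) (at 0) sequentially"
        unfolding filterlim_at using LIMSEQ_inverse_real_of_nat by auto
      ultimately show "(\<lambda>n. f n x) \<longlonglongrightarrow> d x"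
        unfolding f_def by (rule filterlim_compose)
    qed
    show "AE x in lborel. norm (f n x) \<le> m * indicator (cball 0 (R + norm b)) x" for n
    proof (rule AE_I2)
      fix x
      define h where "h = inverse (real (Suc n))"
      have h: "0 < h" "h \<le> 1" by (auto simp: h_def inverse_le_1_iff)
      show "norm (f n x) \<le> m * indicator (cball 0 (R + norm b)) x"
      proof (cases "x \<in> cball 0 (R + norm b)")
        case True
        then show ?thesis
          using lip[OF h(1), of x] h(1) unfolding f_def h_def[symmetric] by (simp add: pos_divide_le_eq)
      next
        case False
        then have "R + norm b < norm x" by simp
        moreover have "norm x \<le> norm (x + h *\<^sub>R b) + norm (h *\<^sub>R b)"
          using norm_triangle_ineq4[of "x + h *\<^sub>R b" "h *\<^sub>R b"] by simp
        moreover have "norm (h *\<^sub>R b) \<le> norm b" using h by (simp add: mult_left_le_one_le)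
        ultimately have "x \<notin> K" "x + h *\<^sub>R b \<notin> K" using R[of x] R[of "x + h *\<^sub>R b"] norm_ge_zero[of b] by (auto simp: not_le[symmetric])
        then show ?thesis using False K(2) unfolding f_def h_def[symmetric] by simp
      qed
    qed
  qed (auto simp: f_def[abs_def])
  then have "(\<integral>x. d x \<partial>lborel) = 0" unfolding f0 by (simp add: LIMSEQ_const_iff)
  then show ?thesis unfolding d_def[symmetric] by (simp add: integral_completion)
qed

lemma smooth_fun_derivative:
  assumes "smooth_fun \<phi>"
  shows "\<phi> differentiable (at x)" "b \<in> Basis \<Longrightarrow> smooth_fun (\<lambda>x. frechet_derivative \<phi> (at x) b)"
  using assms unfolding smooth_fun_def by blast+

text \<open>Smoothness is coinductive: it asks for a family of differentiable functions closed under
  partial derivatives. The combinations of members of two such families form another one.\<close>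

lemma smooth_fun_linear_combination:
  assumes "smooth_fun \<phi>" "smooth_fun \<psi>"
  shows "smooth_fun (\<lambda>x. c * \<phi> x + d * \<psi> x)"
proof -
  obtain S1 where S1: "\<phi> \<in> S1" "\<And>f. f \<in> S1 \<Longrightarrow> (\<forall>x. f differentiable (at x)) \<and> (\<forall>b\<in>Basis. (\<lambda>x. frechet_derivative f (at x) b) \<in> S1)"
    using assms(1) unfolding smooth_fun_def by blast
  obtain S2 where S2: "\<psi> \<in> S2" "\<And>f. f \<in> S2 \<Longrightarrow> (\<forall>x. f differentiable (at x)) \<and> (\<forall>b\<in>Basis. (\<lambda>x. frechet_derivative f (at x) b) \<in> S2)"
    using assms(2) unfolding smooth_fun_def by blast
  define S where "S = (\<lambda>(f, g) x. c * f x + d * g x) ` (S1 \<times> S2)"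
  show ?thesis
    unfolding smooth_fun_def
  proof (intro exI[of _ S] conjI ballI allI)
    show "(\<lambda>x. c * \<phi> x + d * \<psi> x) \<in> S"
      unfolding S_def using S1(1) S2(1) by (intro image_eqI[of _ _ "(\<phi>, \<psi>)"]) auto
    fix h assume "h \<in> S"
    then obtain f g where fg: "f \<in> S1" "g \<in> S2" "h = (\<lambda>x. c * f x + d * g x)" by (auto simp: S_def)
    have f: "(f has_derivative frechet_derivative f (at x)) (at x)" and g: "(g has_derivative frechet_derivative g (at x)) (at x)" for x
      using S1(2)[OF fg(1)] S2(2)[OF fg(2)] frechet_derivative_works by blast+
    have h: "(h has_derivative (\<lambda>v. c * frechet_derivative f (at x) v + d * frechet_derivative g (at x) v)) (at x)" for x
      unfolding fg(3) by (intro has_derivative_add has_derivative_mult_right f g)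
    show "h differentiable (at x)" for x using h differentiable_def by blast
    fix b :: 'a assume b: "b \<in> Basis"
    have "(\<lambda>x. frechet_derivative h (at x) b) = (\<lambda>x. c * frechet_derivative f (at x) b + d * frechet_derivative g (at x) b)"
      using frechet_derivative_at[OF h, symmetric] by simp
    then show "(\<lambda>x. frechet_derivative h (at x) b) \<in> S"
      unfolding S_def using S1(2)[OF fg(1)] S2(2)[OF fg(2)] b
      by (intro image_eqI[of _ _ "(\<lambda>x. frechet_derivative f (at x) b, \<lambda>x. frechet_derivative g (at x) b)"]) auto
  qed
qed

lemma smooth_fun_zero: "smooth_fun (\<lambda>x. 0)"
  unfolding smooth_fun_def by (intro exI[of _ "{\<lambda>x. 0}"]) auto

lemma smooth_fun_continuous: "smooth_fun \<phi> \<Longrightarrow> continuous_on UNIV \<phi>"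
  by (simp add: continuous_on_eq_continuous_at differentiable_imp_continuous_within smooth_fun_derivative)

lemma grad_inner: "b \<in> Basis \<Longrightarrow> grad \<phi> x \<bullet> b = frechet_derivative \<phi> (at x) b"
  unfolding grad_def by (simp add: inner_sum_left inner_Basis if_distrib sum.delta cong: if_cong)

section \<open>Integration by parts and the Poincare inequality for test functions\<close>

context
  fixes D :: "'a::euclidean_space set" and \<phi> :: "'a \<Rightarrow> real"
  assumes \<phi>: "test_fun D \<phi>"
begin

lemma test_fun_support:
  obtains K where "compact K" "K \<subseteq> D" "\<And>x. x \<notin> K \<Longrightarrow> \<phi> x = 0"
proof (rule that[of "closure {x. \<phi> x \<noteq> 0}"])
  show "compact (closure {x. \<phi> x \<noteq> 0})" "closure {x. \<phi> x \<noteq> 0} \<subseteq> D"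
    using \<phi> by (simp_all add: test_fun_def)
  show "\<phi> x = 0" if "x \<notin> closure {x. \<phi> x \<noteq> 0}" for x
    using that closure_subset[of "{x. \<phi> x \<noteq> 0}"] by auto
qed

lemma test_fun_smooth: "smooth_fun \<phi>"
  using \<phi> by (simp add: test_fun_def)

lemma test_fun_derivative: "(\<phi> has_derivative frechet_derivative \<phi> (at x)) (at x)"
  using smooth_fun_derivative(1)[OF test_fun_smooth] frechet_derivative_works by blast

lemma test_fun_continuous: "continuous_on UNIV \<phi>"
  by (rule smooth_fun_continuous[OF test_fun_smooth])

lemma test_fun_continuous_partial: "b \<in> Basis \<Longrightarrow> continuous_on UNIV (\<lambda>x. frechet_derivative \<phi> (at x) b)"
  by (rule smooth_fun_continuous) (rule smooth_fun_derivative(2)[OF test_fun_smooth])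

lemma test_fun_outside: "x \<notin> D \<Longrightarrow> \<phi> x = 0"
  by (rule test_fun_support) auto

lemma test_fun_derivative_support:
  assumes "compact K" "\<And>x. x \<notin> K \<Longrightarrow> \<phi> x = 0" "x \<notin> K"
  shows "frechet_derivative \<phi> (at x) v = 0" "grad \<phi> x = 0"
  using frechet_derivative_zero_outside[OF compact_imp_closed[OF assms(1)] assms(2,3)]
  by (auto simp: grad_def)

lemma test_fun_derivative_outside:
  assumes "x \<notin> D"
  shows "frechet_derivative \<phi> (at x) v = 0" "grad \<phi> x = 0"
proof -
  obtain K where K: "compact K" "\<And>x. x \<notin> K \<Longrightarrow> \<phi> x = 0" "x \<notin> K"
    by (rule test_fun_support) (use assms in blast)
  show "frechet_derivative \<phi> (at x) v = 0" "grad \<phi> x = 0"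
    using test_fun_derivative_support[OF K] by auto
qed

lemma sqint_test_fun: "sqint \<phi>"
  by (rule test_fun_support) (rule sqint_continuous_compact_support[OF test_fun_continuous])

lemma sqint_test_fun_partial: "b \<in> Basis \<Longrightarrow> sqint (\<lambda>x. frechet_derivative \<phi> (at x) b)"
  by (rule test_fun_support)
    (rule sqint_continuous_compact_support[OF test_fun_continuous_partial], auto intro: test_fun_derivative_support)

lemma sqint_test_fun_grad: "sqint (grad \<phi>)"
proof -
  have cont: "continuous_on UNIV (grad \<phi>)"
    unfolding grad_def[abs_def] by (intro continuous_intros test_fun_continuous_partial)
  show ?thesis
    by (rule test_fun_support)
      (rule sqint_continuous_compact_support[OF cont], auto intro: test_fun_derivative_support)
qed

text \<open>The product of two test functions has compact support, so the integral of its partial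
  derivative is 0; the product rule splits it.\<close>

lemma test_fun_integration_by_parts:
  assumes \<psi>: "test_fun D \<psi>" and b: "b \<in> Basis"
  shows "(\<integral>x. \<phi> x * frechet_derivative \<psi> (at x) b \<partial>lebesgue)
    = - (\<integral>x. frechet_derivative \<phi> (at x) b * \<psi> x \<partial>lebesgue)"
proof -
  obtain K where K: "compact K" "K \<subseteq> D" "\<And>x. x \<notin> K \<Longrightarrow> \<phi> x = 0" by (rule test_fun_support) (rule that)
  have \<psi>': "(\<psi> has_derivative frechet_derivative \<psi> (at x)) (at x)" for x
    using smooth_fun_derivative(1)[of \<psi>] \<psi> frechet_derivative_works unfolding test_fun_def by blast
  have \<psi>_cont: "continuous_on UNIV \<psi>" "continuous_on UNIV (\<lambda>x. frechet_derivative \<psi> (at x) b)"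
    using \<psi> b smooth_fun_continuous smooth_fun_derivative(2) unfolding test_fun_def by blast+
  have prod: "((\<lambda>x. \<phi> x * \<psi> x) has_derivative (\<lambda>h. \<phi> x * frechet_derivative \<psi> (at x) h + frechet_derivative \<phi> (at x) h * \<psi> x)) (at x)" for x
    by (rule has_derivative_mult[OF test_fun_derivative \<psi>'])
  have fd: "frechet_derivative (\<lambda>x. \<phi> x * \<psi> x) (at x) b = \<phi> x * frechet_derivative \<psi> (at x) b + frechet_derivative \<phi> (at x) b * \<psi> x" for x
    using frechet_derivative_at[OF prod[of x], symmetric] by simp
  have "(\<integral>x. frechet_derivative (\<lambda>x. \<phi> x * \<psi> x) (at x) b \<partial>lebesgue) = 0"
  proof (rule integral_partial_derivative_eq_0[OF _ _ K(1)])
    show "(\<lambda>x. \<phi> x * \<psi> x) differentiable (at x)" for x using prod differentiable_def by blast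
    show "continuous_on UNIV (\<lambda>x. frechet_derivative (\<lambda>x. \<phi> x * \<psi> x) (at x) b)"
      unfolding fd by (intro continuous_intros test_fun_continuous test_fun_continuous_partial b \<psi>_cont)
  qed (simp add: K)
  moreover have "integrable lebesgue (\<lambda>x. \<phi> x * frechet_derivative \<psi> (at x) b)"
    by (rule integrable_continuous_compact_support[OF _ K(1)])
      (auto intro!: continuous_intros test_fun_continuous \<psi>_cont simp: K)
  moreover have "integrable lebesgue (\<lambda>x. frechet_derivative \<phi> (at x) b * \<psi> x)"
    by (rule integrable_continuous_compact_support[OF _ K(1)])
      (auto intro!: continuous_intros test_fun_continuous_partial b \<psi>_cont simp: test_fun_derivative_support[OF K(1,3)])
  ultimately show ?thesis unfolding fd by simp
qed

text \<open>Integrating the partial derivative along \<open>b\<close> of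
  \<open>(x \<bullet> b) * (\<phi> x * \<phi> x)\<close> expresses the squared norm of
  \<open>\<phi>\<close> by -2 times an inner product of \<open>(x \<bullet> b) * \<phi> x\<close>
  with the derivative. Since \<open>\<bar>x \<bullet> b\<bar>\<close> is at most \<open>R\<close> on
  \<open>D\<close>, Cauchy-Schwarz and division by the norm of \<open>\<phi>\<close> give the
  constant \<open>2 * R\<close>.\<close>

lemma test_fun_Poincare:
  assumes R: "\<And>x. x \<in> D \<Longrightarrow> norm x \<le> R" "0 \<le> R"
  shows "norm (abs_l2 \<phi>) \<le> 2 * R * norm (abs_l2 (grad \<phi>))"
proof -
  obtain b :: 'a where b: "b \<in> Basis" using nonempty_Basis by blast
  obtain K where K: "compact K" "K \<subseteq> D" "\<And>x. x \<notin> K \<Longrightarrow> \<phi> x = 0" by (rule test_fun_support) (rule that)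
  define d where "d x = frechet_derivative \<phi> (at x) b" for x
  have d_cont: "continuous_on UNIV d" unfolding d_def[abs_def] by (rule test_fun_continuous_partial[OF b])
  have deriv: "((\<lambda>x. (x \<bullet> b) * (\<phi> x * \<phi> x)) has_derivative
      (\<lambda>h. (x \<bullet> b) * (\<phi> x * frechet_derivative \<phi> (at x) h + frechet_derivative \<phi> (at x) h * \<phi> x) + (h \<bullet> b) * (\<phi> x * \<phi> x))) (at x)" for x
    by (intro has_derivative_mult has_derivative_inner_left has_derivative_ident test_fun_derivative)
  have fd: "frechet_derivative (\<lambda>x. (x \<bullet> b) * (\<phi> x * \<phi> x)) (at x) b = 2 * (((x \<bullet> b) * \<phi> x) * d x) + \<phi> x * \<phi> x" for x
    using frechet_derivative_at[OF deriv[of x], symmetric] b by (simp add: d_def algebra_simps)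
  have "(\<integral>x. frechet_derivative (\<lambda>x. (x \<bullet> b) * (\<phi> x * \<phi> x)) (at x) b \<partial>lebesgue) = 0"
  proof (rule integral_partial_derivative_eq_0[OF _ _ K(1)])
    show "(\<lambda>x. (x \<bullet> b) * (\<phi> x * \<phi> x)) differentiable (at x)" for x using deriv differentiable_def by blast
    show "continuous_on UNIV (\<lambda>x. frechet_derivative (\<lambda>x. (x \<bullet> b) * (\<phi> x * \<phi> x)) (at x) b)"
      unfolding fd by (intro continuous_intros test_fun_continuous d_cont)
  qed (simp add: K)
  moreover have sq_x\<phi>: "sqint (\<lambda>x. (x \<bullet> b) * \<phi> x)"
    by (rule sqint_continuous_compact_support[OF _ K(1)])
      (auto intro!: continuous_intros test_fun_continuous simp: K)
  have sq_d: "sqint d" unfolding d_def[abs_def] by (rule sqint_test_fun_partial[OF b])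
  have "integrable lebesgue (\<lambda>x. ((x \<bullet> b) * \<phi> x) * d x)" "integrable lebesgue (\<lambda>x. \<phi> x * \<phi> x)"
    using sqint_inner[OF sq_x\<phi> sq_d] sqint_inner[OF sqint_test_fun sqint_test_fun] by simp_all
  ultimately have "(\<integral>x. \<phi> x * \<phi> x \<partial>lebesgue) = - 2 * (\<integral>x. ((x \<bullet> b) * \<phi> x) * d x \<partial>lebesgue)"
    unfolding fd by simp
  then have "(norm (abs_l2 \<phi>))\<^sup>2 = - 2 * (abs_l2 (\<lambda>x. (x \<bullet> b) * \<phi> x) \<bullet> abs_l2 d)"
    using sq_x\<phi> sq_d sqint_test_fun by (simp add: power2_norm_eq_inner inner_abs_l2)
  also have "\<dots> \<le> 2 * (norm (abs_l2 (\<lambda>x. (x \<bullet> b) * \<phi> x)) * norm (abs_l2 d))"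
    using Cauchy_Schwarz_ineq2[of "abs_l2 (\<lambda>x. (x \<bullet> b) * \<phi> x)" "abs_l2 d"] by linarith
  also have "\<dots> \<le> 2 * ((R * norm (abs_l2 \<phi>)) * (1 * norm (abs_l2 (grad \<phi>))))"
  proof (intro mult_left_mono mult_mono norm_abs_l2_mono sq_x\<phi> sq_d sqint_test_fun sqint_test_fun_grad)
    have "norm ((x \<bullet> b) * \<phi> x) \<le> R * norm (\<phi> x)" for x
    proof (cases "x \<in> D")
      case True
      then have "\<bar>x \<bullet> b\<bar> \<le> R" using Basis_le_norm[OF b, of x] R(1)[of x] by linarith
      then show ?thesis by (simp add: abs_mult mult_right_mono)
    qed (simp add: test_fun_outside)
    then show "AE x in lebesgue. norm ((x \<bullet> b) * \<phi> x) \<le> R * norm (\<phi> x)" by simp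
    have "norm (d x) \<le> 1 * norm (grad \<phi> x)" for x
      using Basis_le_norm[OF b, of "grad \<phi> x"] b by (simp add: grad_inner d_def)
    then show "AE x in lebesgue. norm (d x) \<le> 1 * norm (grad \<phi> x)" by simp
  qed (use R in auto)
  finally have *: "norm (abs_l2 \<phi>) * norm (abs_l2 \<phi>) \<le> norm (abs_l2 \<phi>) * (2 * R * norm (abs_l2 (grad \<phi>)))"
    by (simp add: power2_eq_square mult_ac)
  show ?thesis
  proof (cases "norm (abs_l2 \<phi>) = 0")
    case True
    then show ?thesis using R(2) by simp
  next
    case False
    then show ?thesis using * by (simp add: mult_le_cancel_left)
  qed
qed

end

lemma test_fun_zero: "test_fun D (\<lambda>x. 0)"
  by (simp add: test_fun_def smooth_fun_zero)

lemma test_fun_linear_combination: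
  assumes "test_fun D \<phi>" "test_fun D \<psi>"
  shows "test_fun D (\<lambda>x. c * \<phi> x + d * \<psi> x)"
    and "grad (\<lambda>x. c * \<phi> x + d * \<psi> x) x = c *\<^sub>R grad \<phi> x + d *\<^sub>R grad \<psi> x"
proof -
  have sub: "closure {x. c * \<phi> x + d * \<psi> x \<noteq> 0} \<subseteq> closure {x. \<phi> x \<noteq> 0} \<union> closure {x. \<psi> x \<noteq> 0}"
    unfolding closure_Un[symmetric] by (rule closure_mono) auto
  have cpt: "compact (closure {x. \<phi> x \<noteq> 0} \<union> closure {x. \<psi> x \<noteq> 0})"
    using assms by (auto simp: test_fun_def)
  have "compact (closure {x. c * \<phi> x + d * \<psi> x \<noteq> 0})"
    using bounded_subset[OF compact_imp_bounded[OF cpt] sub] by (simp add: compact_eq_bounded_closed)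
  then show "test_fun D (\<lambda>x. c * \<phi> x + d * \<psi> x)"
    using sub assms unfolding test_fun_def by (auto intro: smooth_fun_linear_combination)
  have "((\<lambda>x. c * \<phi> x + d * \<psi> x) has_derivative (\<lambda>v. c * frechet_derivative \<phi> (at x) v + d * frechet_derivative \<psi> (at x) v)) (at x)"
    by (intro has_derivative_add has_derivative_mult_right test_fun_derivative[OF assms(1)] test_fun_derivative[OF assms(2)])
  from frechet_derivative_at[OF this, symmetric]
  show "grad (\<lambda>x. c * \<phi> x + d * \<psi> x) x = c *\<^sub>R grad \<phi> x + d *\<^sub>R grad \<psi> x"
    unfolding grad_def by (simp add: scaleR_add_left sum.distrib scaleR_sum_right)
qed


subsection \<open>The elliptic solution operator\<close>

text \<open>Embeds functions on \<open>D\<close> isometrically into functions on the whole space, so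
  that \<open>l2_of\<close> sends L2(D) into a fixed type.\<close>

definition zero_ext :: "'a set \<Rightarrow> ('a \<Rightarrow> 'b) \<Rightarrow> 'a \<Rightarrow> 'b::zero" where
  "zero_ext D f x = (if x \<in> D then f x else 0)"

definition sqint_on :: "'a::euclidean_space set \<Rightarrow> ('a \<Rightarrow> 'b::euclidean_space) \<Rightarrow> bool" where
  "sqint_on D f \<longleftrightarrow> sqint (zero_ext D f)"

definition l2_of :: "'a::euclidean_space set \<Rightarrow> ('a \<Rightarrow> 'b::euclidean_space) \<Rightarrow> ('a, 'b) l2" where
  "l2_of D f = abs_l2 (zero_ext D f)"

lemma zero_ext_add: "zero_ext D (\<lambda>x. f x + g x) = (\<lambda>x. zero_ext D f x + zero_ext D g x :: 'b::real_vector)"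
  and zero_ext_diff: "zero_ext D (\<lambda>x. f x - g x) = (\<lambda>x. zero_ext D f x - zero_ext D g x :: 'b::real_vector)"
  and zero_ext_scaleR: "zero_ext D (\<lambda>x. c *\<^sub>R f x) = (\<lambda>x. c *\<^sub>R zero_ext D f x :: 'b::real_vector)"
  by (auto simp: zero_ext_def)

lemma sqint_on_add: "sqint_on D f \<Longrightarrow> sqint_on D g \<Longrightarrow> sqint_on D (\<lambda>x. f x + g x)"
  and sqint_on_diff: "sqint_on D f \<Longrightarrow> sqint_on D g \<Longrightarrow> sqint_on D (\<lambda>x. f x - g x)"
  and sqint_on_scaleR: "sqint_on D f \<Longrightarrow> sqint_on D (\<lambda>x. c *\<^sub>R f x)"
  by (simp_all add: sqint_on_def zero_ext_add zero_ext_diff zero_ext_scaleR sqint_add sqint_diff sqint_scaleR)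

lemma l2_of_add: "sqint_on D f \<Longrightarrow> sqint_on D g \<Longrightarrow> l2_of D (\<lambda>x. f x + g x) = l2_of D f + l2_of D g"
  and l2_of_diff: "sqint_on D f \<Longrightarrow> sqint_on D g \<Longrightarrow> l2_of D (\<lambda>x. f x - g x) = l2_of D f - l2_of D g"
  and l2_of_scaleR: "sqint_on D f \<Longrightarrow> l2_of D (\<lambda>x. c *\<^sub>R f x) = c *\<^sub>R l2_of D f"
  by (simp_all add: sqint_on_def l2_of_def zero_ext_add zero_ext_diff zero_ext_scaleR plus_abs_l2 minus_abs_l2 scaleR_abs_l2)

section \<open>Integrals and norms over \<open>D\<close> as Hilbert space expressions, and the space
  H01\<close>

context
  fixes D :: "'a::euclidean_space set"
  assumes D_open: "open D"
begin

lemma D_sets: "D \<in> sets lebesgue"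
  using D_open by (simp add: borel_open sets_completionI_sets)

lemma integral_lebesgue_on:
  fixes f :: "'a \<Rightarrow> real"
  shows "integral\<^sup>L (lebesgue_on D) f = (\<integral>x. zero_ext D f x \<partial>lebesgue)"
  unfolding zero_ext_def by (rule Lebesgue_Measure.integral_restrict_UNIV[OF D_sets, symmetric])

lemma L2_iff: "f \<in> L2 D \<longleftrightarrow> sqint_on D f"
proof -
  have "(\<lambda>x. (norm (zero_ext D f x))\<^sup>2) = (\<lambda>x. if x \<in> D then (f x)\<^sup>2 else 0)"
    by (auto simp: zero_ext_def)
  then show ?thesis
    unfolding L2_def sqint_on_def sqint_def
    using borel_measurable_if[OF D_sets, of f] Lebesgue_Measure.integrable_restrict_UNIV[OF D_sets, of "\<lambda>x. (f x)\<^sup>2"]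
    by (simp add: zero_ext_def[abs_def])
qed

lemma L2_norm_eq: "f \<in> L2 D \<Longrightarrow> L2_norm D f = norm (l2_of D f)"
proof -
  assume "f \<in> L2 D"
  then have "(norm (l2_of D f))\<^sup>2 = (\<integral>x. (norm (zero_ext D f x))\<^sup>2 \<partial>lebesgue)"
    by (simp add: L2_iff sqint_on_def l2_of_def norm_abs_l2)
  also have "(\<lambda>x. (norm (zero_ext D f x))\<^sup>2) = zero_ext D (\<lambda>x. (f x)\<^sup>2)"
    by (auto simp: zero_ext_def)
  finally have "L2_norm D f = sqrt ((norm (l2_of D f))\<^sup>2)"
    by (simp add: L2_norm_def integral_lebesgue_on)
  then show ?thesis by simp
qed

lemma integral_inner_eq:
  assumes "sqint_on D f" "sqint_on D g"
  shows "integral\<^sup>L (lebesgue_on D) (\<lambda>x. f x \<bullet> g x) = l2_of D f \<bullet> l2_of D g"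
proof -
  have "zero_ext D (\<lambda>x. f x \<bullet> g x) = (\<lambda>x. zero_ext D f x \<bullet> zero_ext D g x)"
    by (auto simp: zero_ext_def)
  then show ?thesis
    using assms by (simp add: integral_lebesgue_on sqint_on_def l2_of_def inner_abs_l2)
qed

lemma L2_norm_norm_eq:
  assumes "sqint_on D g"
  shows "L2_norm D (\<lambda>x. norm (g x)) = norm (l2_of D g)"
proof -
  have "integral\<^sup>L (lebesgue_on D) (\<lambda>x. (norm (g x))\<^sup>2) = (norm (l2_of D g))\<^sup>2"
    using integral_inner_eq[OF assms assms] by (simp add: power2_norm_eq_inner)
  then show ?thesis by (simp add: L2_norm_def)
qed

lemma L2_norm_diff_eq:
  assumes "sqint_on D f" "sqint_on D g"
  shows "L2_norm D (\<lambda>x. f x - g x) = norm (l2_of D f - l2_of D g)"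
  using L2_norm_eq[of "\<lambda>x. f x - g x"] sqint_on_diff[OF assms] l2_of_diff[OF assms] by (simp add: L2_iff)

lemma L2_norm_norm_diff_eq:
  assumes "sqint_on D f" "sqint_on D g"
  shows "L2_norm D (\<lambda>x. norm (f x - g x)) = norm (l2_of D f - l2_of D g)"
  using L2_norm_norm_eq[OF sqint_on_diff[OF assms]] l2_of_diff[OF assms] by simp

lemma sqint_on_components:
  fixes g :: "'a \<Rightarrow> 'b::euclidean_space"
  shows "(\<forall>b\<in>Basis. (\<lambda>x. g x \<bullet> b) \<in> L2 D) \<longleftrightarrow> sqint_on D g"
proof
  assume "\<forall>b\<in>Basis. (\<lambda>x. g x \<bullet> b) \<in> L2 D"
  then have c: "sqint (\<lambda>x. zero_ext D g x \<bullet> b)" if "b \<in> Basis" for b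
  proof -
    have "zero_ext D (\<lambda>x. g x \<bullet> b) = (\<lambda>x. zero_ext D g x \<bullet> b)" by (auto simp: zero_ext_def)
    moreover have "sqint (zero_ext D (\<lambda>x. g x \<bullet> b))"
      using \<open>\<forall>b\<in>Basis. (\<lambda>x. g x \<bullet> b) \<in> L2 D\<close> that unfolding L2_iff sqint_on_def by blast
    ultimately show ?thesis by simp
  qed
  show "sqint_on D g"
    unfolding sqint_on_def sqint_def
  proof
    show "zero_ext D g \<in> borel_measurable lebesgue"
      by (rule borel_measurable_euclidean_space[THEN iffD2]) (use c in \<open>simp add: sqint_def\<close>)
    have "(norm (zero_ext D g x))\<^sup>2 = (\<Sum>b\<in>Basis. (norm (zero_ext D g x \<bullet> b))\<^sup>2)" for x
      unfolding power2_norm_eq_inner[of "zero_ext D g x"] by (subst euclidean_inner) (simp add: power2_eq_square)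
    then show "integrable lebesgue (\<lambda>x. (norm (zero_ext D g x))\<^sup>2)"
      using c by (auto simp: sqint_def intro!: Bochner_Integration.integrable_sum)
  qed
next
  assume g: "sqint_on D g"
  show "\<forall>b\<in>Basis. (\<lambda>x. g x \<bullet> b) \<in> L2 D"
  proof
    fix b :: 'b assume b: "b \<in> Basis"
    have eq: "zero_ext D (\<lambda>x. g x \<bullet> b) = (\<lambda>x. zero_ext D g x \<bullet> b)" by (auto simp: zero_ext_def)
    show "(\<lambda>x. g x \<bullet> b) \<in> L2 D"
      unfolding L2_iff sqint_on_def eq
    proof (rule sqint_dominated)
      show "integrable lebesgue (\<lambda>x. (norm (zero_ext D g x))\<^sup>2)"
        using g by (simp add: sqint_on_def sqint_def)
      show "(\<lambda>x. zero_ext D g x \<bullet> b) \<in> borel_measurable lebesgue"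
        using g by (auto simp: sqint_on_def sqint_def)
      show "(norm (zero_ext D g x \<bullet> b))\<^sup>2 \<le> (norm (zero_ext D g x))\<^sup>2" for x
        using Basis_le_norm[OF b] by (intro power_mono) auto
    qed
  qed
qed

lemma zero_ext_test_fun:
  assumes "test_fun D \<phi>"
  shows "zero_ext D \<phi> = \<phi>" "zero_ext D (grad \<phi>) = grad \<phi>"
    "zero_ext D (\<lambda>x. frechet_derivative \<phi> (at x) b) = (\<lambda>x. frechet_derivative \<phi> (at x) b)"
  using test_fun_outside[OF assms] test_fun_derivative_outside[OF assms]
  by (auto simp: zero_ext_def fun_eq_iff)

lemma sqint_on_test_fun:
  assumes "test_fun D \<phi>"
  shows "sqint_on D \<phi>" "sqint_on D (grad \<phi>)" "b \<in> Basis \<Longrightarrow> sqint_on D (\<lambda>x. frechet_derivative \<phi> (at x) b)"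
  unfolding sqint_on_def zero_ext_test_fun[OF assms]
  using sqint_test_fun[OF assms] sqint_test_fun_grad[OF assms] sqint_test_fun_partial[OF assms] by auto

lemma test_fun_scaleR:
  assumes \<psi>: "test_fun D \<psi>" and b: "b \<in> Basis"
  shows "zero_ext D (\<lambda>x. \<psi> x *\<^sub>R b) = (\<lambda>x. \<psi> x *\<^sub>R b)" "sqint (\<lambda>x. \<psi> x *\<^sub>R b)"
proof -
  show "zero_ext D (\<lambda>x. \<psi> x *\<^sub>R b) = (\<lambda>x. \<psi> x *\<^sub>R b)"
    using test_fun_outside[OF \<psi>] by (auto simp: zero_ext_def fun_eq_iff)
  show "sqint (\<lambda>x. \<psi> x *\<^sub>R b)"
  proof (rule sqint_dominated[OF sqint_int[OF sqint_test_fun[OF \<psi>]]])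
    show "(\<lambda>x. \<psi> x *\<^sub>R b) \<in> borel_measurable lebesgue"
      using sqint_meas[OF sqint_test_fun[OF \<psi>]] by measurable
  qed (use b in \<open>simp add: power_mult_distrib\<close>)
qed

text \<open>Multiplication by the indicator of \<open>D\<close>. Its fixed points are the classes
  that come from functions on \<open>D\<close>; this set is closed, so limits of test functions stay
  in it and can be represented on \<open>D\<close> again.\<close>

definition l2_restrict :: "('a, 'b::euclidean_space) l2 \<Rightarrow> ('a, 'b) l2" where
  "l2_restrict h = l2_of D (rep_l2 h)"

lemma sqint_on_sqint: "sqint f \<Longrightarrow> sqint_on D f"
  unfolding sqint_on_def
proof (rule sqint_dominated)
  assume f: "sqint f"
  show "integrable lebesgue (\<lambda>x. (norm (f x))\<^sup>2)" using f by (rule sqint_int)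
  show "zero_ext D f \<in> borel_measurable lebesgue"
    unfolding zero_ext_def[abs_def] using sqint_meas[OF f] D_sets by measurable
  show "(norm (zero_ext D f x))\<^sup>2 \<le> (norm (f x))\<^sup>2" for x by (simp add: zero_ext_def)
qed

lemma sqint_on_rep: "sqint_on D (rep_l2 h)"
  by (rule sqint_on_sqint[OF sqint_rep])

lemma rep_l2_of: "sqint_on D f \<Longrightarrow> AE x in lebesgue. rep_l2 (l2_of D f) x = zero_ext D f x"
  unfolding l2_of_def sqint_on_def by (rule rep_abs_l2)

lemma l2_of_cong_AE:
  assumes "sqint_on D f" "sqint_on D g" "AE x in lebesgue. x \<in> D \<longrightarrow> f x = g x"
  shows "l2_of D f = l2_of D g"
  unfolding l2_of_def
proof (rule abs_l2_eqI)
  show "AE x in lebesgue. zero_ext D f x = zero_ext D g x"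
    using assms(3) by eventually_elim (simp add: zero_ext_def)
qed (use assms in \<open>simp_all add: sqint_on_def\<close>)

lemma l2_restrict_l2_of: "sqint_on D f \<Longrightarrow> l2_restrict (l2_of D f) = l2_of D f"
  unfolding l2_restrict_def
proof (rule l2_of_cong_AE)
  assume f: "sqint_on D f"
  show "AE x in lebesgue. x \<in> D \<longrightarrow> rep_l2 (l2_of D f) x = f x"
    using rep_l2_of[OF f] by eventually_elim (simp add: zero_ext_def)
qed (auto intro: sqint_on_rep)

lemma l2_restrict_diff: "norm (l2_restrict h - l2_restrict k) \<le> norm (h - k)"
proof -
  have "l2_restrict h - l2_restrict k = abs_l2 (zero_ext D (\<lambda>x. rep_l2 h x - rep_l2 k x))"
    unfolding l2_restrict_def l2_of_diff[OF sqint_on_rep sqint_on_rep, symmetric] by (simp add: l2_of_def)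
  moreover have "h - k = abs_l2 (\<lambda>x. rep_l2 h x - rep_l2 k x)"
    using minus_abs_l2[OF sqint_rep sqint_rep, of h k] by (simp add: abs_rep_l2)
  moreover have "norm (abs_l2 (zero_ext D (\<lambda>x. rep_l2 h x - rep_l2 k x))) \<le> 1 * norm (abs_l2 (\<lambda>x. rep_l2 h x - rep_l2 k x))"
  proof (rule norm_abs_l2_mono)
    show "sqint (zero_ext D (\<lambda>x. rep_l2 h x - rep_l2 k x))"
      using sqint_on_diff[OF sqint_on_rep sqint_on_rep] by (simp add: sqint_on_def)
    show "sqint (\<lambda>x. rep_l2 h x - rep_l2 k x)" by (intro sqint_diff sqint_rep)
  qed (auto simp: zero_ext_def)
  ultimately show ?thesis by simp
qed

lemma continuous_l2_restrict: "continuous_on S (l2_restrict :: ('a, 'b::euclidean_space) l2 \<Rightarrow> _)"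
proof -
  have "1-lipschitz_on S (l2_restrict :: ('a, 'b) l2 \<Rightarrow> _)"
    by (rule lipschitz_onI) (simp_all add: dist_norm l2_restrict_diff)
  then show ?thesis by (rule lipschitz_on_continuous_on)
qed

lemma closed_l2_restrict_fixed: "closed {h. l2_restrict h = (h :: ('a, 'b::euclidean_space) l2)}"
  by (intro closed_Collect_eq continuous_l2_restrict continuous_intros)

text \<open>An element of H01 is represented by the pair of the function and its weak gradient.\<close>

definition H01 :: "(('a, real) l2 \<times> ('a, 'a) l2) set" where
  "H01 = closure {(l2_of D \<phi>, l2_of D (grad \<phi>)) | \<phi>. test_fun D \<phi>}"

lemma H01_closed: "closed H01" by (simp add: H01_def)

lemma H01_restrict: assumes "p \<in> H01" shows "l2_restrict (fst p) = fst p" "l2_restrict (snd p) = snd p"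
proof -
  have "H01 \<subseteq> {h. l2_restrict h = h} \<times> {h. l2_restrict h = h}"
    unfolding H01_def
    by (intro closure_minimal closed_Times closed_l2_restrict_fixed) (auto intro!: l2_restrict_l2_of sqint_on_test_fun)
  then show "l2_restrict (fst p) = fst p" "l2_restrict (snd p) = snd p" using assms by auto
qed

lemma H01_linear_combination:
  assumes "p \<in> H01" "q \<in> H01"
  shows "c *\<^sub>R p + d *\<^sub>R q \<in> H01"
proof -
  let ?T = "{(l2_of D \<phi>, l2_of D (grad \<phi>)) | \<phi>. test_fun D \<phi>}"
  obtain a b where ab: "\<And>n. a n \<in> ?T" "a \<longlonglongrightarrow> p" "\<And>n. b n \<in> ?T" "b \<longlonglongrightarrow> q"
    using assms unfolding H01_def closure_sequential by blast
  have "c *\<^sub>R a n + d *\<^sub>R b n \<in> ?T" for n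
  proof -
    obtain \<phi> \<psi> where \<phi>: "test_fun D \<phi>" "a n = (l2_of D \<phi>, l2_of D (grad \<phi>))"
      and \<psi>: "test_fun D \<psi>" "b n = (l2_of D \<psi>, l2_of D (grad \<psi>))"
      using ab(1)[of n] ab(3)[of n] by blast
    have "l2_of D (\<lambda>x. c * \<phi> x + d * \<psi> x) = c *\<^sub>R l2_of D \<phi> + d *\<^sub>R l2_of D \<psi>"
      using l2_of_add[of D "\<lambda>x. c *\<^sub>R \<phi> x" "\<lambda>x. d *\<^sub>R \<psi> x"] l2_of_scaleR[of D \<phi> c] l2_of_scaleR[of D \<psi> d]
        sqint_on_scaleR[OF sqint_on_test_fun(1)[OF \<phi>(1)], of c]
        sqint_on_scaleR[OF sqint_on_test_fun(1)[OF \<psi>(1)], of d]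
        sqint_on_test_fun(1)[OF \<phi>(1)] sqint_on_test_fun(1)[OF \<psi>(1)] by simp
    moreover have "l2_of D (grad (\<lambda>x. c * \<phi> x + d * \<psi> x)) = c *\<^sub>R l2_of D (grad \<phi>) + d *\<^sub>R l2_of D (grad \<psi>)"
      unfolding test_fun_linear_combination(2)[OF \<phi>(1) \<psi>(1), abs_def]
      by (simp add: l2_of_add l2_of_scaleR sqint_on_scaleR sqint_on_test_fun \<phi>(1) \<psi>(1))
    ultimately show ?thesis
      using test_fun_linear_combination(1)[OF \<phi>(1) \<psi>(1), of c d] \<phi>(2) \<psi>(2)
      by (intro CollectI exI[of _ "\<lambda>x. c * \<phi> x + d * \<psi> x"]) simp
  qed
  moreover have "(\<lambda>n. c *\<^sub>R a n + d *\<^sub>R b n) \<longlonglongrightarrow> c *\<^sub>R p + d *\<^sub>R q"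
    by (intro tendsto_intros ab)
  ultimately show ?thesis
    unfolding H01_def closure_sequential by (intro exI[of _ "\<lambda>n. c *\<^sub>R a n + d *\<^sub>R b n"]) simp
qed

lemma H01_zero: "0 \<in> H01"
proof -
  have "(l2_of D (\<lambda>x. 0::real), l2_of D (grad (\<lambda>x. 0))) \<in> {(l2_of D \<phi>, l2_of D (grad \<phi>)) | \<phi>. test_fun D \<phi>}"
    using test_fun_zero by blast
  then have "(l2_of D (\<lambda>x. 0::real), l2_of D (grad (\<lambda>x. 0))) \<in> H01"
    unfolding H01_def by (rule subsetD[OF closure_subset])
  from H01_linear_combination[OF this this, of 0 0] show ?thesis by (simp add: zero_prod_def)
qed

lemma H01_add: "p \<in> H01 \<Longrightarrow> q \<in> H01 \<Longrightarrow> p + q \<in> H01"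
  and H01_diff: "p \<in> H01 \<Longrightarrow> q \<in> H01 \<Longrightarrow> p - q \<in> H01"
  and H01_scaleR: "p \<in> H01 \<Longrightarrow> c *\<^sub>R p \<in> H01"
  using H01_linear_combination[of p q 1 1] H01_linear_combination[of p q 1 "-1"]
    H01_linear_combination[of p p c 0] by simp_all

lemma H01_convex: "convex H01"
  unfolding convex_def using H01_linear_combination by blast

text \<open>Both sides are continuous, so the inequality passes from test functions to the
  closure.\<close>

lemma H01_Poincare:
  assumes R: "\<And>x. x \<in> D \<Longrightarrow> norm x \<le> R" "0 \<le> R" and p: "p \<in> H01"
  shows "norm (fst p) \<le> 2 * R * norm (snd p)"
proof -
  have "H01 \<subseteq> {p. norm (fst p) \<le> 2 * R * norm (snd p)}"
    unfolding H01_def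
  proof (rule closure_minimal)
    show "closed {p::('a, real) l2 \<times> ('a, 'a) l2. norm (fst p) \<le> 2 * R * norm (snd p)}"
      by (intro closed_Collect_le continuous_intros)
    show "{(l2_of D \<phi>, l2_of D (grad \<phi>)) | \<phi>. test_fun D \<phi>} \<subseteq> {p. norm (fst p) \<le> 2 * R * norm (snd p)}"
      using test_fun_Poincare[OF _ R] by (auto simp: l2_of_def zero_ext_test_fun)
  qed
  then show ?thesis using p by auto
qed

text \<open>For fixed \<open>\<psi>\<close> both sides are continuous in the pair, so integration by
  parts survives the closure. This supplies the weak-gradient clause of
  \<open>H01_grad\<close>.\<close>

lemma H01_weak_gradient:
  assumes p: "p \<in> H01" and \<psi>: "test_fun D \<psi>" and b: "b \<in> Basis"
  shows "fst p \<bullet> l2_of D (\<lambda>x. frechet_derivative \<psi> (at x) b) = - (snd p \<bullet> l2_of D (\<lambda>x. \<psi> x *\<^sub>R b))"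
proof -
  note test = test_fun_scaleR[OF \<psi> b]
  have "H01 \<subseteq> {p. fst p \<bullet> l2_of D (\<lambda>x. frechet_derivative \<psi> (at x) b) = - (snd p \<bullet> l2_of D (\<lambda>x. \<psi> x *\<^sub>R b))}"
    unfolding H01_def
  proof (rule closure_minimal)
    show "closed {p::('a, real) l2 \<times> ('a, 'a) l2. fst p \<bullet> l2_of D (\<lambda>x. frechet_derivative \<psi> (at x) b) = - (snd p \<bullet> l2_of D (\<lambda>x. \<psi> x *\<^sub>R b))}"
      by (intro closed_Collect_eq continuous_intros)
    show "{(l2_of D \<phi>, l2_of D (grad \<phi>)) | \<phi>. test_fun D \<phi>}
      \<subseteq> {p. fst p \<bullet> l2_of D (\<lambda>x. frechet_derivative \<psi> (at x) b) = - (snd p \<bullet> l2_of D (\<lambda>x. \<psi> x *\<^sub>R b))}"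
    proof safe
      fix \<phi> assume \<phi>: "test_fun D \<phi>"
      have "l2_of D \<phi> \<bullet> l2_of D (\<lambda>x. frechet_derivative \<psi> (at x) b) = (\<integral>x. \<phi> x * frechet_derivative \<psi> (at x) b \<partial>lebesgue)"
        using inner_abs_l2[OF sqint_test_fun[OF \<phi>] sqint_test_fun_partial[OF \<psi> b]]
        by (simp add: l2_of_def zero_ext_test_fun \<phi> \<psi>)
      moreover have "l2_of D (grad \<phi>) \<bullet> l2_of D (\<lambda>x. \<psi> x *\<^sub>R b) = (\<integral>x. frechet_derivative \<phi> (at x) b * \<psi> x \<partial>lebesgue)"
        using inner_abs_l2[OF sqint_test_fun_grad[OF \<phi>] test(2)]
        by (simp add: l2_of_def zero_ext_test_fun \<phi> test(1) grad_inner b mult.commute)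
      ultimately show "fst (l2_of D \<phi>, l2_of D (grad \<phi>)) \<bullet> l2_of D (\<lambda>x. frechet_derivative \<psi> (at x) b)
          = - (snd (l2_of D \<phi>, l2_of D (grad \<phi>)) \<bullet> l2_of D (\<lambda>x. \<psi> x *\<^sub>R b))"
        using test_fun_integration_by_parts[OF \<phi> \<psi> b] by simp
    qed
  qed
  then show ?thesis using p by auto
qed

text \<open>Approximation of the function and of its gradient in L2 is exactly convergence of pairs,
  that is membership in the closure. Through this equivalence the weak formulations become equations
  on a closed subspace.\<close>

lemma H01_grad_iff: "H01_grad D y g \<longleftrightarrow> sqint_on D y \<and> sqint_on D g \<and> (l2_of D y, l2_of D g) \<in> H01"
proof
  assume H: "H01_grad D y g"
  then obtain \<phi> where \<phi>: "\<And>k. test_fun D (\<phi> k)" "(\<lambda>k. L2_norm D (\<lambda>x. \<phi> k x - y x)) \<longlonglongrightarrow> 0"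
    "(\<lambda>k. L2_norm D (\<lambda>x. norm (grad (\<phi> k) x - g x))) \<longlonglongrightarrow> 0"
    unfolding H01_grad_def by blast
  have y: "sqint_on D y" and g: "sqint_on D g"
    using H sqint_on_components[of g] L2_iff[of y] unfolding H01_grad_def by auto
  have "L2_norm D (\<lambda>x. \<phi> k x - y x) = norm (l2_of D (\<phi> k) - l2_of D y)" for k
    by (rule L2_norm_diff_eq[OF sqint_on_test_fun(1)[OF \<phi>(1)] y])
  then have 1: "(\<lambda>k. l2_of D (\<phi> k)) \<longlonglongrightarrow> l2_of D y"
    using \<phi>(2) by (simp add: tendsto_norm_zero_iff LIM_zero_iff)
  have "L2_norm D (\<lambda>x. norm (grad (\<phi> k) x - g x)) = norm (l2_of D (grad (\<phi> k)) - l2_of D g)" for k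
    by (rule L2_norm_norm_diff_eq[OF sqint_on_test_fun(2)[OF \<phi>(1)] g])
  then have 2: "(\<lambda>k. l2_of D (grad (\<phi> k))) \<longlonglongrightarrow> l2_of D g"
    using \<phi>(3) by (simp add: tendsto_norm_zero_iff LIM_zero_iff)
  have "(l2_of D y, l2_of D g) \<in> H01"
    unfolding H01_def closure_sequential
    by (intro exI[of _ "\<lambda>k. (l2_of D (\<phi> k), l2_of D (grad (\<phi> k)))"] conjI tendsto_Pair 1 2) (use \<phi>(1) in blast)
  then show "sqint_on D y \<and> sqint_on D g \<and> (l2_of D y, l2_of D g) \<in> H01" using y g by blast
next
  assume "sqint_on D y \<and> sqint_on D g \<and> (l2_of D y, l2_of D g) \<in> H01"
  then have y: "sqint_on D y" and g: "sqint_on D g" and H01: "(l2_of D y, l2_of D g) \<in> H01" by auto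
  have wg: "weak_gradient D y g"
    unfolding weak_gradient_def
  proof (intro allI impI ballI)
    fix \<psi> and b :: 'a assume \<psi>: "test_fun D \<psi>" and b: "b \<in> Basis"
    have sqb: "sqint_on D (\<lambda>x. \<psi> x *\<^sub>R b)"
      using test_fun_scaleR[OF \<psi> b] by (simp add: sqint_on_def)
    have "integral\<^sup>L (lebesgue_on D) (\<lambda>x. y x * frechet_derivative \<psi> (at x) b) = l2_of D y \<bullet> l2_of D (\<lambda>x. frechet_derivative \<psi> (at x) b)"
      using integral_inner_eq[OF y sqint_on_test_fun(3)[OF \<psi> b]] by simp
    also have "\<dots> = - (l2_of D g \<bullet> l2_of D (\<lambda>x. \<psi> x *\<^sub>R b))"
      using H01_weak_gradient[OF H01 \<psi> b] by simp
    also have "l2_of D g \<bullet> l2_of D (\<lambda>x. \<psi> x *\<^sub>R b) = integral\<^sup>L (lebesgue_on D) (\<lambda>x. (g x \<bullet> b) * \<psi> x)"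
      using integral_inner_eq[OF g sqb] by (simp add: mult.commute)
    finally show "integral\<^sup>L (lebesgue_on D) (\<lambda>x. y x * frechet_derivative \<psi> (at x) b)
      = - integral\<^sup>L (lebesgue_on D) (\<lambda>x. (g x \<bullet> b) * \<psi> x)" .
  qed
  obtain a where a: "\<And>n. a n \<in> {(l2_of D \<phi>, l2_of D (grad \<phi>)) | \<phi>. test_fun D \<phi>}" "a \<longlonglongrightarrow> (l2_of D y, l2_of D g)"
    using H01 unfolding H01_def closure_sequential by blast
  then have "\<exists>\<phi>. test_fun D \<phi> \<and> a n = (l2_of D \<phi>, l2_of D (grad \<phi>))" for n by blast
  then obtain \<phi> where \<phi>: "\<And>n. test_fun D (\<phi> n)" "\<And>n. a n = (l2_of D (\<phi> n), l2_of D (grad (\<phi> n)))" by metis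
  have "(\<lambda>n. l2_of D (\<phi> n)) \<longlonglongrightarrow> l2_of D y" "(\<lambda>n. l2_of D (grad (\<phi> n))) \<longlonglongrightarrow> l2_of D g"
    using tendsto_fst[OF a(2)] tendsto_snd[OF a(2)] by (simp_all add: \<phi>(2))
  then have lim: "(\<lambda>n. norm (l2_of D (\<phi> n) - l2_of D y)) \<longlonglongrightarrow> 0" "(\<lambda>n. norm (l2_of D (grad (\<phi> n)) - l2_of D g)) \<longlonglongrightarrow> 0"
    by (simp_all add: tendsto_norm_zero_iff LIM_zero_iff)
  have "norm (l2_of D (\<phi> k) - l2_of D y) = L2_norm D (\<lambda>x. \<phi> k x - y x)" for k
    by (rule L2_norm_diff_eq[OF sqint_on_test_fun(1)[OF \<phi>(1)] y, symmetric])
  moreover have "norm (l2_of D (grad (\<phi> k)) - l2_of D g) = L2_norm D (\<lambda>x. norm (grad (\<phi> k) x - g x))" for k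
    by (rule L2_norm_norm_diff_eq[OF sqint_on_test_fun(2)[OF \<phi>(1)] g, symmetric])
  ultimately show "H01_grad D y g"
    unfolding H01_grad_def using y g wg \<phi>(1) lim sqint_on_components[of g] L2_iff[of y] by auto
qed

end


lemma rep_l2_add: "AE x in lebesgue. rep_l2 (g + h) x = rep_l2 g x + rep_l2 h x"
proof -
  have "g + h = abs_l2 (\<lambda>x. rep_l2 g x + rep_l2 h x)"
    using plus_abs_l2[OF sqint_rep sqint_rep, of g h] by (simp add: abs_rep_l2)
  then show ?thesis using rep_abs_l2[OF sqint_add[OF sqint_rep sqint_rep], of g h] by simp
qed

lemma rep_l2_scaleR: "AE x in lebesgue. rep_l2 (c *\<^sub>R g) x = c *\<^sub>R rep_l2 g x"
proof -
  have "c *\<^sub>R g = abs_l2 (\<lambda>x. c *\<^sub>R rep_l2 g x)"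
    using scaleR_abs_l2[OF sqint_rep, of c g] by (simp add: abs_rep_l2)
  then show ?thesis using rep_abs_l2[OF sqint_scaleR[OF sqint_rep], of c g] by simp
qed

section \<open>Existence, symmetry, bounds and continuity of the solution operator\<close>

locale elliptic =
  fixes D :: "'a::euclidean_space set" and amin amax R :: real
  assumes D_open: "open D" and R: "\<And>x. x \<in> D \<Longrightarrow> norm x \<le> R" "0 \<le> R"
    and amin: "0 < amin" "amin \<le> amax"
begin

text \<open>Clamping makes the coefficient-to-solution map total and continuous on all of L2.\<close>

definition clamp :: "('a, real) l2 \<Rightarrow> 'a \<Rightarrow> real" where
  "clamp A x = max amin (min amax (rep_l2 A x))"

definition mul :: "('a, real) l2 \<Rightarrow> ('a, 'a) l2 \<Rightarrow> ('a, 'a) l2" where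
  "mul A g = abs_l2 (\<lambda>x. clamp A x *\<^sub>R rep_l2 g x)"

lemma clamp_bounds: "amin \<le> clamp A x" "clamp A x \<le> amax" "0 < clamp A x"
  using amin by (auto simp: clamp_def)

lemma clamp_lipschitz: "\<bar>clamp A x - clamp B x\<bar> \<le> \<bar>rep_l2 A x - rep_l2 B x\<bar>"
  unfolding clamp_def by (simp add: max_def min_def)

lemma clamp_measurable[measurable]: "clamp A \<in> borel_measurable lebesgue"
  unfolding clamp_def[abs_def] using sqint_meas[OF sqint_rep[of A]] by measurable

lemma sqint_mul: "sqint (\<lambda>x. clamp A x *\<^sub>R rep_l2 g x)"
proof (rule sqint_dominated)
  show "integrable lebesgue (\<lambda>x. amax\<^sup>2 * (norm (rep_l2 g x))\<^sup>2)"
    by (intro integrable_mult_right sqint_int sqint_rep)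
  show "(\<lambda>x. clamp A x *\<^sub>R rep_l2 g x) \<in> borel_measurable lebesgue"
    by (intro borel_measurable_scaleR clamp_measurable sqint_meas sqint_rep)
  fix x
  have "(clamp A x)\<^sup>2 \<le> amax\<^sup>2" using clamp_bounds[of A x] by (intro power_mono) auto
  then show "(norm (clamp A x *\<^sub>R rep_l2 g x))\<^sup>2 \<le> amax\<^sup>2 * (norm (rep_l2 g x))\<^sup>2"
    by (simp add: power_mult_distrib mult_right_mono)
qed

lemma mul_inner: "mul A g \<bullet> h = (\<integral>x. clamp A x * (rep_l2 g x \<bullet> rep_l2 h x) \<partial>lebesgue)"
  using inner_abs_l2[OF sqint_mul sqint_rep, of A g h] by (simp add: mul_def abs_rep_l2)

lemma mul_sym: "mul A g \<bullet> h = mul A h \<bullet> g"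
  unfolding mul_inner by (simp add: inner_commute)

lemma mul_add: "mul A (g + h) = mul A g + mul A h"
  unfolding mul_def plus_abs_l2[OF sqint_mul sqint_mul]
proof (rule abs_l2_eqI[OF sqint_mul sqint_add[OF sqint_mul sqint_mul]])
  show "AE x in lebesgue. clamp A x *\<^sub>R rep_l2 (g + h) x = clamp A x *\<^sub>R rep_l2 g x + clamp A x *\<^sub>R rep_l2 h x"
    using rep_l2_add[of g h] by eventually_elim (simp add: scaleR_add_right)
qed

lemma mul_scaleR: "mul A (c *\<^sub>R g) = c *\<^sub>R mul A g"
  unfolding mul_def scaleR_abs_l2[OF sqint_mul]
proof (rule abs_l2_eqI[OF sqint_mul sqint_scaleR[OF sqint_mul]])
  show "AE x in lebesgue. clamp A x *\<^sub>R rep_l2 (c *\<^sub>R g) x = c *\<^sub>R clamp A x *\<^sub>R rep_l2 g x"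
    using rep_l2_scaleR[of c g] by eventually_elim simp
qed

lemma mul_bound: "norm (mul A g) \<le> amax * norm g"
proof -
  have "norm (abs_l2 (\<lambda>x. clamp A x *\<^sub>R rep_l2 g x)) \<le> amax * norm (abs_l2 (rep_l2 g))"
  proof (rule norm_abs_l2_mono[OF sqint_mul sqint_rep])
    show "AE x in lebesgue. norm (clamp A x *\<^sub>R rep_l2 g x) \<le> amax * norm (rep_l2 g x)"
    proof (rule AE_I2)
      fix x
      show "norm (clamp A x *\<^sub>R rep_l2 g x) \<le> amax * norm (rep_l2 g x)"
        using clamp_bounds[of A x] by (simp add: mult_right_mono)
    qed
  qed (use amin in simp)
  then show ?thesis by (simp add: mul_def abs_rep_l2)
qed

lemma mul_coercive: "amin * (norm g)\<^sup>2 \<le> mul A g \<bullet> g"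
proof -
  have "amin * (norm g)\<^sup>2 = (\<integral>x. amin * (norm (rep_l2 g x))\<^sup>2 \<partial>lebesgue)"
    using norm_abs_l2[OF sqint_rep, of g] by (simp add: abs_rep_l2)
  also have "\<dots> \<le> (\<integral>x. clamp A x * (rep_l2 g x \<bullet> rep_l2 g x) \<partial>lebesgue)"
  proof (rule integral_mono)
    show "integrable lebesgue (\<lambda>x. amin * (norm (rep_l2 g x))\<^sup>2)"
      by (intro integrable_mult_right sqint_int sqint_rep)
    show "integrable lebesgue (\<lambda>x. clamp A x * (rep_l2 g x \<bullet> rep_l2 g x))"
      using sqint_inner[OF sqint_mul sqint_rep, of A g g] by simp
    show "amin * (norm (rep_l2 g x))\<^sup>2 \<le> clamp A x * (rep_l2 g x \<bullet> rep_l2 g x)" for x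
      using clamp_bounds(1)[of A x] by (simp add: power2_norm_eq_inner mult_right_mono)
  qed
  finally show ?thesis by (simp add: mul_inner)
qed

text \<open>Coefficients converging in L2 need not converge uniformly, so the fixed factor
  \<open>g\<close> is truncated at height \<open>k\<close>. Where its norm is at most
  \<open>k\<close>, the error is bounded by \<open>k\<close> times the coefficient difference;
  elsewhere the clamped coefficients differ by at most \<open>amax\<close>, and the tail
  \<open>t k\<close> of \<open>g\<close> is small uniformly in \<open>n\<close>. Thus
  \<open>k\<close> is chosen before \<open>n\<close>.\<close>

lemma mul_continuous:
  assumes "A \<longlonglongrightarrow> A0"
  shows "(\<lambda>n. mul (A n) g) \<longlonglongrightarrow> mul A0 g"
proof -
  define t where "t k = (\<integral>x. (if real k < norm (rep_l2 g x) then (norm (rep_l2 g x))\<^sup>2 else 0) \<partial>lebesgue)" for k :: nat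
  note g_meas[measurable] = sqint_meas[OF sqint_rep[of g]]
  note g_int = sqint_int[OF sqint_rep[of g]]
  have t_int: "integrable lebesgue (\<lambda>x. if real k < norm (rep_l2 g x) then (norm (rep_l2 g x))\<^sup>2 else 0)" for k :: nat
    by (rule Bochner_Integration.integrable_bound[OF g_int]) auto
  have "t \<longlonglongrightarrow> (\<integral>x. (0::real) \<partial>(lebesgue :: 'a measure))"
    unfolding t_def
  proof (rule integral_dominated_convergence[OF _ _ g_int])
    show "AE x in lebesgue. (\<lambda>k. if real k < norm (rep_l2 g x) then (norm (rep_l2 g x))\<^sup>2 else 0) \<longlonglongrightarrow> 0"
    proof (rule AE_I2)
      fix x
      obtain N :: nat where "norm (rep_l2 g x) \<le> real N" using real_arch_simple by blast
      then have "\<forall>\<^sub>F k in sequentially. (if real k < norm (rep_l2 g x) then (norm (rep_l2 g x))\<^sup>2 else 0) = 0"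
        unfolding eventually_sequentially by (intro exI[of _ N]) auto
      then show "(\<lambda>k. if real k < norm (rep_l2 g x) then (norm (rep_l2 g x))\<^sup>2 else 0) \<longlonglongrightarrow> 0"
        by (rule tendsto_eventually)
    qed
  qed auto
  then have t_lim: "t \<longlonglongrightarrow> 0" by simp
  have est: "(norm (mul (A n) g - mul A0 g))\<^sup>2 \<le> (real k)\<^sup>2 * (norm (A n - A0))\<^sup>2 + amax\<^sup>2 * t k" for n k
  proof -
    have A_int: "integrable lebesgue (\<lambda>x. (norm (rep_l2 (A n) x - rep_l2 A0 x))\<^sup>2)"
      by (intro sqint_int sqint_diff sqint_rep)
    have "(norm (mul (A n) g - mul A0 g))\<^sup>2 = (\<integral>x. (norm (clamp (A n) x *\<^sub>R rep_l2 g x - clamp A0 x *\<^sub>R rep_l2 g x))\<^sup>2 \<partial>lebesgue)"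
      unfolding mul_def by (rule norm_diff_abs_l2[OF sqint_mul sqint_mul])
    also have "\<dots> \<le> (\<integral>x. (real k)\<^sup>2 * (norm (rep_l2 (A n) x - rep_l2 A0 x))\<^sup>2
        + amax\<^sup>2 * (if real k < norm (rep_l2 g x) then (norm (rep_l2 g x))\<^sup>2 else 0) \<partial>lebesgue)"
    proof (rule integral_mono)
      show "integrable lebesgue (\<lambda>x. (norm (clamp (A n) x *\<^sub>R rep_l2 g x - clamp A0 x *\<^sub>R rep_l2 g x))\<^sup>2)"
        by (intro sqint_int sqint_diff sqint_mul)
      show "integrable lebesgue (\<lambda>x. (real k)\<^sup>2 * (norm (rep_l2 (A n) x - rep_l2 A0 x))\<^sup>2
        + amax\<^sup>2 * (if real k < norm (rep_l2 g x) then (norm (rep_l2 g x))\<^sup>2 else 0))"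
        by (intro Bochner_Integration.integrable_add integrable_mult_right A_int t_int)
      fix x
      define c where "c = \<bar>clamp (A n) x - clamp A0 x\<bar>"
      have c: "0 \<le> c" "c \<le> \<bar>rep_l2 (A n) x - rep_l2 A0 x\<bar>" "c \<le> amax"
        using clamp_bounds[of "A n" x] clamp_bounds[of A0 x] clamp_lipschitz[of "A n" x A0]
        by (auto simp: c_def)
      have "(norm (clamp (A n) x *\<^sub>R rep_l2 g x - clamp A0 x *\<^sub>R rep_l2 g x))\<^sup>2 = c\<^sup>2 * (norm (rep_l2 g x))\<^sup>2"
        by (simp add: c_def power_mult_distrib flip: scaleR_diff_left)
      also have "\<dots> \<le> (real k)\<^sup>2 * (norm (rep_l2 (A n) x - rep_l2 A0 x))\<^sup>2
        + amax\<^sup>2 * (if real k < norm (rep_l2 g x) then (norm (rep_l2 g x))\<^sup>2 else 0)"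
      proof (cases "real k < norm (rep_l2 g x)")
        case True
        have "c\<^sup>2 * (norm (rep_l2 g x))\<^sup>2 \<le> amax\<^sup>2 * (norm (rep_l2 g x))\<^sup>2"
          using c by (intro mult_right_mono power_mono) auto
        moreover have "0 \<le> (real k)\<^sup>2 * (norm (rep_l2 (A n) x - rep_l2 A0 x))\<^sup>2" by simp
        ultimately show ?thesis unfolding if_P[OF True] by linarith
      next
        case False
        have "c\<^sup>2 * (norm (rep_l2 g x))\<^sup>2 \<le> (norm (rep_l2 (A n) x - rep_l2 A0 x))\<^sup>2 * (real k)\<^sup>2"
          using c False by (intro mult_mono power_mono) auto
        then show ?thesis using False by (simp add: mult.commute)
      qed
      finally show "(norm (clamp (A n) x *\<^sub>R rep_l2 g x - clamp A0 x *\<^sub>R rep_l2 g x))\<^sup>2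
          \<le> (real k)\<^sup>2 * (norm (rep_l2 (A n) x - rep_l2 A0 x))\<^sup>2
        + amax\<^sup>2 * (if real k < norm (rep_l2 g x) then (norm (rep_l2 g x))\<^sup>2 else 0)" .
    qed
    also have "\<dots> = (real k)\<^sup>2 * (norm (A n - A0))\<^sup>2 + amax\<^sup>2 * t k"
      unfolding norm_sq_l2 t_def using A_int t_int[of k] by (subst Bochner_Integration.integral_add) auto
    finally show ?thesis .
  qed
  have "(\<lambda>n. (norm (mul (A n) g - mul A0 g))\<^sup>2) \<longlonglongrightarrow> 0"
  proof (rule order_tendstoI)
    fix a :: real assume "a < 0"
    then show "\<forall>\<^sub>F n in sequentially. a < (norm (mul (A n) g - mul A0 g))\<^sup>2"
      by (intro always_eventually allI) (rule less_le_trans, auto)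
  next
    fix a :: real assume a: "0 < a"
    have "(\<lambda>k. amax\<^sup>2 * t k) \<longlonglongrightarrow> amax\<^sup>2 * 0" by (rule tendsto_mult_left[OF t_lim])
    then have "\<forall>\<^sub>F k in sequentially. amax\<^sup>2 * t k < a/2" using a by (intro order_tendstoD) auto
    then obtain k where k: "amax\<^sup>2 * t k < a/2" using eventually_happens'[OF sequentially_bot] by blast
    have "(\<lambda>n. norm (A n - A0)) \<longlonglongrightarrow> 0" using assms by (simp add: tendsto_norm_zero_iff LIM_zero_iff)
    then have "(\<lambda>n. (real k)\<^sup>2 * (norm (A n - A0))\<^sup>2) \<longlonglongrightarrow> (real k)\<^sup>2 * 0\<^sup>2"
      by (intro tendsto_mult_left tendsto_power)
    then have "\<forall>\<^sub>F n in sequentially. (real k)\<^sup>2 * (norm (A n - A0))\<^sup>2 < a/2"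
      using a by (intro order_tendstoD(2)) auto
    then show "\<forall>\<^sub>F n in sequentially. (norm (mul (A n) g - mul A0 g))\<^sup>2 < a"
    proof eventually_elim
      case (elim n)
      then show ?case using est[of n k] k by linarith
    qed
  qed
  then have "(\<lambda>n. sqrt ((norm (mul (A n) g - mul A0 g))\<^sup>2)) \<longlonglongrightarrow> sqrt 0" by (rule tendsto_real_sqrt)
  then show ?thesis by (simp add: tendsto_norm_zero_iff LIM_zero_iff)
qed

definition is_sol :: "('a, real) l2 \<Rightarrow> ('a, real) l2 \<Rightarrow> ('a, real) l2 \<times> ('a, 'a) l2 \<Rightarrow> bool" where
  "is_sol A f p \<longleftrightarrow> p \<in> H01 D \<and> (\<forall>q\<in>H01 D. mul A (snd p) \<bullet> snd q = f \<bullet> fst q)"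

definition sol :: "('a, real) l2 \<Rightarrow> ('a, real) l2 \<Rightarrow> ('a, real) l2 \<times> ('a, 'a) l2" where
  "sol A f = (SOME p. is_sol A f p)"

definition T :: "('a, real) l2 \<Rightarrow> ('a, real) l2 \<Rightarrow> ('a, real) l2" where
  "T A f = fst (sol A f)"

lemma Poincare: "p \<in> H01 D \<Longrightarrow> norm (fst p) \<le> 2 * R * norm (snd p)"
  by (rule H01_Poincare[OF D_open]) (use R in auto)

lemma is_sol_exists: "\<exists>p. is_sol A f p"
proof -
  define B where "B p q = mul A (snd p) \<bullet> snd q" for p q :: "('a, real) l2 \<times> ('a, 'a) l2"
  have bil: "bounded_bilinear B"
  proof
    fix p p' q q' :: "('a, real) l2 \<times> ('a, 'a) l2" and c :: real
    show "B (p + p') q = B p q + B p' q" by (simp add: B_def mul_add inner_add_left)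
    show "B p (q + q') = B p q + B p q'" by (simp add: B_def inner_add_right)
    show "B (c *\<^sub>R p) q = c *\<^sub>R B p q" by (simp add: B_def mul_scaleR)
    show "B p (c *\<^sub>R q) = c *\<^sub>R B p q" by (simp add: B_def)
    show "\<exists>K. \<forall>p q. norm (B p q) \<le> norm p * norm q * K"
    proof (intro exI allI)
      fix p q :: "('a, real) l2 \<times> ('a, 'a) l2"
      have "norm (B p q) \<le> norm (mul A (snd p)) * norm (snd q)"
        unfolding B_def real_norm_def by (rule Cauchy_Schwarz_ineq2)
      also have "\<dots> \<le> (amax * norm p) * norm q"
        using amin norm_snd_le[of "snd p" "fst p"] norm_snd_le[of "snd q" "fst q"]
        by (intro mult_mono order_trans[OF mul_bound] mult_left_mono) auto
      finally show "norm (B p q) \<le> norm p * norm q * amax" by (simp add: mult_ac)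
    qed
  qed
  have lin: "bounded_linear (\<lambda>q::('a, real) l2 \<times> ('a, 'a) l2. f \<bullet> fst q)"
    by (rule bounded_linear_compose[OF bounded_linear_inner_right bounded_linear_fst])
  \<comment> \<open>The form sees only the gradient component. On H01 the Poincare inequality bounds
    the full squared norm by \<open>(2 * R)\<^sup>2 + 1\<close> times that of the gradient, so
    coercivity is available there and not on the whole product space.\<close>
  define c where "c = amin / ((2 * R)\<^sup>2 + 1)"
  have c: "c > 0" unfolding c_def using amin by (intro divide_pos_pos) (auto intro: add_nonneg_pos)
  have coercive: "c * (norm (x - y))\<^sup>2 \<le> B (x - y) (x - y)" if "x \<in> H01 D" "y \<in> H01 D" for x y
  proof -
    define z where "z = x - y"
    have z: "z \<in> H01 D" unfolding z_def by (rule H01_diff[OF D_open that])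
    have "(norm z)\<^sup>2 = (norm (fst z))\<^sup>2 + (norm (snd z))\<^sup>2"
      by (simp add: norm_prod_def)
    also have "(norm (fst z))\<^sup>2 \<le> (2 * R * norm (snd z))\<^sup>2"
      by (intro power_mono Poincare[OF z]) simp
    finally have "(norm z)\<^sup>2 \<le> ((2 * R)\<^sup>2 + 1) * (norm (snd z))\<^sup>2"
      by (simp add: power_mult_distrib algebra_simps)
    then have "c * (norm z)\<^sup>2 \<le> c * (((2 * R)\<^sup>2 + 1) * (norm (snd z))\<^sup>2)"
      using c by (intro mult_left_mono) auto
    also have "\<dots> = amin * (norm (snd z))\<^sup>2"
    proof -
      have "(2 * R)\<^sup>2 + 1 \<noteq> 0" by (metis add_nonneg_pos less_irrefl zero_le_power2 zero_less_one)
      then show ?thesis by (simp add: c_def)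
    qed
    also have "\<dots> \<le> B z z" unfolding B_def by (rule mul_coercive)
    finally show ?thesis by (simp add: z_def)
  qed
  obtain p where p: "p \<in> H01 D" "\<And>v. v \<in> H01 D \<Longrightarrow> f \<bullet> fst (v - p) \<le> B p (v - p)"
  proof (rule variational_inequality_exists[OF bil _ lin H01_closed[OF D_open] H01_convex[OF D_open] _ c coercive])
    show "B x y = B y x" for x y by (simp add: B_def mul_sym)
    show "H01 D \<noteq> {}" using H01_zero[OF D_open] by auto
  qed auto
  \<comment> \<open>H01 is a subspace, so the variational inequality can be tested with
    \<open>p + q\<close> and with \<open>p - q\<close>; together they give equality.\<close>
  have "B p q = f \<bullet> fst q" if q: "q \<in> H01 D" for q
  proof -
    interpret B: bounded_bilinear B by fact
    have "f \<bullet> fst q \<le> B p q" using p(2)[OF H01_add[OF D_open p(1) q]] by simp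
    moreover have "f \<bullet> fst (- q) \<le> B p (- q)" using p(2)[OF H01_diff[OF D_open p(1) q]] by simp
    ultimately show ?thesis by (simp add: B.minus_right)
  qed
  then show ?thesis using p(1) unfolding is_sol_def B_def by blast
qed

lemma sol: "is_sol A f (sol A f)"
  unfolding sol_def by (rule someI_ex[OF is_sol_exists])

lemma sol_V: "sol A f \<in> H01 D" and sol_eq: "q \<in> H01 D \<Longrightarrow> mul A (snd (sol A f)) \<bullet> snd q = f \<bullet> fst q"
  using sol[of A f] by (auto simp: is_sol_def)

lemma H01_zeroI:
  assumes "p \<in> H01 D" "mul A (snd p) \<bullet> snd p \<le> 0"
  shows "p = 0"
proof -
  have "amin * (norm (snd p))\<^sup>2 \<le> 0" using mul_coercive[of "snd p" A] assms(2) by linarith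
  then have "snd p = 0" using amin by (simp add: mult_le_0_iff)
  moreover from this have "fst p = 0" using Poincare[OF assms(1)] by simp
  ultimately show ?thesis by (simp add: prod_eq_iff)
qed

lemma sol_eqI:
  assumes "is_sol A f p"
  shows "sol A f = p"
proof -
  have p: "p \<in> H01 D" "\<And>q. q \<in> H01 D \<Longrightarrow> mul A (snd p) \<bullet> snd q = f \<bullet> fst q"
    using assms by (auto simp: is_sol_def)
  define r where "r = sol A f - p"
  have r: "r \<in> H01 D" unfolding r_def by (rule H01_diff[OF D_open sol_V p(1)])
  have "snd (sol A f) = snd r + snd p" by (simp add: r_def)
  then have "mul A (snd r) \<bullet> snd r = mul A (snd (sol A f)) \<bullet> snd r - mul A (snd p) \<bullet> snd r"
    by (simp add: mul_add inner_add_left)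
  then have "mul A (snd r) \<bullet> snd r = 0" using sol_eq[OF r] p(2)[OF r] by simp
  then have "r = 0" using H01_zeroI[OF r, of A] by simp
  then show ?thesis by (simp add: r_def)
qed

lemma T_linear: "linear (T A)"
proof
  fix f g :: "('a, real) l2" and c :: real
  have "sol A (f + g) = sol A f + sol A g"
    by (rule sol_eqI)
      (auto simp: is_sol_def sol_V sol_eq H01_add[OF D_open] mul_add inner_add_left)
  then show "T A (f + g) = T A f + T A g" by (simp add: T_def)
  have "sol A (c *\<^sub>R f) = c *\<^sub>R sol A f"
    by (rule sol_eqI)
      (auto simp: is_sol_def sol_V sol_eq H01_scaleR[OF D_open] mul_scaleR)
  then show "T A (c *\<^sub>R f) = c *\<^sub>R T A f" by (simp add: T_def)
qed

text \<open>Each equation is tested with the solution of the other, and the form is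
  symmetric.\<close>

lemma T_sym: "T A f \<bullet> g = f \<bullet> T A g"
proof -
  have "T A f \<bullet> g = mul A (snd (sol A g)) \<bullet> snd (sol A f)"
    using sol_eq[OF sol_V, of A g A f] by (simp add: T_def inner_commute)
  also have "\<dots> = mul A (snd (sol A f)) \<bullet> snd (sol A g)" by (rule mul_sym)
  also have "\<dots> = f \<bullet> T A g"
    using sol_eq[OF sol_V, of A f A g] by (simp add: T_def)
  finally show ?thesis .
qed

text \<open>The estimate shared by boundedness and continuity of \<open>T\<close>: coercivity bounds
  the gradient by \<open>k / amin\<close>, and the Poincare inequality passes to the
  function.\<close>

lemma energy_bound:
  assumes r: "r \<in> H01 D" and k: "0 \<le> k" and le: "mul A (snd r) \<bullet> snd r \<le> k * norm (snd r)"
  shows "norm (fst r) \<le> 2 * R / amin * k"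
proof -
  have "norm (snd r) \<le> k / amin"
  proof (cases "snd r = 0")
    case True
    then show ?thesis using k amin by simp
  next
    case False
    have "amin * (norm (snd r))\<^sup>2 \<le> k * norm (snd r)" using mul_coercive[of "snd r" A] le by linarith
    then have "amin * norm (snd r) \<le> k" using False by (simp add: power2_eq_square mult_le_cancel_right flip: mult.assoc)
    then show ?thesis using amin by (simp add: pos_le_divide_eq mult.commute)
  qed
  then have "2 * R * norm (snd r) \<le> 2 * R * (k / amin)" using R(2) by (intro mult_left_mono) auto
  then show ?thesis using Poincare[OF r] by simp
qed

text \<open>The Poincare constant \<open>2 * R\<close> enters twice, once for the right-hand side
  and once on returning from the gradient to the function; hence
  \<open>4 * R\<^sup>2\<close>.\<close>

lemma T_bound: "norm (T A f) \<le> 4 * R\<^sup>2 / amin * norm f"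
proof -
  have "mul A (snd (sol A f)) \<bullet> snd (sol A f) = f \<bullet> fst (sol A f)" by (rule sol_eq[OF sol_V])
  also have "\<dots> \<le> norm f * norm (fst (sol A f))" by (rule norm_cauchy_schwarz)
  also have "\<dots> \<le> norm f * (2 * R * norm (snd (sol A f)))"
    by (intro mult_left_mono Poincare sol_V) simp
  finally have "mul A (snd (sol A f)) \<bullet> snd (sol A f) \<le> (2 * R * norm f) * norm (snd (sol A f))"
    by (simp add: mult_ac)
  from energy_bound[OF sol_V _ this] show ?thesis
    using R(2) by (simp add: T_def power2_eq_square mult_ac)
qed

text \<open>The difference of the two solutions satisfies the equation with coefficient
  \<open>A n\<close> and two residuals: \<open>f n - f0\<close>, and the change of coefficient
  applied to the fixed gradient \<open>g\<close>. Because \<open>g\<close> does not vary with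
  \<open>n\<close>, pointwise continuity of \<open>mul\<close> suffices.\<close>

lemma T_continuous_seq:
  assumes A: "A \<longlonglongrightarrow> A0" and f: "f \<longlonglongrightarrow> f0"
  shows "(\<lambda>n. T (A n) (f n)) \<longlonglongrightarrow> T A0 f0"
proof -
  define g where "g = snd (sol A0 f0)"
  define k where "k n = norm (f n - f0) * (2 * R) + norm (mul A0 g - mul (A n) g)" for n
  have bound: "norm (T (A n) (f n) - T A0 f0) \<le> 2 * R / amin * k n" for n
  proof -
    define r where "r = sol (A n) (f n) - sol A0 f0"
    have r: "r \<in> H01 D" unfolding r_def by (rule H01_diff[OF D_open sol_V sol_V])
    have split: "snd (sol (A n) (f n)) = snd r + g" by (simp add: r_def g_def)
    have "mul (A n) (snd r) \<bullet> snd r = mul (A n) (snd (sol (A n) (f n))) \<bullet> snd r - mul (A n) g \<bullet> snd r"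
      unfolding split by (simp add: mul_add inner_add_left)
    also have "\<dots> = f n \<bullet> fst r - f0 \<bullet> fst r + (mul A0 g \<bullet> snd r - mul (A n) g \<bullet> snd r)"
      using sol_eq[OF r, of "A n" "f n"] sol_eq[OF r, of A0 f0] by (simp add: g_def)
    also have "\<dots> = (f n - f0) \<bullet> fst r + (mul A0 g - mul (A n) g) \<bullet> snd r"
      by (simp add: inner_diff_left)
    also have "\<dots> \<le> norm (f n - f0) * (2 * R * norm (snd r)) + norm (mul A0 g - mul (A n) g) * norm (snd r)"
      by (intro add_mono order_trans[OF norm_cauchy_schwarz mult_left_mono[OF Poincare[OF r]]] norm_cauchy_schwarz) simp
    finally have "mul (A n) (snd r) \<bullet> snd r \<le> k n * norm (snd r)"
      by (simp add: k_def algebra_simps)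
    moreover have "0 \<le> k n" using R(2) by (simp add: k_def)
    ultimately have "norm (fst r) \<le> 2 * R / amin * k n" using energy_bound[OF r] by blast
    then show ?thesis by (simp add: r_def T_def)
  qed
  have lim: "(\<lambda>n. 2 * R / amin * k n) \<longlonglongrightarrow> 0"
  proof -
    have "(\<lambda>n. norm (f n - f0)) \<longlonglongrightarrow> 0"
      using f by (simp add: tendsto_norm_zero_iff LIM_zero_iff)
    moreover have "(\<lambda>n. norm (mul A0 g - mul (A n) g)) \<longlonglongrightarrow> norm (mul A0 g - mul A0 g)"
      by (intro tendsto_norm tendsto_diff tendsto_const mul_continuous A)
    ultimately have "(\<lambda>n. 2 * R / amin * k n) \<longlonglongrightarrow> 2 * R / amin * (0 * (2 * R) + norm (mul A0 g - mul A0 g))"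
      unfolding k_def by (intro tendsto_mult tendsto_add tendsto_const)
    then show ?thesis by simp
  qed
  have "(\<lambda>n. T (A n) (f n) - T A0 f0) \<longlonglongrightarrow> 0"
    by (rule Lim_null_comparison[OF always_eventually[OF allI[OF bound]] lim])
  then show ?thesis by (simp add: LIM_zero_iff)
qed

lemma T_continuous: "continuous_on UNIV (\<lambda>p. T (fst p) (snd p))"
  unfolding continuous_on_sequentially comp_def
  using T_continuous_seq tendsto_fst tendsto_snd by blast

text \<open>On \<open>D\<close> the bounds make clamping inactive. Outside \<open>D\<close> the
  clamped coefficient equals \<open>amin\<close>, but the extended factors vanish there.\<close>

lemma weighted_inner_eq:
  assumes \<alpha>: "sqint_on D \<alpha>" "\<And>x. x \<in> D \<Longrightarrow> amin \<le> \<alpha> x \<and> \<alpha> x \<le> amax"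
    and g: "sqint_on D g" and h: "sqint_on D h"
  shows "integral\<^sup>L (lebesgue_on D) (\<lambda>x. \<alpha> x * (g x \<bullet> h x)) = mul (l2_of D \<alpha>) (l2_of D g) \<bullet> l2_of D h"
  unfolding integral_lebesgue_on[OF D_open] mul_inner
proof (rule integral_cong_AE)
  note [measurable] = sqint_meas[OF sqint_rep]
  have meas: "zero_ext D \<alpha> \<in> borel_measurable lebesgue" "zero_ext D g \<in> borel_measurable lebesgue" "zero_ext D h \<in> borel_measurable lebesgue"
    using \<alpha> g h by (auto simp: sqint_on_def sqint_def)
  have "zero_ext D (\<lambda>x. \<alpha> x * (g x \<bullet> h x)) = (\<lambda>x. zero_ext D \<alpha> x * (zero_ext D g x \<bullet> zero_ext D h x))"
    by (auto simp: zero_ext_def)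
  then show "zero_ext D (\<lambda>x. \<alpha> x * (g x \<bullet> h x)) \<in> borel_measurable lebesgue"
    using meas by simp
  show "(\<lambda>x. clamp (l2_of D \<alpha>) x * (rep_l2 (l2_of D g) x \<bullet> rep_l2 (l2_of D h) x)) \<in> borel_measurable lebesgue"
    by measurable
  show "AE x in lebesgue. zero_ext D (\<lambda>x. \<alpha> x * (g x \<bullet> h x)) x = clamp (l2_of D \<alpha>) x * (rep_l2 (l2_of D g) x \<bullet> rep_l2 (l2_of D h) x)"
    using rep_l2_of[OF D_open \<alpha>(1)] rep_l2_of[OF D_open g] rep_l2_of[OF D_open h]
  proof eventually_elim
    case (elim x)
    then show ?case using \<alpha>(2)[of x] by (auto simp: clamp_def zero_ext_def)
  qed
qed

text \<open>Elements of H01 vanish outside \<open>D\<close>, so their representatives are valid test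
  pairs and \<open>l2_of\<close> returns the original classes. Both directions then compare the weak
  equation with \<open>is_sol\<close>, whose solution is unique.\<close>

lemma weak_sol_iff:
  assumes \<alpha>: "sqint_on D \<alpha>" "\<And>x. x \<in> D \<Longrightarrow> amin \<le> \<alpha> x \<and> \<alpha> x \<le> amax" and f: "sqint_on D f"
  shows "weak_sol D \<alpha> f y \<longleftrightarrow> sqint_on D y \<and> l2_of D y = T (l2_of D \<alpha>) (l2_of D f)"
proof
  assume "weak_sol D \<alpha> f y"
  then obtain g where g: "H01_grad D y g"
    and eq: "\<And>v gv. H01_grad D v gv \<Longrightarrow> integral\<^sup>L (lebesgue_on D) (\<lambda>x. \<alpha> x * (g x \<bullet> gv x)) = integral\<^sup>L (lebesgue_on D) (\<lambda>x. f x * v x)"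
    unfolding weak_sol_def by blast
  have yg: "sqint_on D y" "sqint_on D g" "(l2_of D y, l2_of D g) \<in> H01 D"
    using g by (auto simp: H01_grad_iff[OF D_open])
  have "is_sol (l2_of D \<alpha>) (l2_of D f) (l2_of D y, l2_of D g)"
    unfolding is_sol_def
  proof (intro conjI ballI)
    fix q assume q: "q \<in> H01 D"
    define v gv where "v = rep_l2 (fst q)" and "gv = rep_l2 (snd q)"
    have sq: "sqint_on D v" "sqint_on D gv"
      unfolding v_def gv_def by (rule sqint_on_rep[OF D_open])+
    have cls: "l2_of D v = fst q" "l2_of D gv = snd q"
      using H01_restrict[OF D_open q] by (simp_all add: v_def gv_def l2_restrict_def[OF D_open])
    then have "H01_grad D v gv" using sq q by (simp add: H01_grad_iff[OF D_open])
    from eq[OF this] show "mul (l2_of D \<alpha>) (snd (l2_of D y, l2_of D g)) \<bullet> snd q = l2_of D f \<bullet> fst q"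
      using weighted_inner_eq[OF \<alpha> yg(2) sq(2)] integral_inner_eq[OF D_open f sq(1)] cls by simp
  qed (rule yg)
  then show "sqint_on D y \<and> l2_of D y = T (l2_of D \<alpha>) (l2_of D f)"
    using sol_eqI yg(1) by (simp add: T_def)
next
  assume y: "sqint_on D y \<and> l2_of D y = T (l2_of D \<alpha>) (l2_of D f)"
  define p where "p = sol (l2_of D \<alpha>) (l2_of D f)"
  define g where "g = rep_l2 (snd p)"
  have sq: "sqint_on D g" unfolding g_def by (rule sqint_on_rep[OF D_open])
  have cls: "l2_of D y = fst p" "l2_of D g = snd p"
    using y H01_restrict[OF D_open sol_V] by (simp_all add: T_def p_def g_def l2_restrict_def[OF D_open])
  have "H01_grad D y g"
    using y sq cls sol_V[of "l2_of D \<alpha>" "l2_of D f"] by (simp add: H01_grad_iff[OF D_open] p_def T_def)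
  moreover have "integral\<^sup>L (lebesgue_on D) (\<lambda>x. \<alpha> x * (g x \<bullet> gv x)) = integral\<^sup>L (lebesgue_on D) (\<lambda>x. f x * v x)"
    if "H01_grad D v gv" for v gv
  proof -
    have v: "sqint_on D v" "sqint_on D gv" "(l2_of D v, l2_of D gv) \<in> H01 D"
      using that by (auto simp: H01_grad_iff[OF D_open])
    show ?thesis
      using sol_eq[OF v(3), of "l2_of D \<alpha>" "l2_of D f"] weighted_inner_eq[OF \<alpha> sq v(2)]
        integral_inner_eq[OF D_open f v(1)] cls by (simp add: p_def)
  qed
  ultimately show "weak_sol D \<alpha> f y" unfolding weak_sol_def by blast
qed

end


subsection \<open>Random coefficients and box constraints\<close>

text \<open>An open set is a countable union of balls with centres in a countable dense set and
  radii \<open>inverse (real (Suc n))\<close>, and the preimage of a ball is a sublevel set of a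
  distance.\<close>

lemma borel_measurable_if_dist_measurable:
  fixes F :: "'m \<Rightarrow> 'c::{metric_space, second_countable_topology}"
  assumes F: "\<And>c. (\<lambda>\<omega>. dist (F \<omega>) c) \<in> borel_measurable M"
  shows "F \<in> borel_measurable M"
proof (rule borel_measurableI)
  fix U :: "'c set" assume U: "open U"
  obtain Q :: "'c set" where Q: "countable Q" "\<And>X. open X \<Longrightarrow> X \<noteq> {} \<Longrightarrow> \<exists>q\<in>Q. q \<in> X"
    using countable_dense_setE by blast
  define I where "I = {(q, n). q \<in> Q \<and> ball q (inverse (real (Suc n))) \<subseteq> U}"
  have "I \<subseteq> Q \<times> UNIV" by (auto simp: I_def)
  then have I: "countable I" using Q(1) by (meson countable_SIGMA countableI_type countable_subset)
  have "F -` U \<inter> space M = (\<Union>i\<in>I. {\<omega> \<in> space M. dist (F \<omega>) (fst i) < inverse (real (Suc (snd i)))})"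
  proof (intro equalityI subsetI)
    fix \<omega> assume "\<omega> \<in> F -` U \<inter> space M"
    then have \<omega>: "F \<omega> \<in> U" "\<omega> \<in> space M" by auto
    obtain e where e: "e > 0" "ball (F \<omega>) e \<subseteq> U" using U \<omega>(1) open_contains_ball by blast
    obtain n where n: "inverse (real (Suc n)) < e/2" using reals_Archimedean[of "e/2"] e by auto
    obtain q where q: "q \<in> Q" "q \<in> ball (F \<omega>) (inverse (real (Suc n)))"
      using Q(2)[of "ball (F \<omega>) (inverse (real (Suc n)))"] by auto
    have "ball q (inverse (real (Suc n))) \<subseteq> ball (F \<omega>) e"
    proof
      fix z assume "z \<in> ball q (inverse (real (Suc n)))"
      then show "z \<in> ball (F \<omega>) e"
        using q(2) n dist_triangle[of "F \<omega>" z q] unfolding mem_ball by linarith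
    qed
    then have "(q, n) \<in> I" using q e by (auto simp: I_def)
    moreover have "dist (F \<omega>) q < inverse (real (Suc n))" using q(2) by simp
    ultimately show "\<omega> \<in> (\<Union>i\<in>I. {\<omega> \<in> space M. dist (F \<omega>) (fst i) < inverse (real (Suc (snd i)))})"
      using \<omega>(2) by (intro UN_I[of "(q, n)"]) auto
  next
    fix \<omega> assume "\<omega> \<in> (\<Union>i\<in>I. {\<omega> \<in> space M. dist (F \<omega>) (fst i) < inverse (real (Suc (snd i)))})"
    then obtain q n where "(q, n) \<in> I" "\<omega> \<in> space M" "dist (F \<omega>) q < inverse (real (Suc n))" by auto
    then show "\<omega> \<in> F -` U \<inter> space M" by (auto simp: I_def dist_commute)
  qed
  also have "\<dots> \<in> sets M"
  proof (rule sets.countable_UN''[OF I])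
    fix i
    show "{\<omega> \<in> space M. dist (F \<omega>) (fst i) < inverse (real (Suc (snd i)))} \<in> sets M"
      using F[of "fst i"] by measurable
  qed
  finally show "F -` U \<inter> space M \<in> sets M" .
qed

lemma sqint_on_bounded:
  fixes f :: "'a::euclidean_space \<Rightarrow> real"
  assumes D: "open D" "bounded D" and f: "f \<in> borel_measurable borel" and c: "\<And>x. x \<in> D \<Longrightarrow> \<bar>f x\<bar> \<le> c"
  shows "sqint_on D f"
  unfolding sqint_on_def
proof (rule sqint_dominated)
  show "integrable lebesgue (\<lambda>x. c\<^sup>2 * indicator D x)"
    using emeasure_bounded_finite[OF D(2)] D(1)
    by (intro integrable_mult_right integrable_real_indicator) (auto simp: D_sets)
  have [measurable]: "D \<in> sets borel" using D(1) by simp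
  have "zero_ext D f \<in> borel_measurable lborel"
    unfolding zero_ext_def[abs_def] using f by measurable
  then show "zero_ext D f \<in> borel_measurable lebesgue" by (rule measurable_completion)
  fix x
  show "(norm (zero_ext D f x))\<^sup>2 \<le> c\<^sup>2 * indicator D x"
    using power_mono[OF c[of x] abs_ge_zero, of 2] by (auto simp: zero_ext_def)
qed

text \<open>The random coefficient as a random element of L2. Its distance to a fixed class is the
  root of a parameter integral, which is measurable in the parameter by joint measurability of the
  integrand.\<close>

lemma l2_of_measurable:
  fixes a :: "'a::euclidean_space \<Rightarrow> 'w \<Rightarrow> real"
  assumes D: "open D" "bounded D"
    and a_meas: "(\<lambda>(x, \<omega>). a x \<omega>) \<in> borel_measurable (lborel \<Otimes>\<^sub>M M)"
    and c: "\<And>x \<omega>. x \<in> D \<Longrightarrow> \<omega> \<in> space M \<Longrightarrow> \<bar>a x \<omega>\<bar> \<le> c"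
  shows "\<omega> \<in> space M \<Longrightarrow> sqint_on D (\<lambda>x. a x \<omega>)"
    and "(\<lambda>\<omega>. l2_of D (\<lambda>x. a x \<omega>)) \<in> borel_measurable M"
proof -
  have sq: "sqint_on D (\<lambda>x. a x \<omega>)" if \<omega>: "\<omega> \<in> space M" for \<omega>
  proof (rule sqint_on_bounded[OF D])
    have "(\<lambda>x. (x, \<omega>)) \<in> measurable lborel (lborel \<Otimes>\<^sub>M M)" using \<omega> by measurable
    from measurable_compose[OF this a_meas] show "(\<lambda>x. a x \<omega>) \<in> borel_measurable borel" by simp
  qed (use c \<omega> in auto)
  then show "\<omega> \<in> space M \<Longrightarrow> sqint_on D (\<lambda>x. a x \<omega>)" .
  show "(\<lambda>\<omega>. l2_of D (\<lambda>x. a x \<omega>)) \<in> borel_measurable M"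
  proof (rule borel_measurable_if_dist_measurable)
    fix h :: "('a, real) l2"
    \<comment> \<open>Joint measurability of \<open>a\<close> refers to Borel sets, so the Lebesgue
      measurable representative of \<open>h\<close> is replaced by a Borel version.\<close>
    obtain \<rho> where \<rho>: "\<rho> \<in> borel_measurable lborel" "AE x in lborel. rep_l2 h x = \<rho> x"
      using completion_ex_borel_measurable_real[OF sqint_meas[OF sqint_rep], of h] by blast
    have D_meas: "D \<in> sets borel" using D(1) by simp
    have swap: "(\<lambda>(\<omega>, x). a x \<omega>) \<in> borel_measurable (M \<Otimes>\<^sub>M lborel)"
    proof -
      have "(\<lambda>p. (snd p, fst p)) \<in> measurable (M \<Otimes>\<^sub>M lborel) (lborel \<Otimes>\<^sub>M M)" by measurable
      from measurable_compose[OF this a_meas] show ?thesis by (simp add: split_beta)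
    qed
    have joint: "(\<lambda>(\<omega>, x). (indicator D x * a x \<omega> - \<rho> x)\<^sup>2) \<in> borel_measurable (M \<Otimes>\<^sub>M lborel)"
    proof -
      have "(\<lambda>p. (indicator D (snd p) * (case p of (\<omega>, x) \<Rightarrow> a x \<omega>) - \<rho> (snd p))\<^sup>2) \<in> borel_measurable (M \<Otimes>\<^sub>M lborel)"
        using swap D_meas \<rho>(1) by measurable
      then show ?thesis by (simp add: split_beta)
    qed
    have "(\<lambda>\<omega>. sqrt (\<integral>x. (indicator D x * a x \<omega> - \<rho> x)\<^sup>2 \<partial>lborel)) \<in> borel_measurable M"
    proof -
      have "(\<lambda>\<omega>. \<integral>x. (indicator D x * a x \<omega> - \<rho> x)\<^sup>2 \<partial>lborel) \<in> borel_measurable M"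
        by (rule lborel.borel_measurable_lebesgue_integral[OF joint])
      then show ?thesis by measurable
    qed
    also have "?this \<longleftrightarrow> (\<lambda>\<omega>. dist (l2_of D (\<lambda>x. a x \<omega>)) h) \<in> borel_measurable M"
    proof (rule measurable_cong)
      fix \<omega> assume \<omega>: "\<omega> \<in> space M"
      have s: "sqint (zero_ext D (\<lambda>x. a x \<omega>))" using sq[OF \<omega>] by (simp add: sqint_on_def)
      have a_\<omega>: "(\<lambda>x. a x \<omega>) \<in> borel_measurable borel"
      proof -
        have "(\<lambda>x. (x, \<omega>)) \<in> measurable lborel (lborel \<Otimes>\<^sub>M M)" using \<omega> by measurable
        from measurable_compose[OF this a_meas] show ?thesis by simp
      qed
      have meas: "(\<lambda>x. (indicator D x * a x \<omega> - \<rho> x)\<^sup>2) \<in> borel_measurable lborel"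
        using a_\<omega> \<rho>(1) D_meas by simp
      have "(dist (l2_of D (\<lambda>x. a x \<omega>)) h)\<^sup>2 = (\<integral>x. (norm (zero_ext D (\<lambda>x. a x \<omega>) x - rep_l2 h x))\<^sup>2 \<partial>lebesgue)"
        using norm_diff_abs_l2[OF s sqint_rep, of h] by (simp add: dist_norm l2_of_def abs_rep_l2)
      also have "\<dots> = (\<integral>x. (indicator D x * a x \<omega> - \<rho> x)\<^sup>2 \<partial>lebesgue)"
      proof (rule integral_cong_AE)
        show "(\<lambda>x. (norm (zero_ext D (\<lambda>x. a x \<omega>) x - rep_l2 h x))\<^sup>2) \<in> borel_measurable lebesgue"
          using sqint_meas[OF s] sqint_meas[OF sqint_rep, of h] by measurable
        show "(\<lambda>x. (indicator D x * a x \<omega> - \<rho> x)\<^sup>2) \<in> borel_measurable lebesgue"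
          using meas by (rule measurable_completion)
        show "AE x in lebesgue. (norm (zero_ext D (\<lambda>x. a x \<omega>) x - rep_l2 h x))\<^sup>2 = (indicator D x * a x \<omega> - \<rho> x)\<^sup>2"
          using AE_completion[OF \<rho>(2)] by eventually_elim (auto simp: zero_ext_def)
      qed
      also have "\<dots> = (\<integral>x. (indicator D x * a x \<omega> - \<rho> x)\<^sup>2 \<partial>lborel)"
        by (rule integral_completion[OF meas])
      finally have "sqrt (\<integral>x. (indicator D x * a x \<omega> - \<rho> x)\<^sup>2 \<partial>lborel) = sqrt ((dist (l2_of D (\<lambda>x. a x \<omega>)) h)\<^sup>2)"
        by simp
      then show "sqrt (\<integral>x. (indicator D x * a x \<omega> - \<rho> x)\<^sup>2 \<partial>lborel) = dist (l2_of D (\<lambda>x. a x \<omega>)) h"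
        by simp
    qed
    finally show "(\<lambda>\<omega>. dist (l2_of D (\<lambda>x. a x \<omega>)) h) \<in> borel_measurable M" .
  qed
qed

section \<open>The admissible set as a set of classes\<close>

context
  fixes D :: "'a::euclidean_space set" and ua ub :: "'a \<Rightarrow> real"
  assumes D: "open D" and ua: "ua \<in> L2 D" and ub: "ub \<in> L2 D"
    and uab: "AE x in lebesgue_on D. ua x \<le> ub x"
begin

lemma AE_lebesgue_on: "(AE x in lebesgue_on D. Q x) \<longleftrightarrow> (AE x in lebesgue. x \<in> D \<longrightarrow> Q x)"
  using D_sets[OF D] by (subst AE_restrict_space_iff) auto

lemma Uad_iff: "u \<in> Uad D ua ub \<longleftrightarrow> sqint_on D u \<and> (AE x in lebesgue. x \<in> D \<longrightarrow> ua x \<le> u x \<and> u x \<le> ub x)"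
  by (simp only: Uad_def mem_Collect_eq L2_iff[OF D] AE_lebesgue_on)

lemma Uad_nonempty: "l2_of D ` Uad D ua ub \<noteq> {}"
proof -
  have "ua \<in> Uad D ua ub"
    using ua uab unfolding Uad_iff L2_iff[OF D] AE_lebesgue_on by auto
  then show ?thesis by blast
qed

lemma Uad_convex: "convex (l2_of D ` Uad D ua ub)"
  unfolding convex_alt
proof (intro ballI allI impI)
  fix h k t assume hk: "h \<in> l2_of D ` Uad D ua ub" "k \<in> l2_of D ` Uad D ua ub" and t: "0 \<le> t \<and> (t::real) \<le> 1"
  then obtain u v where uv: "h = l2_of D u" "u \<in> Uad D ua ub" "k = l2_of D v" "v \<in> Uad D ua ub" by auto
  define w where "w x = (1 - t) *\<^sub>R u x + t *\<^sub>R v x" for x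
  have sq: "sqint_on D u" "sqint_on D v" using uv by (auto simp: Uad_iff)
  have "sqint_on D w" unfolding w_def by (intro sqint_on_add sqint_on_scaleR sq)
  moreover have "AE x in lebesgue. x \<in> D \<longrightarrow> ua x \<le> w x \<and> w x \<le> ub x"
  proof -
    have "AE x in lebesgue. x \<in> D \<longrightarrow> ua x \<le> u x \<and> u x \<le> ub x" "AE x in lebesgue. x \<in> D \<longrightarrow> ua x \<le> v x \<and> v x \<le> ub x"
      using uv by (auto simp: Uad_iff)
    then show ?thesis
    proof eventually_elim
      case (elim x)
      show ?case
      proof
        assume "x \<in> D"
        then have "u x \<in> {ua x..ub x}" "v x \<in> {ua x..ub x}" using elim by auto
        from convexD_alt[OF convex_real_interval(5) this, of t] t
        show "ua x \<le> w x \<and> w x \<le> ub x" by (simp add: w_def)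
      qed
    qed
  qed
  ultimately have "w \<in> Uad D ua ub" by (simp add: Uad_iff)
  moreover have "l2_of D w = (1 - t) *\<^sub>R h + t *\<^sub>R k"
    unfolding w_def uv by (simp only: l2_of_add l2_of_scaleR sqint_on_scaleR sq)
  ultimately show "(1 - t) *\<^sub>R h + t *\<^sub>R k \<in> l2_of D ` Uad D ua ub" by (metis imageI)
qed

lemma Uad_bounded: "bounded (l2_of D ` Uad D ua ub)"
proof -
  define g where "g x = \<bar>zero_ext D ua x\<bar> + \<bar>zero_ext D ub x\<bar>" for x
  have "sqint (\<lambda>x. \<bar>zero_ext D ua x\<bar>)" "sqint (\<lambda>x. \<bar>zero_ext D ub x\<bar>)"
    using ua ub by (auto simp: L2_iff[OF D] sqint_on_def sqint_def)
  then have g: "sqint g" unfolding g_def by (rule sqint_add)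
  have "norm (l2_of D u) \<le> 1 * norm (abs_l2 g)" if "u \<in> Uad D ua ub" for u
    unfolding l2_of_def
  proof (rule norm_abs_l2_mono[OF _ g])
    have u: "sqint_on D u" "AE x in lebesgue. x \<in> D \<longrightarrow> ua x \<le> u x \<and> u x \<le> ub x"
      using that by (auto simp: Uad_iff)
    show "sqint (zero_ext D u)" using u by (simp add: sqint_on_def)
    show "AE x in lebesgue. norm (zero_ext D u x) \<le> 1 * norm (g x)"
      using u(2) by eventually_elim (auto simp: g_def zero_ext_def)
  qed simp
  then show ?thesis unfolding bounded_iff by auto
qed

text \<open>A subsequence of an L2-convergent sequence converges almost everywhere, and the
  pointwise bounds pass to its limit. The limit class must also come from a function on
  \<open>D\<close>, by closedness of the fixed points of \<open>l2_restrict\<close>.\<close>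

lemma Uad_closed: "closed (l2_of D ` Uad D ua ub)"
  unfolding closed_sequential_limits
proof (intro allI impI)
  fix h and l :: "('a, real) l2"
  assume "(\<forall>n. h n \<in> l2_of D ` Uad D ua ub) \<and> h \<longlonglongrightarrow> l"
  then have h: "\<And>n. h n \<in> l2_of D ` Uad D ua ub" and lim: "h \<longlonglongrightarrow> l" by auto
  have "\<exists>v. v \<in> Uad D ua ub \<and> h n = l2_of D v" for n using h[of n] by auto
  then obtain u where u: "\<And>n. u n \<in> Uad D ua ub" "\<And>n. h n = l2_of D (u n)" by metis
  have sq: "sqint_on D (u n)" and bd: "AE x in lebesgue. x \<in> D \<longrightarrow> ua x \<le> u n x \<and> u n x \<le> ub x" for n
    using u(1)[of n] by (auto simp: Uad_iff)
  have "h n \<in> {k. l2_restrict D k = k}" for n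
    using l2_restrict_l2_of[OF D sq] by (simp add: u(2))
  then have "l \<in> {k. l2_restrict D k = k}"
    using closed_sequentially[OF closed_l2_restrict_fixed[OF D] _ lim] by blast
  then have l: "l2_of D (rep_l2 l) = l" by (simp add: l2_restrict_def[OF D])
  define d where "d n x = (norm (rep_l2 (h n) x - rep_l2 l x))\<^sup>2" for n x
  have d_int: "integrable lebesgue (d n)" for n
    unfolding d_def by (intro sqint_int sqint_diff sqint_rep)
  have "(\<lambda>n. norm (h n - l)) \<longlonglongrightarrow> 0" using lim by (simp add: tendsto_norm_zero_iff LIM_zero_iff)
  then have "(\<lambda>n. (norm (h n - l))\<^sup>2) \<longlonglongrightarrow> 0\<^sup>2" by (rule tendsto_power)
  then have "(\<lambda>n. \<integral>x. norm (d n x) \<partial>lebesgue) \<longlonglongrightarrow> 0"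
    by (simp add: norm_sq_l2 d_def)
  then obtain r where r: "strict_mono r" "AE x in lebesgue. (\<lambda>n. d (r n) x) \<longlonglongrightarrow> 0"
    using tendsto_L1_AE_subseq[of lebesgue d, OF d_int] by blast
  have "AE x in lebesgue. \<forall>n. rep_l2 (h n) x = zero_ext D (u n) x"
    unfolding AE_all_countable u(2) using rep_l2_of[OF D sq] by blast
  moreover have "AE x in lebesgue. \<forall>n. x \<in> D \<longrightarrow> ua x \<le> u n x \<and> u n x \<le> ub x"
    unfolding AE_all_countable using bd by blast
  ultimately have "AE x in lebesgue. x \<in> D \<longrightarrow> ua x \<le> rep_l2 l x \<and> rep_l2 l x \<le> ub x"
    using r(2)
  proof eventually_elim
    case (elim x)
    show ?case
    proof
      assume x: "x \<in> D"
      have "(\<lambda>n. sqrt (d (r n) x)) \<longlonglongrightarrow> sqrt 0" by (rule tendsto_real_sqrt) (rule elim(3))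
      then have "(\<lambda>n. norm (rep_l2 (h (r n)) x - rep_l2 l x)) \<longlonglongrightarrow> 0" by (simp add: d_def)
      then have lim_x: "(\<lambda>n. rep_l2 (h (r n)) x) \<longlonglongrightarrow> rep_l2 l x"
        by (simp only: tendsto_norm_zero_iff LIM_zero_iff)
      have mem: "rep_l2 (h (r n)) x \<in> {ua x..ub x}" for n
        using elim(1,2) x by (simp add: zero_ext_def)
      have "rep_l2 l x \<in> {ua x..ub x}"
        by (rule closed_sequentially[OF closed_atLeastAtMost mem lim_x])
      then show "ua x \<le> rep_l2 l x \<and> rep_l2 l x \<le> ub x" by simp
    qed
  qed
  then have "rep_l2 l \<in> Uad D ua ub" using sqint_on_rep[OF D] by (simp add: Uad_iff)
  then show "l \<in> l2_of D ` Uad D ua ub" using l by (metis imageI)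
qed

end

section \<open>Transfer to the control problem\<close>

lemma adj_sol_eq_weak_sol: "adj_sol D A f p \<longleftrightarrow> weak_sol D A f p"
  by (simp add: adj_sol_def weak_sol_def inner_commute)

theorem theorem4p5:
  fixes D :: "'a::euclidean_space set"
    and M :: "'w measure" and a :: "'a \<Rightarrow> 'w \<Rightarrow> real" and amin amax :: real
    and yD ua ub u0 :: "'a \<Rightarrow> real" and lam :: real
    and P :: "'s measure" and \<xi> :: "nat \<Rightarrow> 's \<Rightarrow> 'w"
    and \<tau> :: "nat \<Rightarrow> real"
    and u y p :: "nat \<Rightarrow> 's \<Rightarrow> 'a \<Rightarrow> real"
  assumes dim: "DIM('a) = 2 \<or> DIM('a) = 3"
    and dom: "lipschitz_domain D"
    and probM: "prob_space M"
    and a_meas: "(\<lambda>(x, \<omega>). a x \<omega>) \<in> borel_measurable (lborel \<Otimes>\<^sub>M M)"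
    and a_bnds: "0 < amin" "amin < amax"
    and a_bounds: "\<And>x \<omega>. x \<in> D \<Longrightarrow> \<omega> \<in> space M \<Longrightarrow> amin < a x \<omega> \<and> a x \<omega> < amax"
    and yD: "yD \<in> L2 D"
    and lam: "lam \<ge> 0"
    and ua: "ua \<in> L2 D" and ub: "ub \<in> L2 D"
    and uab: "AE x in lebesgue_on D. ua x \<le> ub x"
    and probP: "prob_space P"
    and \<xi>_meas: "\<And>n. \<xi> n \<in> measurable P M"
    and \<xi>_distr: "\<And>n. distr P M (\<xi> n) = M"
    and \<xi>_indep: "prob_space.indep_vars P (\<lambda>_. M) \<xi> UNIV"
    and \<tau>_pos: "\<And>n. \<tau> n > 0"
    and \<tau>_sum: "\<not> summable \<tau>"
    and \<tau>_sq: "summable (\<lambda>n. (\<tau> n)\<^sup>2)"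
    and u0: "u0 \<in> L2 D"
    and u_init: "\<And>s. s \<in> space P \<Longrightarrow> u 0 s = u0"
    and y_eq: "\<And>n s. s \<in> space P \<Longrightarrow> weak_sol D (\<lambda>x. a x (\<xi> n s)) (u n s) (y n s)"
    and p_eq: "\<And>n s. s \<in> space P \<Longrightarrow>
                 adj_sol D (\<lambda>x. a x (\<xi> n s)) (\<lambda>x. yD x - y n s x) (p n s)"
    and u_step: "\<And>n s. s \<in> space P \<Longrightarrow>
        u (Suc n) s \<in> Uad D ua ub \<and>
        (\<forall>w\<in>Uad D ua ub.
           L2_norm D (\<lambda>x. u n s x - \<tau> n * (lam * u n s x - p n s x) - u (Suc n) s x)
           \<le> L2_norm D (\<lambda>x. u n s x - \<tau> n * (lam * u n s x - p n s x) - w x))"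
  shows "(lam \<noteq> 0 \<longrightarrow>
            (\<exists>ubar \<in> Uad D ua ub.
               (\<forall>w\<in>Uad D ua ub. jfun D M a yD lam ubar \<le> jfun D M a yD lam w) \<and>
               (\<forall>v\<in>Uad D ua ub. (\<forall>w\<in>Uad D ua ub. jfun D M a yD lam v \<le> jfun D M a yD lam w)
                    \<longrightarrow> L2_norm D (\<lambda>x. v x - ubar x) = 0) \<and>
               (AE s in P. (\<lambda>n. L2_norm D (\<lambda>x. u n s x - ubar x)) \<longlonglongrightarrow> 0)))
       \<and> (lam = 0 \<longrightarrow>
            (AE s in P. \<exists>ubar \<in> {v \<in> Uad D ua ub. \<forall>w\<in>Uad D ua ub. jfun D M a yD lam v \<le> jfun D M a yD lam w}.
               \<forall>v\<in>L2 D. (\<lambda>n. L2_inner D (u n s) v) \<longlonglongrightarrow> L2_inner D ubar v))"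
proof -
  have D: "open D" "bounded D" using dom by (auto simp: lipschitz_domain_def)
  obtain R0 where R0: "\<And>x. x \<in> D \<Longrightarrow> norm x \<le> R0" using D(2) by (auto simp: bounded_iff)
  define R where "R = max R0 0"
  interpret E: elliptic D amin amax R
    using D a_bnds R0 by unfold_locales (auto simp: R_def le_max_iff_disj)
  define A where "A \<omega> = l2_of D (\<lambda>x. a x \<omega>)" for \<omega>
  have a_abs: "\<bar>a x \<omega>\<bar> \<le> amax" if "x \<in> D" "\<omega> \<in> space M" for x \<omega>
    using a_bounds[OF that] a_bnds by auto
  have a_l2_of: "\<And>\<omega>. \<omega> \<in> space M \<Longrightarrow> sqint_on D (\<lambda>x. a x \<omega>)"
    "(\<lambda>\<omega>. l2_of D (\<lambda>x. a x \<omega>)) \<in> borel_measurable M"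
    using l2_of_measurable[OF D a_meas, where c=amax] a_abs by auto
  have a_le: "amin \<le> a x \<omega> \<and> a x \<omega> \<le> amax" if "\<omega> \<in> space M" "x \<in> D" for x \<omega>
    using a_bounds[OF that(2,1)] by auto
  have sol: "weak_sol D (\<lambda>x. a x \<omega>) f v \<longleftrightarrow> sqint_on D v \<and> l2_of D v = E.T (A \<omega>) (l2_of D f)"
    if "\<omega> \<in> space M" "sqint_on D f" for \<omega> f v
    unfolding A_def by (rule E.weak_sol_iff[OF a_l2_of(1)[OF that(1)] a_le[OF that(1)] that(2)])
  have \<xi>_space: "\<xi> n s \<in> space M" if "s \<in> space P" for n s
    using measurable_space[OF \<xi>_meas that] .
  have sq_yD: "sqint_on D yD" and sq_u0: "sqint_on D u0" using yD u0 by (simp_all add: L2_iff[OF D(1)])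
  have sq_Uad: "sqint_on D v" if "v \<in> Uad D ua ub" for v
    using that by (simp add: Uad_def L2_iff[OF D(1)])
  have sq_u: "sqint_on D (u n s)" if s: "s \<in> space P" for n s
  proof (cases n)
    case 0
    then show ?thesis using u_init[OF s] sq_u0 by simp
  next
    case (Suc m)
    then show ?thesis using u_step[OF s, of m] sq_Uad by simp
  qed
  define K where "K = l2_of D ` Uad D ua ub"
  note K = Uad_closed[OF D(1) ua ub uab, folded K_def] Uad_convex[OF D(1) ua ub uab, folded K_def]
    Uad_bounded[OF D(1) ua ub uab, folded K_def] Uad_nonempty[OF D(1) ua ub uab, folded K_def]
  note norm_l2_of_diff = L2_norm_diff_eq[OF D(1)]
  interpret S: projected_sgd M P "\<lambda>\<omega>. E.T (A \<omega>)" "4 * R\<^sup>2 / amin" lam "l2_of D yD" "l2_of D u0" K \<xi> \<tau> "\<lambda>n s. l2_of D (u n s)"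
  proof (intro projected_sgd.intro probM probP projected_sgd_axioms.intro)
    show "(\<lambda>(\<omega>, v). E.T (A \<omega>) v) \<in> borel_measurable (M \<Otimes>\<^sub>M borel)"
    proof -
      have "A \<in> borel_measurable M" unfolding A_def[abs_def] by (rule a_l2_of(2))
      then have "(\<lambda>p. A (fst p)) \<in> borel_measurable (M \<Otimes>\<^sub>M borel)" by measurable
      moreover have "snd \<in> borel_measurable (M \<Otimes>\<^sub>M (borel :: ('a, real) l2 measure))" by measurable
      ultimately have "(\<lambda>p. E.T (A (fst p)) (snd p)) \<in> borel_measurable (M \<Otimes>\<^sub>M borel)"
        by (rule borel_measurable_continuous_Pair[OF _ _ E.T_continuous])
      then show ?thesis by (simp add: split_beta)
    qed
    \<comment> \<open>The given functions \<open>y\<close> and \<open>p\<close> are arbitrary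
      solutions, but their classes are determined by \<open>E.T\<close>. Minimality of the distance
      over admissible functions becomes minimality over \<open>K\<close>.\<close>
    show "l2_of D (u (Suc n) s) = hproj K (l2_of D (u n s) - \<tau> n *\<^sub>R (lam *\<^sub>R l2_of D (u n s) -
        E.T (A (\<xi> n s)) (l2_of D yD - E.T (A (\<xi> n s)) (l2_of D (u n s)))))" if s: "s \<in> space P" for n s
    proof (rule hproj_eqI[OF K(1,2), symmetric])
      have y: "sqint_on D (y n s)" "l2_of D (y n s) = E.T (A (\<xi> n s)) (l2_of D (u n s))"
        using y_eq[OF s, of n] sol[OF \<xi>_space[OF s] sq_u[OF s]] by auto
      have p: "sqint_on D (p n s)" "l2_of D (p n s) = E.T (A (\<xi> n s)) (l2_of D (\<lambda>x. yD x - y n s x))"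
        using p_eq[OF s, of n] sol[OF \<xi>_space[OF s] sqint_on_diff[OF sq_yD y(1)]]
        by (auto simp: adj_sol_eq_weak_sol)
      define z where "z x = u n s x - \<tau> n *\<^sub>R (lam *\<^sub>R u n s x - p n s x)" for x
      have z: "sqint_on D z"
        unfolding z_def by (intro sqint_on_diff sqint_on_scaleR sq_u[OF s] p(1))
      have l2_of_z: "l2_of D z = l2_of D (u n s) - \<tau> n *\<^sub>R (lam *\<^sub>R l2_of D (u n s) -
          E.T (A (\<xi> n s)) (l2_of D yD - E.T (A (\<xi> n s)) (l2_of D (u n s))))"
        unfolding z_def
        by (simp only: l2_of_diff l2_of_scaleR sqint_on_diff sqint_on_scaleR sq_u[OF s] p y(2) sq_yD y(1))
      show "l2_of D (u (Suc n) s) \<in> K" using u_step[OF s, of n] by (auto simp: K_def)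
      fix v assume "v \<in> K"
      then obtain w where w: "w \<in> Uad D ua ub" "v = l2_of D w" by (auto simp: K_def)
      have "L2_norm D (\<lambda>x. z x - u (Suc n) s x) \<le> L2_norm D (\<lambda>x. z x - w x)"
        using u_step[OF s, of n] w(1) by (simp add: z_def)
      then have "norm (l2_of D z - l2_of D (u (Suc n) s)) \<le> norm (l2_of D z - v)"
        by (simp add: norm_l2_of_diff z sq_u[OF s] sq_Uad w)
      then show "norm (l2_of D (u n s) - \<tau> n *\<^sub>R (lam *\<^sub>R l2_of D (u n s) -
          E.T (A (\<xi> n s)) (l2_of D yD - E.T (A (\<xi> n s)) (l2_of D (u n s)))) - l2_of D (u (Suc n) s))
        \<le> norm (l2_of D (u n s) - \<tau> n *\<^sub>R (lam *\<^sub>R l2_of D (u n s) -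
          E.T (A (\<xi> n s)) (l2_of D yD - E.T (A (\<xi> n s)) (l2_of D (u n s)))) - v)"
        unfolding l2_of_z .
    qed
    show "linear (E.T (A \<omega>))" for \<omega> by (rule E.T_linear)
    show "E.T (A \<omega>) v \<bullet> w = v \<bullet> E.T (A \<omega>) w" for \<omega> v w by (rule E.T_sym)
    show "norm (E.T (A \<omega>) v) \<le> 4 * R\<^sup>2 / amin * norm v" for \<omega> v by (rule E.T_bound)
    show "K \<noteq> {}" by (rule K(4))
  qed (use lam \<xi>_meas \<xi>_distr \<xi>_indep \<tau>_pos \<tau>_sum \<tau>_sq K u_init in
      \<open>auto simp del: ex_in_conv\<close>)
  have j_eq: "jfun D M a yD lam v = S.j (l2_of D v)" if "v \<in> Uad D ua ub" for v
  proof -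
    have v: "sqint_on D v" by (rule sq_Uad[OF that])
    have "(\<integral>\<omega>. 1/2 * (L2_norm D (\<lambda>x. state D a \<omega> v x - yD x))\<^sup>2 \<partial>M) = S.j0 (l2_of D v)"
      unfolding S.j0_def
    proof (rule Bochner_Integration.integral_cong)
      fix \<omega> assume \<omega>: "\<omega> \<in> space M"
      \<comment> \<open>A representative of the solution class shows that a weak solution exists, so
        the choice in \<open>state\<close> yields one. All choices have the same class, and the
        objective depends only on the class.\<close>
      define w where "w = rep_l2 (E.T (A \<omega>) (l2_of D v))"
      have "l2_of D w = E.T (A \<omega>) (l2_of D v)"
        using H01_restrict(1)[OF D(1) E.sol_V] by (simp add: w_def E.T_def l2_restrict_def[OF D(1)])
      then have "weak_sol D (\<lambda>x. a x \<omega>) v w"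
        using sol[OF \<omega> v] sqint_on_rep[OF D(1)] by (simp add: w_def)
      then have "weak_sol D (\<lambda>x. a x \<omega>) v (state D a \<omega> v)"
        unfolding state_def by (rule someI[of "weak_sol D (\<lambda>x. a x \<omega>) v"])
      then have st: "sqint_on D (state D a \<omega> v)" "l2_of D (state D a \<omega> v) = E.T (A \<omega>) (l2_of D v)"
        using sol[OF \<omega> v] by auto
      then show "1/2 * (L2_norm D (\<lambda>x. state D a \<omega> v x - yD x))\<^sup>2 = S.J \<omega> (l2_of D v)"
        using norm_l2_of_diff[OF st(1) sq_yD] by (simp add: S.J_def)
    qed simp
    moreover have "L2_norm D v = norm (l2_of D v)"
      using L2_norm_eq[OF D(1)] v by (simp add: L2_iff[OF D(1)])
    ultimately show ?thesis by (simp add: jfun_def S.j_def)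
  qed
  have min_iff: "l2_of D v \<in> S.minimizers \<longleftrightarrow> (\<forall>w\<in>Uad D ua ub. jfun D M a yD lam v \<le> jfun D M a yD lam w)"
    if "v \<in> Uad D ua ub" for v
    using that unfolding S.minimizers_def by (auto simp: K_def j_eq)
  have min_obtain: "\<exists>v\<in>Uad D ua ub. w = l2_of D v" if "w \<in> S.minimizers" for w
    using that unfolding S.minimizers_def by (auto simp: K_def)
  show ?thesis
  proof (intro conjI impI)
    assume "lam \<noteq> 0"
    then obtain w where w: "w \<in> S.minimizers" "\<forall>v\<in>S.minimizers. v = w" "AE s in P. (\<lambda>n. l2_of D (u n s)) \<longlonglongrightarrow> w"
      using S.strong_convergence by blast
    obtain v where v: "v \<in> Uad D ua ub" "w = l2_of D v" using min_obtain[OF w(1)] by blast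
    have "AE s in P. (\<lambda>n. L2_norm D (\<lambda>x. u n s x - v x)) \<longlonglongrightarrow> 0"
      using w(3) AE_space
    proof eventually_elim
      case (elim s)
      then have "(\<lambda>n. norm (l2_of D (u n s) - l2_of D v)) \<longlonglongrightarrow> 0"
        by (simp add: v(2) tendsto_norm_zero_iff LIM_zero_iff)
      then show ?case using norm_l2_of_diff[OF sq_u sq_Uad[OF v(1)]] elim(2) by simp
    qed
    moreover have "\<forall>v'\<in>Uad D ua ub. (\<forall>w\<in>Uad D ua ub. jfun D M a yD lam v' \<le> jfun D M a yD lam w)
        \<longrightarrow> L2_norm D (\<lambda>x. v' x - v x) = 0"
    proof (intro ballI impI)
      fix v' assume v': "v' \<in> Uad D ua ub" "\<forall>w\<in>Uad D ua ub. jfun D M a yD lam v' \<le> jfun D M a yD lam w"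
      then have "l2_of D v' = l2_of D v" using min_iff[OF v'(1)] w(2) v(2) by blast
      then show "L2_norm D (\<lambda>x. v' x - v x) = 0"
        using norm_l2_of_diff[OF sq_Uad[OF v'(1)] sq_Uad[OF v(1)]] by simp
    qed
    ultimately show "\<exists>ubar\<in>Uad D ua ub.
               (\<forall>w\<in>Uad D ua ub. jfun D M a yD lam ubar \<le> jfun D M a yD lam w) \<and>
               (\<forall>v\<in>Uad D ua ub. (\<forall>w\<in>Uad D ua ub. jfun D M a yD lam v \<le> jfun D M a yD lam w)
                    \<longrightarrow> L2_norm D (\<lambda>x. v x - ubar x) = 0) \<and>
               (AE s in P. (\<lambda>n. L2_norm D (\<lambda>x. u n s x - ubar x)) \<longlonglongrightarrow> 0)"
      using v w(1) min_iff[OF v(1)] by (intro bexI[OF _ v(1)] conjI) auto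
  next
    show "AE s in P. \<exists>ubar\<in>{v \<in> Uad D ua ub. \<forall>w\<in>Uad D ua ub. jfun D M a yD lam v \<le> jfun D M a yD lam w}.
               \<forall>v\<in>L2 D. (\<lambda>n. L2_inner D (u n s) v) \<longlonglongrightarrow> L2_inner D ubar v"
      using S.weak_convergence AE_space
    proof eventually_elim
      case (elim s)
      then obtain w where w: "w \<in> S.minimizers" "\<And>v. (\<lambda>n. l2_of D (u n s) \<bullet> v) \<longlonglongrightarrow> w \<bullet> v" by blast
      obtain ubar where ubar: "ubar \<in> Uad D ua ub" "w = l2_of D ubar" using min_obtain[OF w(1)] by blast
      have "(\<lambda>n. L2_inner D (u n s) v) \<longlonglongrightarrow> L2_inner D ubar v" if "v \<in> L2 D" for v
      proof -
        have v: "sqint_on D v" using that by (simp add: L2_iff[OF D(1)])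
        have inner: "L2_inner D f v = l2_of D f \<bullet> l2_of D v" if "sqint_on D f" for f
          using integral_inner_eq[OF D(1) that v] by (simp add: L2_inner_def)
        show ?thesis
          using w(2)[of "l2_of D v"] elim(2) sq_u sq_Uad[OF ubar(1)] by (simp add: inner ubar(2))
      qed
      then show ?case using ubar w(1) min_iff[OF ubar(1)] by (intro bexI[of _ ubar]) auto
    qed
  qed
qed

end
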